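(* Suppose that every $f_i$, $i\in[n]$, is differentiable with $\|\nabla f_i(x)-\nabla f_i(y)\|\le L\|x-y\|$ for all $x,y\in\mathbb{R}^d$ (for some constant $L>0$), and that $h$ is convex and proximable. Run Algorithm VR-SZD with $\gamma=\frac{\sqrt{\ell b}}{10Lm\sqrt d}$ and $m\ge\sqrt b$, and set $\Delta:=\frac12-L\gamma$. Then: (i) If $\beta_\tau=\frac{\beta}{d}(\tau+1)^{-\alpha}$ with $\alpha>1/2$ and $\beta>0$, then $$\eta_m^T\le 40\,\frac{L\sqrt d}{\sqrt{\ell b}}\,\frac{F(x_0^0)-\min F}{T+1}+\mathcal{O}\!\left(\frac1{T+1}\right),$$ where the constant hidden in $\mathcal{O}$ is independent of $T$. (ii) If $\beta_\tau=\frac{\beta}{d}$ with $\beta>0$, then $$\eta_m^T\le 40\,\frac{L\sqrt d}{\sqrt{\ell b}}\,\frac{F(x_0^0)-\min F}{T+1}+C_2\beta^2,\qquad C_2:=4\left(\frac{3d}{\ell b}+2+3d\right)\frac{L^2}{d}.$$ (iii) Let $\varepsilon\in(0,1)$, let $T$ satisfy $T+1\ge\frac{80L\sqrt d\,(F(x_0^0)-\min F)}{\sqrt{\ell b}\,\Delta}\,\varepsilon^{-1}$, and choose $\beta_\tau=\sqrt{\frac{\varepsilon}{2C_3}}$ for all $\tau$, where $C_3=4\left(\frac{3d}{\ell b}+2+3d\right)L^2d$. Then $\eta_m^T\le\varepsilon$, and the complexity is $$\mathcal{O}\!\left(\left(n\frac{d\sqrt d}{\sqrt{\ell b}}+\frac{mb(\ell+1)\sqrt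 d}{\sqrt{\ell b}}\right)\frac1\varepsilon\right).$$ In particular, choosing $b=\lceil n^{2/3}\rceil$, $m=\lceil\sqrt b\rceil$ and $\ell=\lceil d/c\rceil$ for some $c>0$ (with $1\le\ell\le d$), the complexity is $\mathcal{O}(d\,n^{2/3}\varepsilon^{-1})$.
   Context: Problem: minimize over $x\in\mathbb{R}^d$ the function $F(x):=f(x)+h(x)$ with $f(x):=\frac1n\sum_{i=1}^n f_i(x)$, where $f_i:\mathbb{R}^d\to\mathbb{R}$ are differentiable (possibly non-convex) and $h:\mathbb{R}^d\to\mathbb{R}\cup\{+\infty\}$ is convex, possibly non-differentiable, and proximable, meaning that for all $x\in\mathbb{R}^d$, $\gamma>0$ the point $\mathrm{prox}_{\gamma h}(x):=\arg\min_y\{h(y)+\frac{1}{2\gamma}\|y-x\|^2\}$ is well defined (and computable). $\min F$ denotes the minimum value of $F$, assumed to exist. $[n]=\{1,\dots,n\}$, $(e_j)_{j=1}^d$ is the canonical basis of $\mathbb{R}^d$, and $O(d)$ is the group of orthogonal $d\times d$ matrices; "uniformly from $O(d)$" means according to the normalized Haar measure. Finite-difference surrogates: for $\beta>0$, $g(x,\beta):=\sum_{j=1}^d\frac{f(x+\beta e_j)-f(x)}{\beta}e_j$; for $i\in[n]$, $G\in O(d)$, $\hat g_i(x,G,\beta):=\frac{d}{\ell}\sum_{j=1}^\ell\frac{f_i(x+\beta Ge_j)-f_i(x)}{\beta}Ge_j$. Algorithm VR-SZD. Input: $x_0^0\in\mathbb{R}^d$, $T,m\in\mathbb{N}_+$,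 stepsize $\gamma>0$, $(\beta_\tau)_{\tau\in\mathbb{N}}\subset(0,\infty)$, an integer $1\le\ell\le d$, and a batch size $b\in\mathbb{N}_+$. For $\tau=0,\dots,T$: for $k=0,\dots,m-1$, sample $i_{1,k}^\tau,\dots,i_{b,k}^\tau$ uniformly from $[n]$ with replacement and $G_{1,k}^\tau,\dots,G_{b,k}^\tau$ uniformly from $O(d)$ (all independent of each other and of the past), and set $$v_k^\tau=\frac1b\sum_{j=1}^b\Big(\hat g_{i_{j,k}^\tau}(x_k^\tau,G_{j,k}^\tau,\beta_\tau)-\hat g_{i_{j,k}^\tau}(x_0^\tau,G_{j,k}^\tau,\beta_\tau)\Big)+g(x_0^\tau,\beta_\tau),\qquad x_{k+1}^\tau=\mathrm{prox}_{\gamma h}(x_k^\tau-\gamma v_k^\tau);$$ then set $x_0^{\tau+1}=x_m^\tau$. Gradient mapping: $\mathcal{G}_\gamma(x):=\frac1\gamma\big(x-\mathrm{prox}_{\gamma h}(x-\gamma\nabla f(x))\big)$. Convergence measure: $\eta_m^T:=\frac{1}{(T+1)m}\sum_{\tau=0}^T\sum_{k=0}^{m-1}\mathbb{E}\big[\|\mathcal{G}_\gamma(x_k^\tau)\|^2\big]$. Complexity: the total number of evaluations of the component functions $f_i$ used by the algorithm to guarantee $\eta_m^T\le\varepsilon$, i.e. with $T$ the smallest admissible value; each outer iteration $\tau$ costs $n(d+1)+2mb(\ell+1)$ evaluations. The $\mathcal{O}$ in the complexity statements is understood as $\varepsilon\to0$, with hidden constant depending only on $L$ and $F(x_0^0)-\min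 F$ (and on $c$ in the last statement). *)

theory Defs
  imports "HOL-Probability.Probability"
begin

section \<open>The composite problem\<close>

definition gradient :: "('a::real_inner \<Rightarrow> real) \<Rightarrow> 'a \<Rightarrow> 'a" where
  "gradient f x = (THE D. GDERIV f x :> D)"

definition avg_fun :: "nat \<Rightarrow> (nat \<Rightarrow> 'a \<Rightarrow> real) \<Rightarrow> 'a \<Rightarrow> real" where
  "avg_fun n f x = (\<Sum>i=1..n. f i x) / real n"

definition objective :: "nat \<Rightarrow> (nat \<Rightarrow> 'a \<Rightarrow> real) \<Rightarrow> ('a \<Rightarrow> ereal) \<Rightarrow> 'a \<Rightarrow> ereal" where
  "objective n f h x = ereal (avg_fun n f x) + h x"

definition convex_ereal :: "('a::real_vector \<Rightarrow> ereal) \<Rightarrow> bool" where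
  "convex_ereal h \<longleftrightarrow>
     (\<forall>x y. \<forall>t\<in>{0..1}. h ((1 - t) *\<^sub>R x + t *\<^sub>R y) \<le> ereal (1 - t) * h x + ereal t * h y)"

definition prox_objective :: "real \<Rightarrow> ('a::real_normed_vector \<Rightarrow> ereal) \<Rightarrow> 'a \<Rightarrow> 'a \<Rightarrow> ereal" where
  "prox_objective \<gamma> h x y = h y + ereal ((norm (y - x))\<^sup>2 / (2 * \<gamma>))"

definition prox :: "real \<Rightarrow> ('a::real_normed_vector \<Rightarrow> ereal) \<Rightarrow> 'a \<Rightarrow> 'a" where
  "prox \<gamma> h x = arg_min (prox_objective \<gamma> h x) (\<lambda>_. True)"

text \<open>Well-definedness of the proximal point means existence and uniqueness of the minimizer; this
  excludes \<open>h\<close> being identically \<open>\<infinity>\<close>. Computability is not a mathematical restriction and is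
  not modelled.\<close>

definition proximable :: "('a::real_normed_vector \<Rightarrow> ereal) \<Rightarrow> bool" where
  "proximable h \<longleftrightarrow> (\<forall>x. \<forall>\<gamma>>0. \<exists>!y. is_arg_min (prox_objective \<gamma> h x) (\<lambda>_. True) y)"

definition gradient_mapping ::
  "real \<Rightarrow> ('a::real_inner \<Rightarrow> real) \<Rightarrow> ('a \<Rightarrow> ereal) \<Rightarrow> 'a \<Rightarrow> 'a" where
  "gradient_mapping \<gamma> f h x = (1 / \<gamma>) *\<^sub>R (x - prox \<gamma> h (x - \<gamma> *\<^sub>R gradient f x))"


section \<open>Finite-difference surrogates\<close>

text \<open>The argument \<open>e\<close> is the canonical basis, numbered from \<open>1\<close> to \<open>CARD('d)\<close>: below it is only
  required to be a bijection from \<open>{1..CARD('d)}\<close> to \<open>Basis\<close>, since the index type \<open>'d\<close> carries no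
  order.\<close>

definition fd_full ::
  "(nat \<Rightarrow> real^'d) \<Rightarrow> (real^'d \<Rightarrow> real) \<Rightarrow> real^'d \<Rightarrow> real \<Rightarrow> real^'d" where
  "fd_full e f x \<beta> = (\<Sum>j=1..CARD('d). ((f (x + \<beta> *\<^sub>R e j) - f x) / \<beta>) *\<^sub>R e j)"

definition fd_orth ::
  "(nat \<Rightarrow> real^'d) \<Rightarrow> nat \<Rightarrow> (real^'d \<Rightarrow> real) \<Rightarrow> real^'d \<Rightarrow> real^'d^'d \<Rightarrow> real \<Rightarrow> real^'d" where
  "fd_orth e l f x Q \<beta> = (real CARD('d) / real l) *\<^sub>R
     (\<Sum>j=1..l. ((f (x + \<beta> *\<^sub>R (Q *v e j)) - f x) / \<beta>) *\<^sub>R (Q *v e j))"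


section \<open>The algorithm VR-SZD\<close>

text \<open>The iterates are functions of the sampled indices \<open>I \<tau> k j\<close> and orthogonal matrices
  \<open>Q \<tau> k j\<close>, where \<open>k\<close> starts at \<open>0\<close> and \<open>j\<close> ranges over \<open>{1..b}\<close>. They do not depend on the
  number \<open>T\<close> at which the outer loop is stopped.\<close>

definition vr_direction ::
  "(nat \<Rightarrow> real^'d) \<Rightarrow> nat \<Rightarrow> (nat \<Rightarrow> real^'d \<Rightarrow> real) \<Rightarrow> nat \<Rightarrow> nat \<Rightarrow> real
    \<Rightarrow> (nat \<Rightarrow> nat) \<Rightarrow> (nat \<Rightarrow> real^'d^'d) \<Rightarrow> real^'d \<Rightarrow> real^'d \<Rightarrow> real^'d" where
  "vr_direction e n f l b \<beta> I Q x0 x =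
     (1 / real b) *\<^sub>R (\<Sum>j=1..b. fd_orth e l (f (I j)) x (Q j) \<beta> - fd_orth e l (f (I j)) x0 (Q j) \<beta>)
     + fd_full e (avg_fun n f) x0 \<beta>"

primrec vr_inner ::
  "(nat \<Rightarrow> real^'d) \<Rightarrow> nat \<Rightarrow> (nat \<Rightarrow> real^'d \<Rightarrow> real) \<Rightarrow> (real^'d \<Rightarrow> ereal) \<Rightarrow> nat \<Rightarrow> nat \<Rightarrow> real \<Rightarrow> real
    \<Rightarrow> (nat \<Rightarrow> nat \<Rightarrow> nat) \<Rightarrow> (nat \<Rightarrow> nat \<Rightarrow> real^'d^'d) \<Rightarrow> real^'d \<Rightarrow> nat \<Rightarrow> real^'d" where
  "vr_inner e n f h l b \<gamma> \<beta> I Q x0 0 = x0"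
| "vr_inner e n f h l b \<gamma> \<beta> I Q x0 (Suc k) =
     (let x = vr_inner e n f h l b \<gamma> \<beta> I Q x0 k
      in prox \<gamma> h (x - \<gamma> *\<^sub>R vr_direction e n f l b \<beta> (I k) (Q k) x0 x))"

primrec vr_outer ::
  "(nat \<Rightarrow> real^'d) \<Rightarrow> nat \<Rightarrow> (nat \<Rightarrow> real^'d \<Rightarrow> real) \<Rightarrow> (real^'d \<Rightarrow> ereal) \<Rightarrow> nat \<Rightarrow> nat \<Rightarrow> nat \<Rightarrow> real
    \<Rightarrow> (nat \<Rightarrow> real) \<Rightarrow> (nat \<Rightarrow> nat \<Rightarrow> nat \<Rightarrow> nat) \<Rightarrow> (nat \<Rightarrow> nat \<Rightarrow> nat \<Rightarrow> real^'d^'d)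
    \<Rightarrow> real^'d \<Rightarrow> nat \<Rightarrow> real^'d" where
  "vr_outer e n f h l b m \<gamma> \<beta> I Q x00 0 = x00"
| "vr_outer e n f h l b m \<gamma> \<beta> I Q x00 (Suc \<tau>) =
     vr_inner e n f h l b \<gamma> (\<beta> \<tau>) (I \<tau>) (Q \<tau>) (vr_outer e n f h l b m \<gamma> \<beta> I Q x00 \<tau>) m"

definition vr_szd ::
  "(nat \<Rightarrow> real^'d) \<Rightarrow> nat \<Rightarrow> (nat \<Rightarrow> real^'d \<Rightarrow> real) \<Rightarrow> (real^'d \<Rightarrow> ereal) \<Rightarrow> nat \<Rightarrow> nat \<Rightarrow> nat \<Rightarrow> real
    \<Rightarrow> (nat \<Rightarrow> real) \<Rightarrow> (nat \<Rightarrow> nat \<Rightarrow> nat \<Rightarrow> nat) \<Rightarrow> (nat \<Rightarrow> nat \<Rightarrow> nat \<Rightarrow> real^'d^'d)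
    \<Rightarrow> real^'d \<Rightarrow> nat \<Rightarrow> nat \<Rightarrow> real^'d" where
  "vr_szd e n f h l b m \<gamma> \<beta> I Q x00 \<tau> k =
     vr_inner e n f h l b \<gamma> (\<beta> \<tau>) (I \<tau>) (Q \<tau>) (vr_outer e n f h l b m \<gamma> \<beta> I Q x00 \<tau>) k"


section \<open>Sampling\<close>

text \<open>A left-invariant Borel probability measure on the compact group of orthogonal matrices
  exists and is unique, so this predicate determines \<open>H\<close>.\<close>

definition normalized_haar_orth :: "(real^'d^'d) measure \<Rightarrow> bool" where
  "normalized_haar_orth H \<longleftrightarrow>
     prob_space H \<and>
     sets H = sets (restrict_space borel {Q. orthogonal_matrix Q}) \<and>
     (\<forall>Q. orthogonal_matrix Q \<longrightarrow> distr H H (\<lambda>R. Q ** R) = H)"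

text \<open>Joint independence of all indices and all matrices, with the prescribed laws: the pairs
  \<open>(I \<tau> k j, Q \<tau> k j)\<close> form an independent family, and the law of each pair is a product.\<close>

definition vr_samples ::
  "'w measure \<Rightarrow> nat \<Rightarrow> nat \<Rightarrow> nat
    \<Rightarrow> (nat \<Rightarrow> nat \<Rightarrow> nat \<Rightarrow> 'w \<Rightarrow> nat) \<Rightarrow> (nat \<Rightarrow> nat \<Rightarrow> nat \<Rightarrow> 'w \<Rightarrow> real^'d^'d) \<Rightarrow> bool" where
  "vr_samples M n m b I Q \<longleftrightarrow>
     prob_space M \<and>
     (\<exists>H. normalized_haar_orth H \<and>
       prob_space.indep_vars M (\<lambda>_. uniform_count_measure {1..n} \<Otimes>\<^sub>M H)
         (\<lambda>(\<tau>, k, j) \<omega>. (I \<tau> k j \<omega>, Q \<tau> k j \<omega>)) (UNIV \<times> {..<m} \<times> {1..b}) \<and>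
       (\<forall>\<tau>. \<forall>k<m. \<forall>j\<in>{1..b}.
         distr M (uniform_count_measure {1..n} \<Otimes>\<^sub>M H) (\<lambda>\<omega>. (I \<tau> k j \<omega>, Q \<tau> k j \<omega>))
           = uniform_count_measure {1..n} \<Otimes>\<^sub>M H))"


section \<open>Convergence measure and complexity\<close>

text \<open>The expectations are nonnegative Lebesgue integrals, so an upper bound on
  \<open>convergence_measure\<close> entails that they are finite.\<close>

definition convergence_measure ::
  "'w measure \<Rightarrow> (nat \<Rightarrow> real^'d) \<Rightarrow> nat \<Rightarrow> (nat \<Rightarrow> real^'d \<Rightarrow> real) \<Rightarrow> (real^'d \<Rightarrow> ereal)
    \<Rightarrow> nat \<Rightarrow> nat \<Rightarrow> nat \<Rightarrow> real \<Rightarrow> (nat \<Rightarrow> real)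
    \<Rightarrow> (nat \<Rightarrow> nat \<Rightarrow> nat \<Rightarrow> 'w \<Rightarrow> nat) \<Rightarrow> (nat \<Rightarrow> nat \<Rightarrow> nat \<Rightarrow> 'w \<Rightarrow> real^'d^'d)
    \<Rightarrow> real^'d \<Rightarrow> nat \<Rightarrow> ereal" where
  "convergence_measure M e n f h l b m \<gamma> \<beta> I Q x00 T = enn2ereal
     ((\<Sum>\<tau>=0..T. \<Sum>k<m. \<integral>\<^sup>+\<omega>. ennreal ((norm (gradient_mapping \<gamma> (avg_fun n f) h
          (vr_szd e n f h l b m \<gamma> \<beta> (\<lambda>\<tau> k j. I \<tau> k j \<omega>) (\<lambda>\<tau> k j. Q \<tau> k j \<omega>) x00 \<tau> k)))\<^sup>2) \<partial>M)
      / of_nat ((T + 1) * m))"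

definition vr_stepsize :: "real \<Rightarrow> nat \<Rightarrow> nat \<Rightarrow> nat \<Rightarrow> nat \<Rightarrow> real" where
  "vr_stepsize L d l b m = sqrt (real l * real b) / (10 * L * real m * sqrt (real d))"

definition vr_Delta :: "real \<Rightarrow> nat \<Rightarrow> nat \<Rightarrow> nat \<Rightarrow> nat \<Rightarrow> real" where
  "vr_Delta L d l b m = 1 / 2 - L * vr_stepsize L d l b m"

text \<open>The argument \<open>gap\<close> stands for the initial optimality gap, which is \<open>\<infinity>\<close> if the
  starting point lies outside the domain of \<open>h\<close>; then no \<open>T\<close> is admissible.\<close>

definition admissible_T :: "real \<Rightarrow> ereal \<Rightarrow> nat \<Rightarrow> nat \<Rightarrow> nat \<Rightarrow> nat \<Rightarrow> real \<Rightarrow> nat \<Rightarrow> bool" where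
  "admissible_T L gap d l b m \<epsilon> T \<longleftrightarrow> 1 \<le> T \<and>
     ereal (real T + 1) \<ge>
       ereal (80 * L * sqrt (real d) / (sqrt (real l * real b) * vr_Delta L d l b m)) * gap * ereal (1 / \<epsilon>)"

text \<open>An outer iteration evaluates every component function at \<open>d + 1\<close> points (for \<open>fd_full\<close>), and
  in each of its \<open>m\<close> inner iterations evaluates \<open>b\<close> component functions at \<open>l + 1\<close> points around
  each of two centres (for \<open>fd_orth\<close>).\<close>

definition vr_evaluations :: "nat \<Rightarrow> nat \<Rightarrow> nat \<Rightarrow> nat \<Rightarrow> nat \<Rightarrow> nat \<Rightarrow> nat" where
  "vr_evaluations d n l b m T = (\<Sum>\<tau>=0..T. n * (d + 1) + 2 * m * b * (l + 1))"

text \<open>The complexity depends on the problem instance only through the dimension \<open>d\<close>, the number \<open>n\<close> of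
  component functions, the parameters \<open>l\<close>, \<open>b\<close>, \<open>m\<close>, the constant \<open>L\<close> and the gap. That a hidden
  constant depends on \<open>L\<close> and the gap alone can therefore be expressed by choosing it before
  quantifying over all these other numbers, including the dimension, which would be impossible
  for a dimension given by a type.\<close>

definition vr_complexity :: "real \<Rightarrow> ereal \<Rightarrow> nat \<Rightarrow> nat \<Rightarrow> nat \<Rightarrow> nat \<Rightarrow> nat \<Rightarrow> real \<Rightarrow> nat" where
  "vr_complexity L gap d n l b m \<epsilon> =
     vr_evaluations d n l b m (LEAST T. admissible_T L gap d l b m \<epsilon> T)"

end

theory Submission
  imports Defs
begin

text \<open>The method is an inexact proximal gradient method, and everything rests on the size of the error of
its direction. Fix a step with centre \<open>x0\<close>, current point \<open>x\<close>, direction \<open>v\<close> and smoothing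
parameter \<open>\<beta>\<close>. For an \<open>L\<close>-smooth function a forward difference along a unit vector \<open>u\<close> differs
from the directional derivative by at most \<open>L \<beta> / 2\<close>. Replacing all differences by directional
derivatives therefore changes \<open>v\<close> by at most \<open>3/2 d L \<beta>\<close> on every sample path
(\<open>direction_error_decomposition\<close>). What is left is linear in the gradients: with the sketch
\<open>S Q \<delta> = (d / l) \<Sum>j\<le>l. \<langle>\<delta>, Q e j\<rangle> Q e j\<close>, the remaining error, called \<open>noise\<close> below, is the
average of \<open>b\<close> independent copies of \<open>S Q (\<nabla>f i x - \<nabla>f i x0)\<close> minus its mean.

Invariance of the Haar measure makes the second moment of \<open>\<langle>u, Q e\<rangle>\<close> a function of the norm of \<open>u\<close>
alone, and a trace computation gives \<open>norm u ^ 2 / d\<close> (\<open>frame_second_moment_square\<close>). Hence the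
sketch is unbiased and multiplies the expected squared norm by only \<open>d / l\<close>, and independence gains
another factor \<open>1 / b\<close> (\<open>average_variance_bound\<close>): the expected squared noise is at most
\<open>d L^2 / (l b)\<close> times the expectation of \<open>norm (x - x0) ^ 2\<close> (\<open>noise_second_moment\<close>).

On the deterministic side, \<open>inexact_prox_gradient_descent\<close> says that a step lowers the objective by
\<open>\<gamma> \<Delta>\<close> times the squared gradient mapping plus about \<open>1 / (2 \<gamma>)\<close> times the squared step length, up
to \<open>\<gamma> / 2\<close> times the squared error of the direction. Summed over an epoch, the squared step lengths
control the squared displacements from the centre up to a factor \<open>m^2\<close>
(\<open>sum_square_displacement_le\<close>). With \<open>\<gamma>^2 = l b / (100 L^2 m^2 d)\<close> this gain exceeds the loss
\<open>\<gamma> d L^2 / (l b) norm (x - x0) ^ 2\<close> caused by the noise, so the noise disappears from the balance and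
only the smoothing error remains (\<open>expected_gradient_mapping_bound\<close>). All iterates are bounded by
deterministic constants, so every expectation in this argument is finite.

The resulting estimate has the factor \<open>25 L sqrt d / sqrt (l b)\<close> in front of the gap divided by
\<open>T + 1\<close>, and \<open>45/8 d^2 L^2\<close> in front of the average of \<open>\<beta> \<tau> ^ 2\<close>
(\<open>convergence_measure_bound\<close>); the rates are instances of it. For the complexity, the least
admissible number of epochs is at most a constant, depending on \<open>L\<close> and the gap, times
\<open>sqrt d / sqrt (l b) / \<epsilon>\<close> plus \<open>2\<close> (\<open>least_admissible_le\<close>), and the cost of the surplus iterations is
dominated once \<open>\<epsilon>\<close> is small.\<close>

section \<open>Gradients and quadratic bounds for smooth functions\<close>

lemma gradient_eqI:
  fixes f :: "'a::real_inner \<Rightarrow> real"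
  assumes "GDERIV f x :> D"
  shows "gradient f x = D"
  unfolding gradient_def
proof (rule the_equality[where P = "\<lambda>D. GDERIV f x :> D", OF assms])
  fix D' assume "GDERIV f x :> D'"
  with assms have "(\<lambda>h. h \<bullet> D') = (\<lambda>h. h \<bullet> D)"
    unfolding gderiv_def by (rule has_derivative_unique[rotated])
  then have "(D' - D) \<bullet> (D' - D) = 0"
    by (metis diff_self inner_diff_right)
  then show "D' = D" by simp
qed

text \<open>The Riesz representative of the derivative is assembled from its values on the basis, which shows
  that the description defining \<^const>\<open>gradient\<close> denotes.\<close>

lemma GDERIV_gradient:
  fixes f :: "'a::euclidean_space \<Rightarrow> real"
  assumes "f differentiable (at x)"
  shows "GDERIV f x :> gradient f x"
proof -
  obtain f' where f': "(f has_derivative f') (at x)"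
    using assms by (auto simp: differentiable_def)
  interpret f': linear f' by (rule has_derivative_linear[OF f'])
  have f'_inner: "f' h = h \<bullet> (\<Sum>b\<in>Basis. f' b *\<^sub>R b)" for h
  proof -
    have "f' h = f' (\<Sum>b\<in>Basis. (h \<bullet> b) *\<^sub>R b)" by (simp add: euclidean_representation)
    also have "\<dots> = (\<Sum>b\<in>Basis. (h \<bullet> b) * f' b)" by (simp add: f'.sum f'.scaleR)
    also have "\<dots> = h \<bullet> (\<Sum>b\<in>Basis. f' b *\<^sub>R b)" by (simp add: inner_sum_right mult.commute)
    finally show ?thesis .
  qed
  have "f' = (\<lambda>h. h \<bullet> (\<Sum>b\<in>Basis. f' b *\<^sub>R b))" by (rule ext) (rule f'_inner)
  with f' have "GDERIV f x :> (\<Sum>b\<in>Basis. f' b *\<^sub>R b)" by (metis gderiv_def)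
  with gradient_eqI[OF this] show ?thesis by (simp only:)
qed

text \<open>Along the segment from \<open>x\<close> to \<open>y\<close>, the function minus its claimed upper bound has derivative at
  most \<open>0\<close>, by the Lipschitz bound for the gradient.\<close>

lemma smooth_upper_bound:
  fixes f :: "'a::real_inner \<Rightarrow> real"
  assumes f: "\<And>x. GDERIV f x :> g x"
    and g: "\<And>x y. norm (g x - g y) \<le> L * norm (x - y)"
  shows "f y \<le> f x + g x \<bullet> (y - x) + L / 2 * (norm (y - x))\<^sup>2"
proof -
  define u where "u = y - x"
  define \<phi> where "\<phi> t = f (x + t *\<^sub>R u) - t * (g x \<bullet> u) - L / 2 * t\<^sup>2 * (norm u)\<^sup>2" for t
  have line: "((\<lambda>t. f (x + t *\<^sub>R u)) has_real_derivative (u \<bullet> g (x + t *\<^sub>R u))) (at t)" for t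
  proof -
    have "((\<lambda>t. x + t *\<^sub>R u) has_derivative (\<lambda>s. s *\<^sub>R u)) (at t)"
      by (auto intro!: derivative_eq_intros)
    moreover have "(f has_derivative (\<lambda>h. h \<bullet> g (x + t *\<^sub>R u))) (at (x + t *\<^sub>R u))"
      using f by (simp add: gderiv_def)
    ultimately have "((\<lambda>t. f (x + t *\<^sub>R u)) has_derivative (\<lambda>s. (s *\<^sub>R u) \<bullet> g (x + t *\<^sub>R u))) (at t)"
      by (rule has_derivative_compose)
    then show ?thesis
      by (simp add: has_field_derivative_def mult_commute_abs)
  qed
  have "\<phi> 1 \<le> \<phi> 0"
  proof (rule DERIV_nonpos_imp_nonincreasing[where a = 0 and b = 1 and f = \<phi>])
    fix t :: real assume t: "0 \<le> t" "t \<le> 1"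
    have "(\<phi> has_real_derivative (u \<bullet> g (x + t *\<^sub>R u) - g x \<bullet> u - L / 2 * (2 * t) * (norm u)\<^sup>2)) (at t)"
      unfolding \<phi>_def by (auto intro!: derivative_eq_intros line)
    moreover have "u \<bullet> g (x + t *\<^sub>R u) - g x \<bullet> u - L / 2 * (2 * t) * (norm u)\<^sup>2 \<le> 0"
    proof -
      have "u \<bullet> g (x + t *\<^sub>R u) - g x \<bullet> u = (g (x + t *\<^sub>R u) - g x) \<bullet> u"
        by (simp add: inner_diff_left inner_diff_right inner_commute)
      also have "\<dots> \<le> norm (g (x + t *\<^sub>R u) - g x) * norm u" by (rule norm_cauchy_schwarz)
      also have "\<dots> \<le> (L * norm (x + t *\<^sub>R u - x)) * norm u"
        by (intro mult_right_mono g) simp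
      also have "\<dots> = L * t * (norm u)\<^sup>2" using t by (simp add: power2_eq_square)
      finally show ?thesis by simp
    qed
    ultimately show "\<exists>D. (\<phi> has_real_derivative D) (at t) \<and> D \<le> 0" by blast
  qed simp
  then show ?thesis by (simp add: \<phi>_def u_def)
qed

text \<open>The lower bound is the upper bound for the negated function.\<close>

lemma smooth_remainder_bound:
  fixes f :: "'a::real_inner \<Rightarrow> real"
  assumes f: "\<And>x. GDERIV f x :> g x"
    and g: "\<And>x y. norm (g x - g y) \<le> L * norm (x - y)"
  shows "\<bar>f y - f x - g x \<bullet> (y - x)\<bar> \<le> L / 2 * (norm (y - x))\<^sup>2"
proof -
  have "- f y \<le> - f x + (- g x) \<bullet> (y - x) + L / 2 * (norm (y - x))\<^sup>2"
    by (rule smooth_upper_bound[where g = "\<lambda>x. - g x"])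
       (use f g in \<open>auto intro: GDERIV_minus simp: norm_minus_commute\<close>)
  moreover have "f y \<le> f x + g x \<bullet> (y - x) + L / 2 * (norm (y - x))\<^sup>2"
    by (rule smooth_upper_bound[OF assms])
  ultimately show ?thesis unfolding abs_le_iff inner_minus_left by linarith
qed

section \<open>The proximal operator\<close>

lemma prox_minimizes:
  assumes "proximable h" "\<gamma> > 0"
  shows "prox_objective \<gamma> h p (prox \<gamma> h p) \<le> prox_objective \<gamma> h p z"
proof -
  have "\<exists>y. is_arg_min (prox_objective \<gamma> h p) (\<lambda>_. True) y"
    using assms unfolding proximable_def by blast
  then have "is_arg_min (prox_objective \<gamma> h p) (\<lambda>_. True) (prox \<gamma> h p)"
    unfolding prox_def arg_min_def by (rule someI_ex)
  then show ?thesis by (auto simp: is_arg_min_def not_less)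
qed

text \<open>Otherwise every point would minimize the proximal objective, against uniqueness, since a Euclidean
  space has at least two points.\<close>

lemma proximable_imp_finite_somewhere:
  fixes h :: "'a::euclidean_space \<Rightarrow> ereal"
  assumes "proximable h"
  shows "\<exists>z. h z < \<infinity>"
proof (rule ccontr)
  assume "\<not> ?thesis"
  then have "h y = \<infinity>" for y by (auto simp: less_top[symmetric])
  then have "is_arg_min (prox_objective 1 h 0) (\<lambda>_. True) y" for y
    by (simp add: is_arg_min_def prox_objective_def)
  moreover have "\<exists>!y. is_arg_min (prox_objective 1 h 0) (\<lambda>_. True) y"
    using assms by (simp add: proximable_def)
  moreover obtain b :: 'a where "b \<in> Basis" using nonempty_Basis by blast
  ultimately show False by (metis nonzero_Basis)
qed

locale proximable_convex =
  fixes h :: "'a::euclidean_space \<Rightarrow> ereal"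
  assumes proper: "\<And>x. h x \<noteq> -\<infinity>"
    and conv: "convex_ereal h"
    and proxim: "proximable h"
begin

abbreviation hr :: "'a \<Rightarrow> real" where "hr x \<equiv> real_of_ereal (h x)"

lemma ereal_hr: "h x < \<infinity> \<Longrightarrow> h x = ereal (hr x)"
  using proper[of x] by (cases "h x") auto

lemma h_prox_finite:
  assumes "\<gamma> > 0"
  shows "h (prox \<gamma> h p) < \<infinity>"
proof -
  obtain z where z: "h z < \<infinity>" using proximable_imp_finite_somewhere[OF proxim] by blast
  have "prox_objective \<gamma> h p (prox \<gamma> h p) \<le> prox_objective \<gamma> h p z"
    by (rule prox_minimizes[OF proxim assms])
  also have "\<dots> < \<infinity>" using ereal_hr[OF z] by (metis prox_objective_def plus_ereal.simps(1) less_ereal.simps(4))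
  finally show ?thesis by (auto simp: prox_objective_def)
qed

text \<open>The proximal objective is strongly convex, so its minimizer \<open>y\<close> beats every \<open>z\<close> by a quadratic
  margin. The proof compares \<open>y\<close> with points at distance proportional to \<open>t\<close> on the segment towards
  \<open>z\<close>, divides by \<open>t\<close> and lets \<open>t\<close> tend to \<open>0\<close>.\<close>

lemma prox_three_point:
  fixes p z :: 'a
  assumes \<gamma>: "\<gamma> > 0" and z: "h z < \<infinity>"
  defines "y \<equiv> prox \<gamma> h p"
  shows "hr y + (norm (y - p))\<^sup>2 / (2 * \<gamma>) + (norm (z - y))\<^sup>2 / (2 * \<gamma>) \<le> hr z + (norm (z - p))\<^sup>2 / (2 * \<gamma>)"
proof -
  have y: "h y < \<infinity>" unfolding y_def by (rule h_prox_finite[OF \<gamma>])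
  define A where "A = hr y + (norm (y - p))\<^sup>2 / (2 * \<gamma>)"
  define B where "B = hr z + (norm (z - p))\<^sup>2 / (2 * \<gamma>)"
  define C where "C = (norm (z - y))\<^sup>2 / (2 * \<gamma>)"
  have step: "A + (1 - t) * C \<le> B" if t: "0 < t" "t \<le> 1" for t
  proof -
    define w where "w = (1 - t) *\<^sub>R y + t *\<^sub>R z"
    have "h w \<le> ereal (1 - t) * h y + ereal t * h z"
      using conv t by (auto simp: convex_ereal_def w_def)
    also have "\<dots> = ereal ((1 - t) * hr y + t * hr z)"
      using ereal_hr[OF y] ereal_hr[OF z] by (metis plus_ereal.simps(1) times_ereal.simps(1))
    finally have hw: "h w \<le> ereal ((1 - t) * hr y + t * hr z)" .
    then have w: "h w < \<infinity>" by (rule le_less_trans) simp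
    have hw': "hr w \<le> (1 - t) * hr y + t * hr z" using hw ereal_hr[OF w] by (metis ereal_less_eq(3))
    have "ereal A \<le> ereal (hr w + (norm (w - p))\<^sup>2 / (2 * \<gamma>))"
      using prox_minimizes[OF proxim \<gamma>, of p w] ereal_hr[OF y] ereal_hr[OF w]
      unfolding prox_objective_def y_def[symmetric] A_def
      by (metis plus_ereal.simps(1))
    then have "A \<le> hr w + (norm (w - p))\<^sup>2 / (2 * \<gamma>)" by simp
    moreover have "(norm (w - p))\<^sup>2 = (1 - t) * (norm (y - p))\<^sup>2 + t * (norm (z - p))\<^sup>2 - t * (1 - t) * (norm (z - y))\<^sup>2"
      unfolding w_def power2_norm_eq_inner
      by (simp add: inner_add_left inner_add_right inner_diff_left inner_diff_right inner_commute algebra_simps power2_eq_square)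
    ultimately have "A \<le> ((1 - t) * hr y + t * hr z) + ((1 - t) * (norm (y - p))\<^sup>2 + t * (norm (z - p))\<^sup>2 - t * (1 - t) * (norm (z - y))\<^sup>2) / (2 * \<gamma>)"
      using hw' by simp
    also have "\<dots> = (1 - t) * A + t * B - t * (1 - t) * C"
      by (simp add: A_def B_def C_def algebra_simps add_divide_distrib diff_divide_distrib)
    finally have "t * (A + (1 - t) * C) \<le> t * B" by (simp add: algebra_simps)
    then show ?thesis using t by simp
  qed
  have "((\<lambda>t. A + (1 - t) * C) \<longlongrightarrow> A + (1 - 0) * C) (at_right 0)"
    by (intro tendsto_intros)
  moreover have "\<forall>\<^sub>F t in at_right 0. A + (1 - t) * C \<le> B"
    unfolding eventually_at_right_field using step by (intro exI[of _ 1]) auto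
  ultimately have "A + (1 - 0) * C \<le> B"
    by (rule tendsto_upperbound) simp
  then show ?thesis by (simp add: A_def B_def C_def)
qed

text \<open>Adding the three-point inequalities of the two proximal points, each tested with the other, leaves
  firm nonexpansiveness. This is what makes the iterates measurable and bounded.\<close>

lemma prox_nonexpansive:
  assumes \<gamma>: "\<gamma> > 0"
  shows "norm (prox \<gamma> h p - prox \<gamma> h q) \<le> norm (p - q)"
proof -
  define y where "y = prox \<gamma> h p"
  define z where "z = prox \<gamma> h q"
  have 1: "hr y + (norm (y - p))\<^sup>2 / (2 * \<gamma>) + (norm (z - y))\<^sup>2 / (2 * \<gamma>) \<le> hr z + (norm (z - p))\<^sup>2 / (2 * \<gamma>)"
    unfolding y_def by (rule prox_three_point[OF \<gamma>]) (use h_prox_finite[OF \<gamma>] in \<open>simp add: z_def\<close>)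
  have 2: "hr z + (norm (z - q))\<^sup>2 / (2 * \<gamma>) + (norm (y - z))\<^sup>2 / (2 * \<gamma>) \<le> hr y + (norm (y - q))\<^sup>2 / (2 * \<gamma>)"
    unfolding z_def by (rule prox_three_point[OF \<gamma>]) (use h_prox_finite[OF \<gamma>] in \<open>simp add: y_def\<close>)
  have "((norm (y - p))\<^sup>2 + (norm (z - y))\<^sup>2 + (norm (z - q))\<^sup>2 + (norm (y - z))\<^sup>2) / (2 * \<gamma>)
      \<le> ((norm (z - p))\<^sup>2 + (norm (y - q))\<^sup>2) / (2 * \<gamma>)"
    using 1 2 by (simp add: add_divide_distrib)
  then have "(norm (y - p))\<^sup>2 + (norm (z - y))\<^sup>2 + (norm (z - q))\<^sup>2 + (norm (y - z))\<^sup>2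
      \<le> (norm (z - p))\<^sup>2 + (norm (y - q))\<^sup>2"
    using \<gamma> by (simp add: divide_le_cancel)
  then have "(norm (y - z))\<^sup>2 \<le> (y - z) \<bullet> (p - q)"
    unfolding power2_norm_eq_inner
    by (simp add: inner_add_left inner_add_right inner_diff_left inner_diff_right inner_commute algebra_simps)
  also have "\<dots> \<le> norm (y - z) * norm (p - q)" by (rule norm_cauchy_schwarz)
  finally have "norm (y - z) * norm (y - z) \<le> norm (y - z) * norm (p - q)"
    by (simp add: power2_eq_square)
  then have "norm (y - z) \<le> norm (p - q)"
    by (cases "norm (y - z) = 0") (auto simp: mult_le_cancel_left)
  then show ?thesis by (simp add: y_def z_def)
qed

lemma continuous_on_prox:
  assumes "\<gamma> > 0"
  shows "continuous_on UNIV (prox \<gamma> h)"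
  unfolding continuous_on_iff
proof (intro ballI allI impI)
  fix x :: 'a and \<epsilon> :: real assume "\<epsilon> > 0"
  then show "\<exists>\<delta>>0. \<forall>x'\<in>UNIV. dist x' x < \<delta> \<longrightarrow> dist (prox \<gamma> h x') (prox \<gamma> h x) < \<epsilon>"
    using prox_nonexpansive[OF assms] by (intro exI[of _ \<epsilon>]) (auto simp: dist_norm intro: le_less_trans)
qed

text \<open>The three-point inequality after completing the square, combined with the quadratic upper bound
  of \<open>f\<close> at \<open>y\<close> and the quadratic lower bound at \<open>z\<close>, both expanded around \<open>x\<close>.\<close>

lemma prox_composite_step:
  fixes f :: "'a \<Rightarrow> real" and x v :: 'a
  assumes f: "\<And>x. GDERIV f x :> g x"
    and g: "\<And>x y. norm (g x - g y) \<le> L * norm (x - y)"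
    and \<gamma>: "\<gamma> > 0" and z: "h z < \<infinity>"
  defines "y \<equiv> prox \<gamma> h (x - \<gamma> *\<^sub>R v)"
  shows "f y + hr y \<le> f z + hr z + (g x - v) \<bullet> (y - z) + (L / 2 - 1 / (2 * \<gamma>)) * (norm (y - x))\<^sup>2
    + (L / 2 + 1 / (2 * \<gamma>)) * (norm (z - x))\<^sup>2 - 1 / (2 * \<gamma>) * (norm (z - y))\<^sup>2"
proof -
  have "hr y + (norm (y - (x - \<gamma> *\<^sub>R v)))\<^sup>2 / (2 * \<gamma>) + (norm (z - y))\<^sup>2 / (2 * \<gamma>)
      \<le> hr z + (norm (z - (x - \<gamma> *\<^sub>R v)))\<^sup>2 / (2 * \<gamma>)"
    unfolding y_def by (rule prox_three_point[OF \<gamma> z])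
  moreover have expand: "(norm (w - (x - \<gamma> *\<^sub>R v)))\<^sup>2 / (2 * \<gamma>)
      = (norm (w - x))\<^sup>2 / (2 * \<gamma>) + v \<bullet> (w - x) + \<gamma> / 2 * (v \<bullet> v)" for w
  proof -
    have "(norm (w - (x - \<gamma> *\<^sub>R v)))\<^sup>2 = (norm (w - x))\<^sup>2 + 2 * \<gamma> * (v \<bullet> (w - x)) + \<gamma> * \<gamma> * (v \<bullet> v)"
      unfolding power2_norm_eq_inner
      by (simp add: inner_add_left inner_add_right inner_diff_left inner_diff_right inner_commute algebra_simps)
    then show ?thesis using \<gamma> by (simp add: add_divide_distrib)
  qed
  ultimately have "hr y + (norm (y - x))\<^sup>2 / (2 * \<gamma>) + v \<bullet> (y - x) + (norm (z - y))\<^sup>2 / (2 * \<gamma>)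
      \<le> hr z + (norm (z - x))\<^sup>2 / (2 * \<gamma>) + v \<bullet> (z - x)"
    by (simp add: expand)
  moreover have "f y \<le> f x + g x \<bullet> (y - x) + L / 2 * (norm (y - x))\<^sup>2"
    using smooth_remainder_bound[OF f g, of y x] unfolding abs_le_iff by linarith
  moreover have "f x + g x \<bullet> (z - x) \<le> f z + L / 2 * (norm (z - x))\<^sup>2"
    using smooth_remainder_bound[OF f g, of z x] unfolding abs_le_iff by linarith
  moreover have "(g x - v) \<bullet> (y - z) = g x \<bullet> (y - x) - g x \<bullet> (z - x) - v \<bullet> (y - x) + v \<bullet> (z - x)"
    by (simp add: inner_diff_left inner_diff_right)
  ultimately show ?thesis
    unfolding left_diff_distrib distrib_right times_divide_eq_left mult_1 by linarith
qed

text \<open>The exact proximal gradient point \<open>w\<close> serves as an intermediary. Passing from \<open>x\<close> to \<open>w\<close> produces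
  the gradient mapping; comparing \<open>y\<close> with \<open>w\<close> costs the product of the direction error with
  \<open>y - w\<close>, and Young's inequality absorbs the second factor in the quadratic margin of \<open>w\<close>.\<close>

lemma inexact_prox_gradient_descent:
  fixes f :: "'a \<Rightarrow> real" and x v :: 'a
  assumes f: "\<And>x. GDERIV f x :> g x"
    and g: "\<And>x y. norm (g x - g y) \<le> L * norm (x - y)"
    and \<gamma>: "\<gamma> > 0" and x: "h x < \<infinity>"
  defines "y \<equiv> prox \<gamma> h (x - \<gamma> *\<^sub>R v)"
  shows "f y + hr y + \<gamma> * (1 / 2 - L * \<gamma>) * (norm (gradient_mapping \<gamma> f h x))\<^sup>2
      + (1 / (2 * \<gamma>) - L / 2) * (norm (y - x))\<^sup>2
    \<le> f x + hr x + \<gamma> / 2 * (norm (v - g x))\<^sup>2"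
proof -
  define w where "w = prox \<gamma> h (x - \<gamma> *\<^sub>R g x)"
  have w: "h w < \<infinity>" unfolding w_def by (rule h_prox_finite[OF \<gamma>])
  have grad: "gradient f x = g x" by (rule gradient_eqI[OF f])
  have norm_G: "norm (gradient_mapping \<gamma> f h x) = norm (w - x) / \<gamma>"
    using \<gamma> by (simp add: gradient_mapping_def grad w_def norm_minus_commute)
  have G: "\<gamma> * (1 / 2 - L * \<gamma>) * (norm (gradient_mapping \<gamma> f h x))\<^sup>2 = (1 / (2 * \<gamma>) - L) * (norm (w - x))\<^sup>2"
    using \<gamma> unfolding norm_G
    by (simp add: field_simps power2_eq_square)
  have 1: "f w + hr w \<le> f x + hr x + (g x - g x) \<bullet> (w - x) + (L / 2 - 1 / (2 * \<gamma>)) * (norm (w - x))\<^sup>2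
    + (L / 2 + 1 / (2 * \<gamma>)) * (norm (x - x))\<^sup>2 - 1 / (2 * \<gamma>) * (norm (x - w))\<^sup>2"
    unfolding w_def by (rule prox_composite_step[OF f g \<gamma> x])
  have 2: "f y + hr y \<le> f w + hr w + (g x - v) \<bullet> (y - w) + (L / 2 - 1 / (2 * \<gamma>)) * (norm (y - x))\<^sup>2
    + (L / 2 + 1 / (2 * \<gamma>)) * (norm (w - x))\<^sup>2 - 1 / (2 * \<gamma>) * (norm (w - y))\<^sup>2"
    unfolding y_def by (rule prox_composite_step[OF f g \<gamma> w])
  \<comment> \<open>Young's inequality, weighted so that the last term matches the quadratic margin of \<open>w\<close>.\<close>
  have 3: "(g x - v) \<bullet> (y - w) \<le> \<gamma> / 2 * (norm (v - g x))\<^sup>2 + 1 / (2 * \<gamma>) * (norm (w - y))\<^sup>2"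
  proof -
    have "(g x - v) \<bullet> (y - w) \<le> norm (v - g x) * norm (w - y)"
      by (metis norm_cauchy_schwarz norm_minus_commute)
    also have "\<dots> \<le> \<gamma> / 2 * (norm (v - g x))\<^sup>2 + 1 / (2 * \<gamma>) * (norm (w - y))\<^sup>2"
    proof -
      have "0 \<le> (\<gamma> * norm (v - g x) - norm (w - y))\<^sup>2 / (2 * \<gamma>)" using \<gamma> by simp
      also have "\<dots> = \<gamma> / 2 * (norm (v - g x))\<^sup>2 + 1 / (2 * \<gamma>) * (norm (w - y))\<^sup>2 - norm (v - g x) * norm (w - y)"
        using \<gamma> by (simp add: field_simps power2_eq_square)
      finally show ?thesis by simp
    qed
    finally show ?thesis .
  qed
  have sym: "norm (x - w) = norm (w - x)" by (rule norm_minus_commute)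
  have "f w + hr w \<le> f x + hr x + (L / 2 - 1 / (2 * \<gamma>)) * (norm (w - x))\<^sup>2 - 1 / (2 * \<gamma>) * (norm (w - x))\<^sup>2"
    using 1 by (simp add: sym)
  with 2 3 show ?thesis unfolding G left_diff_distrib distrib_right by linarith
qed

end

section \<open>Moments of random orthonormal frames\<close>

lemma orthogonal_matrix_isometry:
  fixes Q :: "real^'d^'d"
  assumes "orthogonal_matrix Q"
  shows "(Q *v x) \<bullet> (Q *v y) = x \<bullet> y" "norm (Q *v x) = norm x"
proof -
  have "orthogonal_transformation ((*v) Q)"
    using assms by (simp add: orthogonal_transformation_matrix matrix_vector_mul_linear)
  then show "(Q *v x) \<bullet> (Q *v y) = x \<bullet> y" "norm (Q *v x) = norm x"
    by (auto simp: orthogonal_transformation_def orthogonal_transformation_norm)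
qed

lemma borel_measurable_matrix_vector_mult [measurable]:
  fixes F :: "'w \<Rightarrow> real^'d^'d" and G :: "'w \<Rightarrow> real^'d"
  assumes "F \<in> borel_measurable N" "G \<in> borel_measurable N"
  shows "(\<lambda>\<omega>. F \<omega> *v G \<omega>) \<in> borel_measurable N"
  by (rule borel_measurable_continuous_Pair[OF assms])
     (unfold matrix_vector_mult_def, intro continuous_intros)

lemma borel_measurable_matrix_mult_const:
  fixes R :: "real^'d^'d"
  shows "(\<lambda>Q::real^'d^'d. R ** Q) \<in> borel_measurable borel"
  by (rule borel_measurable_continuous_onI)
     (unfold matrix_matrix_mult_def, intro continuous_intros)

locale haar_orthogonal = prob_space H for H :: "(real^'d^'d) measure" +
  assumes haar: "normalized_haar_orth H"
begin

lemma sets_H: "sets H = sets (restrict_space borel {Q. orthogonal_matrix Q})"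
  using haar by (simp add: normalized_haar_orth_def)

lemma space_H: "space H = {Q. orthogonal_matrix Q}"
  using sets_eq_imp_space_eq[OF sets_H] by (simp add: space_restrict_space)

lemma norm_mult_H: "Q \<in> space H \<Longrightarrow> norm (Q *v x) = norm x"
  by (simp add: space_H orthogonal_matrix_isometry)

lemma measurable_H_borel [measurable]: "(\<lambda>Q. Q) \<in> borel_measurable H"
  unfolding measurable_cong_sets[OF sets_H refl] by (rule measurable_restrict_space1) simp

lemma measurable_H_left_mult:
  assumes "orthogonal_matrix R"
  shows "(\<lambda>Q. R ** Q) \<in> measurable H H"
  unfolding measurable_cong_sets[OF sets_H sets_H]
proof (rule measurable_restrict_space2)
  show "(\<lambda>Q. R ** Q) \<in> space (restrict_space borel {Q. orthogonal_matrix Q}) \<rightarrow> {Q. orthogonal_matrix Q}"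
    using assms by (auto simp: space_restrict_space intro: orthogonal_matrix_mul)
  show "(\<lambda>Q. R ** Q) \<in> borel_measurable (restrict_space borel {Q. orthogonal_matrix Q})"
    by (rule measurable_restrict_space1) (rule borel_measurable_matrix_mult_const)
qed

text \<open>This is the only place where invariance of the Haar measure enters.\<close>

lemma integral_left_mult:
  fixes \<phi> :: "real^'d^'d \<Rightarrow> real"
  assumes R: "orthogonal_matrix R" and \<phi>: "\<phi> \<in> borel_measurable H"
  shows "(\<integral>Q. \<phi> (R ** Q) \<partial>H) = (\<integral>Q. \<phi> Q \<partial>H)"
proof -
  have "(\<integral>Q. \<phi> Q \<partial>H) = (\<integral>Q. \<phi> Q \<partial>distr H H (\<lambda>Q. R ** Q))"
    using haar R by (simp add: normalized_haar_orth_def)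
  also have "\<dots> = (\<integral>Q. \<phi> (R ** Q) \<partial>H)"
    by (rule integral_distr[OF measurable_H_left_mult[OF R] \<phi>])
  finally show ?thesis ..
qed

lemma integrable_frame_product:
  "integrable H (\<lambda>Q. (u \<bullet> (Q *v a)) * (w \<bullet> (Q *v c)))"
proof (rule integrable_const_bound[where B = "(norm u * norm a) * (norm w * norm c)"])
  show "AE Q in H. norm ((u \<bullet> (Q *v a)) * (w \<bullet> (Q *v c))) \<le> norm u * norm a * (norm w * norm c)"
  proof (rule AE_I2)
    fix Q assume "Q \<in> space H"
    then have Q: "norm (Q *v x) = norm x" for x by (rule norm_mult_H)
    show "norm ((u \<bullet> (Q *v a)) * (w \<bullet> (Q *v c))) \<le> norm u * norm a * (norm w * norm c)"
      unfolding norm_mult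
      by (intro mult_mono) (use Cauchy_Schwarz_ineq2[of u "Q *v a"] Cauchy_Schwarz_ineq2[of w "Q *v c"] in \<open>auto simp: Q\<close>)
  qed
qed measurable

text \<open>Any two vectors of equal norm are exchanged by an orthogonal map, so by invariance the moment
  depends on \<open>u\<close> only through its norm. Its values at the basis vectors are therefore equal, and they
  add up to the expectation of \<open>norm (Q *v a) ^ 2 = 1\<close>.\<close>

lemma frame_second_moment_square:
  assumes a: "norm a = 1"
  shows "(\<integral>Q. (u \<bullet> (Q *v a))\<^sup>2 \<partial>H) = (norm u)\<^sup>2 / real CARD('d)"
proof -
  define \<phi> where "\<phi> u = (\<integral>Q. (u \<bullet> (Q *v a))\<^sup>2 \<partial>H)" for u
  \<comment> \<open>Invariance: rotating the test vector is the same as rotating the frame back.\<close>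
  have rot: "\<phi> u = \<phi> w" if uw: "norm u = norm w" for u w
  proof -
    obtain r where r: "orthogonal_transformation r" "r u = w"
      using orthogonal_transformation_exists[OF uw] by blast
    then have R: "orthogonal_matrix (matrix r)" and lin: "linear r"
      by (auto simp: orthogonal_transformation_matrix)
    have "w = matrix r *v u" using r(2) lin by (simp add: matrix_vector_mul(1))
    have "\<phi> w = (\<integral>Q. (w \<bullet> ((matrix r ** Q) *v a))\<^sup>2 \<partial>H)"
      unfolding \<phi>_def by (rule integral_left_mult[OF R, symmetric]) measurable
    also have "\<dots> = \<phi> u"
      unfolding \<phi>_def \<open>w = matrix r *v u\<close> matrix_vector_mul_assoc[symmetric] orthogonal_matrix_isometry(1)[OF R] ..
    finally show ?thesis ..
  qed
  have scale: "\<phi> (c *\<^sub>R u) = c\<^sup>2 * \<phi> u" for c u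
    unfolding \<phi>_def by (simp add: power_mult_distrib)
  have one: "\<phi> b = 1 / real CARD('d)" if b: "b \<in> Basis" for b :: "real^'d"
  proof -
    have "(\<Sum>b\<in>Basis. \<phi> b) = (\<integral>Q. (\<Sum>b\<in>Basis. (b \<bullet> (Q *v a))\<^sup>2) \<partial>H)"
      unfolding \<phi>_def using integrable_frame_product[of _ a _ a]
      by (subst Bochner_Integration.integral_sum) (auto simp: power2_eq_square)
    also have "\<dots> = (\<integral>Q. 1 \<partial>H)"
    proof (rule Bochner_Integration.integral_cong[OF refl])
      fix Q assume "Q \<in> space H"
      then have "(Q *v a) \<bullet> (Q *v a) = 1" using a norm_mult_H[of Q a] by (metis norm_eq_1)
      moreover have "(\<Sum>b\<in>Basis. (b \<bullet> (Q *v a))\<^sup>2) = (Q *v a) \<bullet> (Q *v a)"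
        by (subst euclidean_inner) (simp only: power2_eq_square inner_commute)
      ultimately show "(\<Sum>b\<in>Basis. (b \<bullet> (Q *v a))\<^sup>2) = 1" by (simp only:)
    qed
    also have "\<dots> = 1" by (simp add: prob_space)
    finally have "(\<Sum>b'\<in>Basis. \<phi> b') = 1" .
    moreover have "\<phi> b' = \<phi> b" if "b' \<in> Basis" for b' using that b by (intro rot) simp
    ultimately have "real CARD('d) * \<phi> b = 1" by simp
    then show ?thesis by (simp add: field_simps)
  qed
  obtain b :: "real^'d" where b: "b \<in> Basis" using nonempty_Basis by blast
  have "\<phi> u = \<phi> (norm u *\<^sub>R b)" using b by (intro rot) simp
  also have "\<dots> = (norm u)\<^sup>2 / real CARD('d)" by (simp add: scale one[OF b])
  finally show ?thesis by (simp add: \<phi>_def)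
qed

text \<open>Polarization of the preceding identity.\<close>

lemma frame_second_moment:
  assumes a: "norm a = 1"
  shows "(\<integral>Q. (u \<bullet> (Q *v a)) * (w \<bullet> (Q *v a)) \<partial>H) = (u \<bullet> w) / real CARD('d)"
proof -
  have int: "integrable H (\<lambda>Q. (v \<bullet> (Q *v a))\<^sup>2)" for v
    using integrable_frame_product[of v a v a] by (simp add: power2_eq_square)
  have "(\<integral>Q. (u \<bullet> (Q *v a)) * (w \<bullet> (Q *v a)) \<partial>H)
      = (\<integral>Q. (((u + w) \<bullet> (Q *v a))\<^sup>2 - ((u - w) \<bullet> (Q *v a))\<^sup>2) / 4 \<partial>H)"
    by (rule arg_cong[where f = "integral\<^sup>L H"]) (auto simp: inner_add_left inner_diff_left power2_eq_square algebra_simps)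
  also have "\<dots> = ((norm (u + w))\<^sup>2 / real CARD('d) - (norm (u - w))\<^sup>2 / real CARD('d)) / 4"
    using int[of "u + w"] int[of "u - w"] by (simp add: frame_second_moment_square[OF a])
  also have "\<dots> = (u \<bullet> w) / real CARD('d)"
    unfolding power2_norm_eq_inner
    by (simp add: inner_add_left inner_add_right inner_diff_left inner_diff_right inner_commute field_simps)
  finally show ?thesis .
qed

end

text \<open>This is \<open>d / l\<close> times the orthogonal projection of \<open>\<delta>\<close> onto the span of \<open>Q e 1, \<dots>, Q e l\<close>. It is
  the limit of \<^const>\<open>fd_orth\<close> at a point with gradient \<open>\<delta>\<close>, as the smoothing parameter tends
  to \<open>0\<close>.\<close>

definition frame_sketch ::
  "(nat \<Rightarrow> real^'d) \<Rightarrow> nat \<Rightarrow> real^'d \<Rightarrow> real^'d^'d \<Rightarrow> real^'d" where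
  "frame_sketch e l \<delta> Q = (real CARD('d) / real l) *\<^sub>R (\<Sum>j=1..l. (\<delta> \<bullet> (Q *v e j)) *\<^sub>R (Q *v e j))"

lemma borel_measurable_frame_sketch [measurable]:
  assumes [measurable]: "\<delta> \<in> borel_measurable N" "F \<in> borel_measurable N"
  shows "(\<lambda>\<omega>. frame_sketch e l (\<delta> \<omega>) (F \<omega>)) \<in> borel_measurable N"
  unfolding frame_sketch_def by measurable

locale orthonormal_basis_enum =
  fixes e :: "nat \<Rightarrow> real^'d" and l :: nat
  assumes e: "bij_betw e {1..CARD('d)} Basis"
    and l: "1 \<le> l" "l \<le> CARD('d)"
begin

lemma e_Basis: "j \<in> {1..CARD('d)} \<Longrightarrow> e j \<in> Basis"
  using e by (auto simp: bij_betw_def)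

lemma norm_e: "j \<in> {1..l} \<Longrightarrow> norm (e j) = 1"
  using e_Basis[of j] l by auto

lemma inner_e:
  assumes "i \<in> {1..l}" "j \<in> {1..l}"
  shows "e i \<bullet> e j = (if i = j then 1 else 0)"
proof -
  have "i \<in> {1..CARD('d)}" "j \<in> {1..CARD('d)}" using assms l by auto
  moreover from this have "e i = e j \<longleftrightarrow> i = j"
    using inj_on_eq_iff[OF bij_betw_imp_inj_on[OF e]] by blast
  ultimately show ?thesis by (simp add: inner_Basis e_Basis)
qed

text \<open>A crude bound for individual matrices, for the sake of boundedness and integrability.\<close>

lemma norm_frame_sketch_le:
  assumes Q: "orthogonal_matrix Q"
  shows "norm (frame_sketch e l \<delta> Q) \<le> real CARD('d) * norm \<delta>"
proof -
  have "norm (\<Sum>j=1..l. (\<delta> \<bullet> (Q *v e j)) *\<^sub>R (Q *v e j)) \<le> of_nat (card {1..l}) * norm \<delta>"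
  proof (rule sum_norm_bound)
    fix j assume "j \<in> {1..l}"
    then have "norm (Q *v e j) = 1" by (simp add: orthogonal_matrix_isometry[OF Q] norm_e)
    then show "norm ((\<delta> \<bullet> (Q *v e j)) *\<^sub>R (Q *v e j)) \<le> norm \<delta>"
      using Cauchy_Schwarz_ineq2[of \<delta> "Q *v e j"] by simp
  qed
  then have "real CARD('d) / real l * norm (\<Sum>j=1..l. (\<delta> \<bullet> (Q *v e j)) *\<^sub>R (Q *v e j)) \<le> real CARD('d) / real l * (real l * norm \<delta>)"
    by (intro mult_left_mono) auto
  then show ?thesis using l by (simp add: frame_sketch_def)
qed

text \<open>Orthonormality keeps the squared norm a sum of \<open>l\<close> rather than \<open>l^2\<close> terms, so that its
  expectation grows by the factor \<open>d / l\<close> only.\<close>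

lemma norm_frame_sketch_square:
  assumes Q: "orthogonal_matrix Q"
  shows "(norm (frame_sketch e l \<delta> Q))\<^sup>2
    = (real CARD('d) / real l)\<^sup>2 * (\<Sum>j=1..l. (\<delta> \<bullet> (Q *v e j))\<^sup>2)"
proof -
  have "(norm (\<Sum>j=1..l. (\<delta> \<bullet> (Q *v e j)) *\<^sub>R (Q *v e j)))\<^sup>2
      = (\<Sum>j=1..l. \<Sum>i=1..l. (\<delta> \<bullet> (Q *v e j)) * (\<delta> \<bullet> (Q *v e i)) * (if i = j then 1 else 0))"
    unfolding power2_norm_eq_inner inner_sum_left inner_sum_right
    by (intro sum.cong refl) (simp add: orthogonal_matrix_isometry[OF Q] inner_e)
  also have "\<dots> = (\<Sum>j=1..l. (\<delta> \<bullet> (Q *v e j))\<^sup>2)"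
    by (intro sum.cong refl) (simp add: power2_eq_square if_distrib cong: if_cong)
  finally show ?thesis
    by (simp add: frame_sketch_def power_mult_distrib power_divide)
qed

end

locale haar_frame = haar_orthogonal H + orthonormal_basis_enum e l
  for H :: "(real^'d^'d) measure" and e :: "nat \<Rightarrow> real^'d" and l :: nat
begin

lemma integrable_frame_sketch: "integrable H (frame_sketch e l \<delta>)"
  by (rule integrable_const_bound[where B = "real CARD('d) * norm \<delta>"])
     (auto simp: space_H intro!: AE_I2 norm_frame_sketch_le)

lemma frame_sketch_unbiased: "(\<integral>Q. frame_sketch e l \<delta> Q \<partial>H) = \<delta>"
proof -
  have "w \<bullet> (\<integral>Q. frame_sketch e l \<delta> Q \<partial>H) = w \<bullet> \<delta>" for w
  proof -
    have "w \<bullet> (\<integral>Q. frame_sketch e l \<delta> Q \<partial>H) = (\<integral>Q. w \<bullet> frame_sketch e l \<delta> Q \<partial>H)"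
      using integrable_frame_sketch[of \<delta>] by simp
    also have "\<dots> = (\<integral>Q. real CARD('d) / real l * (\<Sum>j=1..l. (\<delta> \<bullet> (Q *v e j)) * (w \<bullet> (Q *v e j))) \<partial>H)"
      by (simp add: frame_sketch_def inner_sum_right)
    also have "\<dots> = real CARD('d) / real l * (\<Sum>j=1..l. (\<integral>Q. (\<delta> \<bullet> (Q *v e j)) * (w \<bullet> (Q *v e j)) \<partial>H))"
      by (simp add: integrable_frame_product)
    also have "(\<Sum>j=1..l. (\<integral>Q. (\<delta> \<bullet> (Q *v e j)) * (w \<bullet> (Q *v e j)) \<partial>H)) = (\<Sum>j=1..l. (\<delta> \<bullet> w) / real CARD('d))"
      by (intro sum.cong refl frame_second_moment norm_e)
    finally show ?thesis using l by (simp add: inner_commute)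
  qed
  from this[of "(\<integral>Q. frame_sketch e l \<delta> Q \<partial>H) - \<delta>"] show ?thesis
    by (metis (no_types, lifting) eq_iff_diff_eq_0 inner_diff_right inner_eq_zero_iff)
qed

lemma frame_sketch_second_moment:
  "(\<integral>Q. (norm (frame_sketch e l \<delta> Q))\<^sup>2 \<partial>H) = real CARD('d) / real l * (norm \<delta>)\<^sup>2"
proof -
  have "(\<integral>Q. (norm (frame_sketch e l \<delta> Q))\<^sup>2 \<partial>H)
      = (\<integral>Q. (real CARD('d) / real l)\<^sup>2 * (\<Sum>j=1..l. (\<delta> \<bullet> (Q *v e j)) * (\<delta> \<bullet> (Q *v e j))) \<partial>H)"
    by (intro Bochner_Integration.integral_cong refl)
       (simp only: space_H mem_Collect_eq norm_frame_sketch_square power2_eq_square[of "_ \<bullet> _"])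
  also have "\<dots> = (real CARD('d) / real l)\<^sup>2 * (\<Sum>j=1..l. (\<integral>Q. (\<delta> \<bullet> (Q *v e j)) * (\<delta> \<bullet> (Q *v e j)) \<partial>H))"
    by (simp add: integrable_frame_product)
  also have "(\<Sum>j=1..l. (\<integral>Q. (\<delta> \<bullet> (Q *v e j)) * (\<delta> \<bullet> (Q *v e j)) \<partial>H)) = (\<Sum>j=1..l. (norm \<delta>)\<^sup>2 / real CARD('d))"
    by (intro sum.cong refl) (simp add: frame_second_moment norm_e power2_norm_eq_inner)
  finally show ?thesis using l by (simp add: power2_eq_square)
qed

end

locale index_frame_sampling = haar_frame H e l
  for H :: "(real^'d^'d) measure" and e :: "nat \<Rightarrow> real^'d" and l :: nat +
  fixes n :: nat
  assumes n: "1 \<le> n"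
begin

definition P :: "(nat \<times> (real^'d^'d)) measure" where
  "P = uniform_count_measure {1..n} \<Otimes>\<^sub>M H"

lemma space_P: "p \<in> space P \<longleftrightarrow> fst p \<in> {1..n} \<and> orthogonal_matrix (snd p)"
  by (auto simp: P_def space_pair_measure space_H space_uniform_count_measure mem_Times_iff)

lemma measurable_index [measurable]:
  "(\<lambda>p. (\<delta> :: nat \<Rightarrow> 'z::topological_space) (fst p)) \<in> borel_measurable P"
  unfolding P_def by (rule measurable_compose[OF measurable_fst]) (simp add: uniform_count_measure_def)

lemma measurable_matrix [measurable]: "(\<lambda>p. snd p) \<in> borel_measurable P"
  unfolding P_def by (rule measurable_compose[OF measurable_snd measurable_H_borel])

sublocale U: prob_space "uniform_count_measure {1..n}"
  using n by (intro prob_space_uniform_count_measure) auto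

sublocale UH: pair_prob_space "uniform_count_measure {1..n}" H ..

sublocale P: prob_space P
  unfolding P_def by (rule UH.prob_space_axioms)

lemma integral_P:
  fixes \<phi> :: "nat \<Rightarrow> real^'d^'d \<Rightarrow> 'z::euclidean_space"
  assumes "(\<lambda>p. \<phi> (fst p) (snd p)) \<in> borel_measurable P"
    and "\<And>i Q. i \<in> {1..n} \<Longrightarrow> orthogonal_matrix Q \<Longrightarrow> norm (\<phi> i Q) \<le> B"
  shows "(\<integral>p. \<phi> (fst p) (snd p) \<partial>P) = (1 / real n) *\<^sub>R (\<Sum>i=1..n. \<integral>Q. \<phi> i Q \<partial>H)"
proof -
  have "integrable P (\<lambda>p. \<phi> (fst p) (snd p))"
    using assms by (intro P.integrable_const_bound[where B = B] AE_I2) (auto simp: space_P)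
  from UH.integral_fst'[OF this[unfolded P_def]]
  have "(\<integral>p. \<phi> (fst p) (snd p) \<partial>P) = (\<integral>i. (\<integral>Q. \<phi> i Q \<partial>H) \<partial>uniform_count_measure {1..n})"
    by (simp add: P_def)
  also have "\<dots> = (\<Sum>i=1..n. (1 / real n) *\<^sub>R (\<integral>Q. \<phi> i Q \<partial>H))"
    by (simp add: uniform_count_measure_def lebesgue_integral_point_measure_finite)
  finally show ?thesis by (simp add: scaleR_sum_right)
qed

lemma index_sketch_bound:
  assumes \<delta>: "\<And>i. i \<in> {1..n} \<Longrightarrow> norm (\<delta> i) \<le> D" and p: "p \<in> space P"
  shows "norm (frame_sketch e l (\<delta> (fst p)) (snd p)) \<le> real CARD('d) * D"
proof -
  have "norm (frame_sketch e l (\<delta> (fst p)) (snd p)) \<le> real CARD('d) * norm (\<delta> (fst p))"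
    using p by (intro norm_frame_sketch_le) (simp add: space_P)
  also have "\<dots> \<le> real CARD('d) * D" using p by (intro mult_left_mono \<delta>) (auto simp: space_P)
  finally show ?thesis .
qed

lemma index_sketch_unbiased:
  assumes \<delta>: "\<And>i. i \<in> {1..n} \<Longrightarrow> norm (\<delta> i) \<le> D"
  shows "(\<integral>p. frame_sketch e l (\<delta> (fst p)) (snd p) \<partial>P) = (1 / real n) *\<^sub>R (\<Sum>i=1..n. \<delta> i)"
  by (subst integral_P[where B = "real CARD('d) * D"])
     (use index_sketch_bound[of \<delta> D "(_, _)"] \<delta> in \<open>auto simp: frame_sketch_unbiased space_P\<close>)

lemma index_sketch_second_moment:
  assumes \<delta>: "\<And>i. i \<in> {1..n} \<Longrightarrow> norm (\<delta> i) \<le> D"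
  shows "(\<integral>p. (norm (frame_sketch e l (\<delta> (fst p)) (snd p)))\<^sup>2 \<partial>P) \<le> real CARD('d) / real l * D\<^sup>2"
proof -
  have "(\<integral>p. (norm (frame_sketch e l (\<delta> (fst p)) (snd p)))\<^sup>2 \<partial>P)
      = (1 / real n) *\<^sub>R (\<Sum>i=1..n. \<integral>Q. (norm (frame_sketch e l (\<delta> i) Q))\<^sup>2 \<partial>H)"
    by (rule integral_P[where B = "(real CARD('d) * D)\<^sup>2"])
       (use index_sketch_bound[of \<delta> D "(_, _)"] \<delta> in \<open>auto simp: space_P intro!: power_mono\<close>)
  also have "\<dots> = (1 / real n) * (\<Sum>i=1..n. real CARD('d) / real l * (norm (\<delta> i))\<^sup>2)"
    by (simp add: frame_sketch_second_moment)
  also have "\<dots> \<le> (1 / real n) * (\<Sum>i=1..n. real CARD('d) / real l * D\<^sup>2)"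
    by (intro mult_left_mono sum_mono power_mono \<delta>) auto
  also have "\<dots> = real CARD('d) / real l * D\<^sup>2" using n by simp
  finally show ?thesis .
qed

end

section \<open>Variance of an average of independent vectors\<close>

context prob_space
begin

text \<open>Restriction to two disjoint singletons of indices, followed by evaluation.\<close>

lemma indep_var_of_indep_vars:
  assumes "indep_vars (\<lambda>_. N) Y J" "i \<in> J" "j \<in> J" "i \<noteq> j"
  shows "indep_var N (Y i) N (Y j)"
proof -
  have "indep_var (PiM {i} (\<lambda>_. N)) (\<lambda>\<omega>. restrict (\<lambda>k. Y k \<omega>) {i}) (PiM {j} (\<lambda>_. N)) (\<lambda>\<omega>. restrict (\<lambda>k. Y k \<omega>) {j})"
    using assms by (intro indep_var_restrict) auto
  then have "indep_var N ((\<lambda>x. x i) \<circ> (\<lambda>\<omega>. restrict (\<lambda>k. Y k \<omega>) {i})) N ((\<lambda>x. x j) \<circ> (\<lambda>\<omega>. restrict (\<lambda>k. Y k \<omega>) {j}))"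
    by (rule indep_var_compose) (auto intro: measurable_component_singleton)
  then show ?thesis by (simp add: comp_def)
qed

text \<open>Coordinatewise, the scalar product rule for independent variables.\<close>

lemma expectation_inner_indep:
  fixes X Y :: "'a \<Rightarrow> 'z::euclidean_space"
  assumes XY: "indep_var borel X borel Y" and X: "integrable M X" and Y: "integrable M Y"
  shows "expectation (\<lambda>\<omega>. X \<omega> \<bullet> Y \<omega>) = expectation X \<bullet> expectation Y"
proof -
  have ind: "indep_var borel (\<lambda>\<omega>. X \<omega> \<bullet> c) borel (\<lambda>\<omega>. Y \<omega> \<bullet> c)" for c
    using indep_var_compose[OF XY, of "\<lambda>x. x \<bullet> c" borel "\<lambda>x. x \<bullet> c" borel] by (simp add: comp_def)
  have int: "integrable M (\<lambda>\<omega>. (X \<omega> \<bullet> c) * (Y \<omega> \<bullet> c))" for c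
    using X Y by (intro indep_var_integrable[OF ind]) auto
  have "expectation (\<lambda>\<omega>. X \<omega> \<bullet> Y \<omega>) = expectation (\<lambda>\<omega>. \<Sum>c\<in>Basis. (X \<omega> \<bullet> c) * (Y \<omega> \<bullet> c))"
    by (subst euclidean_inner) simp
  also have "\<dots> = (\<Sum>c\<in>Basis. expectation (\<lambda>\<omega>. (X \<omega> \<bullet> c) * (Y \<omega> \<bullet> c)))"
    using int by simp
  also have "\<dots> = (\<Sum>c\<in>Basis. (expectation X \<bullet> c) * (expectation Y \<bullet> c))"
    using X Y by (intro sum.cong refl) (subst indep_var_lebesgue_integral[OF ind], auto)
  also have "\<dots> = expectation X \<bullet> expectation Y" by (rule euclidean_inner[symmetric])
  finally show ?thesis .
qed

text \<open>After centring, the expectations of all mixed inner products vanish, so only \<open>card J\<close> of the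
  \<open>(card J)^2\<close> terms of the squared norm survive.\<close>

lemma average_variance_bound:
  fixes Y :: "'i \<Rightarrow> 'a \<Rightarrow> 'z::euclidean_space"
  assumes J: "finite J" "J \<noteq> {}"
    and ind: "indep_vars (\<lambda>_. borel) Y J"
    and bnd: "\<And>j \<omega>. j \<in> J \<Longrightarrow> \<omega> \<in> space M \<Longrightarrow> norm (Y j \<omega>) \<le> B"
    and mean: "\<And>j. j \<in> J \<Longrightarrow> expectation (Y j) = \<mu>"
    and second: "\<And>j. j \<in> J \<Longrightarrow> expectation (\<lambda>\<omega>. (norm (Y j \<omega>))\<^sup>2) \<le> s"
  shows "expectation (\<lambda>\<omega>. (norm ((1 / real (card J)) *\<^sub>R (\<Sum>j\<in>J. Y j \<omega>) - \<mu>))\<^sup>2) \<le> s / real (card J)"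
proof -
  define Z where "Z = (\<lambda>j \<omega>. Y j \<omega> - \<mu>)"
  have c: "real (card J) > 0" using J by (simp add: card_gt_0_iff)
  have Ym [measurable]: "Y j \<in> borel_measurable M" if "j \<in> J" for j
    using ind that by (auto simp: indep_vars_def)
  have Zind: "indep_vars (\<lambda>_. borel) Z J"
    unfolding Z_def by (rule indep_vars_compose2[OF ind]) measurable
  have Zbnd: "norm (Z j \<omega>) \<le> B + norm \<mu>" if "j \<in> J" "\<omega> \<in> space M" for j \<omega>
    unfolding Z_def using bnd[OF that] norm_triangle_ineq4[of "Y j \<omega>" \<mu>] by linarith
  have Yint: "integrable M (Y j)" if "j \<in> J" for j
    using that bnd by (intro integrable_const_bound[where B = B] AE_I2) auto
  have Zint: "integrable M (Z j)" if "j \<in> J" for j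
    using Yint[OF that] by (simp add: Z_def)
  have Zmean: "expectation (Z j) = 0" if "j \<in> J" for j
    using Yint[OF that] mean[OF that] by (simp add: Z_def prob_space)
  have sq: "expectation (\<lambda>\<omega>. Z j \<omega> \<bullet> Z j \<omega>) \<le> s" if j: "j \<in> J" for j
  proof -
    have Y_sq: "integrable M (\<lambda>\<omega>. (norm (Y j \<omega>))\<^sup>2)"
      using j bnd by (intro integrable_const_bound[where B = "B\<^sup>2"] AE_I2) (auto intro!: power_mono)
    have "expectation (\<lambda>\<omega>. Z j \<omega> \<bullet> Z j \<omega>) = expectation (\<lambda>\<omega>. (norm (Y j \<omega>))\<^sup>2 - 2 * (\<mu> \<bullet> Y j \<omega>) + \<mu> \<bullet> \<mu>)"
      by (intro Bochner_Integration.integral_cong refl)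
         (simp add: Z_def power2_norm_eq_inner inner_diff_left inner_diff_right inner_commute)
    also have "\<dots> = expectation (\<lambda>\<omega>. (norm (Y j \<omega>))\<^sup>2) - 2 * (\<mu> \<bullet> \<mu>) + \<mu> \<bullet> \<mu>"
      using Y_sq Yint[OF j] mean[OF j] by (simp add: prob_space)
    also have "\<dots> \<le> s" using second[OF j] inner_ge_zero[of \<mu>] by linarith
    finally show ?thesis .
  qed
  have cross: "expectation (\<lambda>\<omega>. Z i \<omega> \<bullet> Z j \<omega>) = 0" if "i \<in> J" "j \<in> J" "i \<noteq> j" for i j
    using that by (subst expectation_inner_indep[OF indep_var_of_indep_vars[OF Zind]]) (auto simp: Zint Zmean)
  have int: "integrable M (\<lambda>\<omega>. Z i \<omega> \<bullet> Z j \<omega>)" if "i \<in> J" "j \<in> J" for i j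
  proof (rule integrable_const_bound[where B = "(B + norm \<mu>) * (B + norm \<mu>)"])
    show "AE \<omega> in M. norm (Z i \<omega> \<bullet> Z j \<omega>) \<le> (B + norm \<mu>) * (B + norm \<mu>)"
    proof (rule AE_I2)
      fix \<omega> assume \<omega>: "\<omega> \<in> space M"
      have "norm (Z i \<omega> \<bullet> Z j \<omega>) \<le> norm (Z i \<omega>) * norm (Z j \<omega>)"
        using Cauchy_Schwarz_ineq2 by auto
      also have "\<dots> \<le> (B + norm \<mu>) * (B + norm \<mu>)"
        using Zbnd[OF that(1) \<omega>] Zbnd[OF that(2) \<omega>] order_trans[OF norm_ge_zero Zbnd[OF that(1) \<omega>]]
        by (intro mult_mono) auto
      finally show "norm (Z i \<omega> \<bullet> Z j \<omega>) \<le> (B + norm \<mu>) * (B + norm \<mu>)" .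
    qed
    show "(\<lambda>\<omega>. Z i \<omega> \<bullet> Z j \<omega>) \<in> borel_measurable M" using that by (simp add: Z_def)
  qed
  have avg: "(1 / real (card J)) *\<^sub>R (\<Sum>j\<in>J. Y j \<omega>) - \<mu> = (1 / real (card J)) *\<^sub>R (\<Sum>j\<in>J. Z j \<omega>)" for \<omega>
    using c by (simp add: Z_def sum_subtractf scaleR_diff_right sum_constant_scaleR)
  have "expectation (\<lambda>\<omega>. (norm ((1 / real (card J)) *\<^sub>R (\<Sum>j\<in>J. Y j \<omega>) - \<mu>))\<^sup>2)
      = expectation (\<lambda>\<omega>. (1 / real (card J))\<^sup>2 * (\<Sum>i\<in>J. \<Sum>j\<in>J. Z i \<omega> \<bullet> Z j \<omega>))"
    unfolding avg
    by (intro Bochner_Integration.integral_cong refl)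
       (simp add: power_mult_distrib power2_norm_eq_inner inner_sum_left inner_sum_right inner_commute power_divide)
  also have "\<dots> = (1 / real (card J))\<^sup>2 * (\<Sum>i\<in>J. \<Sum>j\<in>J. expectation (\<lambda>\<omega>. Z i \<omega> \<bullet> Z j \<omega>))"
    using int by simp
  also have "(\<Sum>i\<in>J. \<Sum>j\<in>J. expectation (\<lambda>\<omega>. Z i \<omega> \<bullet> Z j \<omega>))
      = (\<Sum>i\<in>J. \<Sum>j\<in>J. if j = i then expectation (\<lambda>\<omega>. Z i \<omega> \<bullet> Z i \<omega>) else 0)"
    by (intro sum.cong refl) (auto simp: cross)
  also have "\<dots> = (\<Sum>i\<in>J. expectation (\<lambda>\<omega>. Z i \<omega> \<bullet> Z i \<omega>))"
    using J by simp
  also have "(1 / real (card J))\<^sup>2 * \<dots> \<le> (1 / real (card J))\<^sup>2 * (\<Sum>i\<in>J. s)"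
    by (intro mult_left_mono sum_mono sq) auto
  also have "\<dots> = s / real (card J)" using c by (simp add: power2_eq_square field_simps)
  finally show ?thesis .
qed

end

section \<open>Finite-difference errors\<close>

lemma difference_quotient_error:
  fixes f :: "'a::real_inner \<Rightarrow> real"
  assumes f: "\<And>x. GDERIV f x :> g x"
    and g: "\<And>x y. norm (g x - g y) \<le> L * norm (x - y)"
    and \<beta>: "\<beta> > 0" and u: "norm u = 1"
  shows "\<bar>(f (x + \<beta> *\<^sub>R u) - f x) / \<beta> - g x \<bullet> u\<bar> \<le> L * \<beta> / 2"
proof -
  have "\<bar>f (x + \<beta> *\<^sub>R u) - f x - g x \<bullet> (\<beta> *\<^sub>R u)\<bar> \<le> L / 2 * (norm (\<beta> *\<^sub>R u))\<^sup>2"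
    using smooth_remainder_bound[OF f g, of "x + \<beta> *\<^sub>R u" x] by simp
  then have le: "\<bar>f (x + \<beta> *\<^sub>R u) - f x - \<beta> * (g x \<bullet> u)\<bar> \<le> L / 2 * \<beta>\<^sup>2"
    using u by simp
  have "\<bar>(f (x + \<beta> *\<^sub>R u) - f x) / \<beta> - g x \<bullet> u\<bar> = \<bar>f (x + \<beta> *\<^sub>R u) - f x - \<beta> * (g x \<bullet> u)\<bar> / \<beta>"
  proof -
    have "(f (x + \<beta> *\<^sub>R u) - f x) / \<beta> - g x \<bullet> u = (f (x + \<beta> *\<^sub>R u) - f x - \<beta> * (g x \<bullet> u)) / \<beta>"
      using \<beta> by (simp add: field_simps)
    then show ?thesis using \<beta> by (simp add: abs_divide)
  qed
  also have "\<dots> \<le> L / 2 * \<beta>\<^sup>2 / \<beta>" using le \<beta> by (intro divide_right_mono) auto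
  also have "\<dots> = L * \<beta> / 2" using \<beta> by (simp add: power2_eq_square)
  finally show ?thesis .
qed

context orthonormal_basis_enum
begin

lemma frame_sketch_diff:
  "frame_sketch e l (u - w) Q = frame_sketch e l u Q - frame_sketch e l w Q"
  by (simp add: frame_sketch_def inner_diff_left scaleR_diff_left sum_subtractf scaleR_diff_right)

text \<open>The triangle inequality over the \<open>l\<close> directions loses a factor \<open>sqrt l\<close> against an argument using
  orthonormality, but the bounds below have room for it: after squaring, \<open>d^2 L^2 \<beta>^2\<close> is still of
  the permitted order.\<close>

lemma fd_orth_error:
  assumes f: "\<And>x. GDERIV f x :> g x"
    and g: "\<And>x y. norm (g x - g y) \<le> L * norm (x - y)"
    and \<beta>: "\<beta> > 0" and Q: "orthogonal_matrix Q"
  shows "norm (fd_orth e l f x Q \<beta> - frame_sketch e l (g x) Q) \<le> real CARD('d) * L * \<beta> / 2"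
proof -
  define S where "S = (\<Sum>j=1..l. ((f (x + \<beta> *\<^sub>R (Q *v e j)) - f x) / \<beta> - g x \<bullet> (Q *v e j)) *\<^sub>R (Q *v e j))"
  have "norm S \<le> of_nat (card {1..l}) * (L * \<beta> / 2)"
    unfolding S_def
  proof (rule sum_norm_bound)
    fix j assume "j \<in> {1..l}"
    then have u: "norm (Q *v e j) = 1" by (simp add: orthogonal_matrix_isometry[OF Q] norm_e)
    show "norm (((f (x + \<beta> *\<^sub>R (Q *v e j)) - f x) / \<beta> - g x \<bullet> (Q *v e j)) *\<^sub>R (Q *v e j)) \<le> L * \<beta> / 2"
      using difference_quotient_error[OF f g \<beta> u] u by simp
  qed
  then have "real CARD('d) / real l * norm S \<le> real CARD('d) / real l * (real l * (L * \<beta> / 2))"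
    by (intro mult_left_mono) auto
  moreover have "fd_orth e l f x Q \<beta> - frame_sketch e l (g x) Q = (real CARD('d) / real l) *\<^sub>R S"
    by (simp add: S_def fd_orth_def frame_sketch_def scaleR_diff_right scaleR_diff_left sum_subtractf)
  ultimately show ?thesis using l by simp
qed

text \<open>The same triangle inequality, for the \<open>d\<close> basis directions.\<close>

lemma fd_full_error:
  assumes f: "\<And>x. GDERIV f x :> g x"
    and g: "\<And>x y. norm (g x - g y) \<le> L * norm (x - y)"
    and \<beta>: "\<beta> > 0"
  shows "norm (fd_full e f x \<beta> - g x) \<le> real CARD('d) * L * \<beta> / 2"
proof -
  have "(\<Sum>j=1..CARD('d). (g x \<bullet> e j) *\<^sub>R e j) = (\<Sum>b\<in>Basis. (g x \<bullet> b) *\<^sub>R b)"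
    by (rule sum.reindex_bij_betw[OF e])
  then have "fd_full e f x \<beta> - g x
      = (\<Sum>j=1..CARD('d). ((f (x + \<beta> *\<^sub>R e j) - f x) / \<beta> - g x \<bullet> e j) *\<^sub>R e j)"
    by (simp add: fd_full_def scaleR_diff_left sum_subtractf euclidean_representation)
  also have "norm \<dots> \<le> of_nat (card {1..CARD('d)}) * (L * \<beta> / 2)"
  proof (rule sum_norm_bound)
    fix j assume "j \<in> {1..CARD('d)}"
    then have u: "norm (e j) = 1" using e_Basis by auto
    show "norm (((f (x + \<beta> *\<^sub>R e j) - f x) / \<beta> - g x \<bullet> e j) *\<^sub>R e j) \<le> L * \<beta> / 2"
      using difference_quotient_error[OF f g \<beta> u] u by simp
  qed
  finally show ?thesis by simp
qed

end

section \<open>Pathwise analysis of the iteration\<close>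

text \<open>Each displacement is a telescoping sum of at most \<open>m\<close> steps, so the Cauchy-Schwarz inequality
  costs a factor \<open>m\<close>, and summing over \<open>k\<close> costs another.\<close>

lemma sum_square_displacement_le:
  fixes x :: "nat \<Rightarrow> 'a::real_normed_vector"
  shows "(\<Sum>k<m. (norm (x k - x 0))\<^sup>2) \<le> (real m)\<^sup>2 * (\<Sum>k<m. (norm (x (Suc k) - x k))\<^sup>2)"
proof -
  define S where "S = (\<Sum>k<m. (norm (x (Suc k) - x k))\<^sup>2)"
  have "(norm (x k - x 0))\<^sup>2 \<le> real m * S" if k: "k < m" for k
  proof -
    have "norm (x k - x 0) = norm (\<Sum>j<k. x (Suc j) - x j)"
      by (simp add: sum_lessThan_telescope)
    also have "\<dots> \<le> (\<Sum>j<k. norm (x (Suc j) - x j))" by (rule norm_sum)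
    finally have "(norm (x k - x 0))\<^sup>2 \<le> (\<Sum>j<k. norm (x (Suc j) - x j))\<^sup>2"
      by (intro power_mono) auto
    also have "\<dots> \<le> (\<Sum>j<k. (norm (x (Suc j) - x j))\<^sup>2) * real (card {..<k})"
      by (rule sum_squared_le_sum_of_squares)
    also have "\<dots> \<le> S * real m"
      unfolding S_def using k by (intro mult_mono sum_mono2 sum_nonneg) auto
    finally show ?thesis by (simp add: mult.commute)
  qed
  then have "(\<Sum>k<m. (norm (x k - x 0))\<^sup>2) \<le> (\<Sum>k<m. real m * S)" by (intro sum_mono) auto
  then show ?thesis by (simp add: S_def power2_eq_square)
qed

lemma norm_add_square_le:
  fixes x y :: "'a::real_normed_vector"
  shows "(norm (x + y))\<^sup>2 \<le> 2 * (norm x)\<^sup>2 + 2 * (norm y)\<^sup>2"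
proof -
  have "(norm (x + y))\<^sup>2 \<le> (norm x + norm y)\<^sup>2" by (intro power_mono norm_triangle_ineq) simp
  also have "\<dots> = 2 * (norm x)\<^sup>2 + 2 * (norm y)\<^sup>2 - (norm x - norm y)\<^sup>2"
    by (simp add: power2_eq_square algebra_simps)
  also have "\<dots> \<le> 2 * (norm x)\<^sup>2 + 2 * (norm y)\<^sup>2" by simp
  finally show ?thesis .
qed

text \<open>A sample path is a function \<open>p\<close> assigning to the index \<open>(\<tau>, k, j)\<close> the sampled pair of a component
  number and a matrix. Treating the iterates as functions of \<open>p\<close> makes it possible to say on which
  indices they depend. The bound \<open>L \<gamma> \<le> 1 / 10\<close> is what the prescribed stepsize guarantees.\<close>

locale vr_problem = proximable_convex h + index_frame_sampling H e l n
  for h :: "real^'d \<Rightarrow> ereal" and H :: "(real^'d^'d) measure" and e l n +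
  fixes f :: "nat \<Rightarrow> real^'d \<Rightarrow> real" and L \<gamma> :: real and b m :: nat
    and \<beta> :: "nat \<Rightarrow> real" and x00 :: "real^'d" and Fmin :: real
  assumes L: "L > 0"
    and f_diff: "\<And>i x. i \<in> {1..n} \<Longrightarrow> f i differentiable (at x)"
    and f_smooth: "\<And>i x y. i \<in> {1..n} \<Longrightarrow> norm (gradient (f i) x - gradient (f i) y) \<le> L * norm (x - y)"
    and \<gamma>: "\<gamma> > 0" "L * \<gamma> \<le> 1 / 10"
    and b: "1 \<le> b" and m: "1 \<le> m"
    and \<beta>: "\<And>\<tau>. \<beta> \<tau> > 0"
    and x00: "h x00 < \<infinity>"
    and Fmin: "\<And>x. h x < \<infinity> \<Longrightarrow> Fmin \<le> avg_fun n f x + real_of_ereal (h x)"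
begin

abbreviation F :: "real^'d \<Rightarrow> real" where "F \<equiv> avg_fun n f"
abbreviation grad :: "nat \<Rightarrow> real^'d \<Rightarrow> real^'d" where "grad i \<equiv> gradient (f i)"

definition gradF :: "real^'d \<Rightarrow> real^'d" where
  "gradF x = (1 / real n) *\<^sub>R (\<Sum>i=1..n. grad i x)"

lemma GDERIV_f: "i \<in> {1..n} \<Longrightarrow> GDERIV (f i) x :> grad i x"
  by (intro GDERIV_gradient f_diff)

lemma GDERIV_F: "GDERIV F x :> gradF x"
proof -
  have "((\<lambda>x. (\<Sum>i=1..n. f i x) * (1 / real n)) has_derivative (\<lambda>v. (\<Sum>i=1..n. v \<bullet> grad i x) * (1 / real n))) (at x)"
    by (intro has_derivative_mult_left has_derivative_sum) (use GDERIV_f in \<open>auto simp: gderiv_def\<close>)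
  then show ?thesis
    unfolding gderiv_def avg_fun_def[abs_def] gradF_def by (simp add: inner_sum_right)
qed

lemma gradF_lipschitz: "norm (gradF x - gradF y) \<le> L * norm (x - y)"
proof -
  have "norm (\<Sum>i=1..n. grad i x - grad i y) \<le> of_nat (card {1..n}) * (L * norm (x - y))"
    by (rule sum_norm_bound) (rule f_smooth)
  moreover have "gradF x - gradF y = (1 / real n) *\<^sub>R (\<Sum>i=1..n. grad i x - grad i y)"
    by (simp add: gradF_def sum_subtractf scaleR_diff_right)
  ultimately show ?thesis using n by (simp add: field_simps)
qed

text \<open>The sampling error that remains when all finite differences are replaced by directional
  derivatives. It averages to \<open>0\<close> over the samples for fixed \<open>x0\<close> and \<open>x\<close>.\<close>

definition noise :: "nat \<Rightarrow> nat \<Rightarrow> (nat \<times> nat \<times> nat \<Rightarrow> nat \<times> (real^'d^'d)) \<Rightarrow> real^'d \<Rightarrow> real^'d \<Rightarrow> real^'d" where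
  "noise \<tau> k p x0 x = (1 / real b) *\<^sub>R (\<Sum>j=1..b. frame_sketch e l
      (grad (fst (p (\<tau>, k, j))) x - grad (fst (p (\<tau>, k, j))) x0) (snd (p (\<tau>, k, j))))
    - (gradF x - gradF x0)"

definition direction :: "nat \<Rightarrow> nat \<Rightarrow> (nat \<times> nat \<times> nat \<Rightarrow> nat \<times> (real^'d^'d)) \<Rightarrow> real^'d \<Rightarrow> real^'d \<Rightarrow> real^'d" where
  "direction \<tau> k p x0 x =
    vr_direction e n f l b (\<beta> \<tau>) (\<lambda>j. fst (p (\<tau>, k, j))) (\<lambda>j. snd (p (\<tau>, k, j))) x0 x"

definition X :: "nat \<Rightarrow> nat \<Rightarrow> (nat \<times> nat \<times> nat \<Rightarrow> nat \<times> (real^'d^'d)) \<Rightarrow> real^'d" where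
  "X \<tau> k p = vr_szd e n f h l b m \<gamma> \<beta> (\<lambda>\<tau> k j. fst (p (\<tau>, k, j))) (\<lambda>\<tau> k j. snd (p (\<tau>, k, j))) x00 \<tau> k"

lemma X_0_0: "X 0 0 p = x00"
  by (simp add: X_def vr_szd_def)

lemma X_Suc_0: "X (Suc \<tau>) 0 p = X \<tau> m p"
  by (simp add: X_def vr_szd_def)

lemma X_Suc: "X \<tau> (Suc k) p = prox \<gamma> h (X \<tau> k p - \<gamma> *\<^sub>R direction \<tau> k p (X \<tau> 0 p) (X \<tau> k p))"
  by (simp add: X_def vr_szd_def direction_def Let_def)

definition fresh :: "nat \<Rightarrow> nat \<Rightarrow> (nat \<times> nat \<times> nat) set" where
  "fresh \<tau> k = (\<lambda>j. (\<tau>, k, j)) ` {1..b}"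

text \<open>The indices on which the iterate \<open>X \<tau> k\<close> depends. The restriction to \<open>k' < m\<close> keeps them inside the
  index set of the independent family, and makes \<open>past \<tau> m\<close> coincide with \<open>past (Suc \<tau>) 0\<close>.\<close>

definition past :: "nat \<Rightarrow> nat \<Rightarrow> (nat \<times> nat \<times> nat) set" where
  "past \<tau> k = {(\<tau>', k', j). (\<tau>' < \<tau> \<or> \<tau>' = \<tau> \<and> k' < k) \<and> k' < m \<and> j \<in> {1..b}}"

lemma past_subset:
  "past \<tau> 0 \<subseteq> past \<tau> k" "past \<tau> k \<subseteq> past \<tau> (Suc k)" "past \<tau> m \<subseteq> past (Suc \<tau>) 0"
  "k < m \<Longrightarrow> fresh \<tau> k \<subseteq> past \<tau> (Suc k)"
  by (auto simp: past_def fresh_def)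

definition valid :: "(nat \<times> nat \<times> nat) set \<Rightarrow> (nat \<times> nat \<times> nat \<Rightarrow> nat \<times> (real^'d^'d)) \<Rightarrow> bool" where
  "valid A p \<longleftrightarrow> (\<forall>i\<in>A. p i \<in> space P)"

lemma valid_subset: "valid A p \<Longrightarrow> B \<subseteq> A \<Longrightarrow> valid B p"
  by (auto simp: valid_def)

lemma validD:
  assumes "valid (fresh \<tau> k) p" "j \<in> {1..b}"
  shows "fst (p (\<tau>, k, j)) \<in> {1..n}" "orthogonal_matrix (snd (p (\<tau>, k, j)))"
  using assms by (auto simp: valid_def fresh_def space_P)

lemma noise_bound:
  assumes v: "valid (fresh \<tau> k) p"
  shows "norm (noise \<tau> k p x0 x) \<le> (real CARD('d) + 1) * L * norm (x - x0)"
proof -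
  have "norm (\<Sum>j=1..b. frame_sketch e l (grad (fst (p (\<tau>, k, j))) x - grad (fst (p (\<tau>, k, j))) x0) (snd (p (\<tau>, k, j))))
      \<le> of_nat (card {1..b}) * (real CARD('d) * (L * norm (x - x0)))"
  proof (rule sum_norm_bound)
    fix j assume j: "j \<in> {1..b}"
    show "norm (frame_sketch e l (grad (fst (p (\<tau>, k, j))) x - grad (fst (p (\<tau>, k, j))) x0) (snd (p (\<tau>, k, j))))
        \<le> real CARD('d) * (L * norm (x - x0))"
      by (rule order_trans[OF norm_frame_sketch_le[OF validD(2)[OF v j]]])
         (intro mult_left_mono f_smooth validD(1)[OF v j] of_nat_0_le_iff)
  qed
  then have "norm ((1 / real b) *\<^sub>R (\<Sum>j=1..b. frame_sketch e l (grad (fst (p (\<tau>, k, j))) x - grad (fst (p (\<tau>, k, j))) x0) (snd (p (\<tau>, k, j)))))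
      \<le> real CARD('d) * (L * norm (x - x0))"
    using b by (simp add: field_simps)
  then have "norm (noise \<tau> k p x0 x) \<le> real CARD('d) * (L * norm (x - x0)) + L * norm (x - x0)"
    unfolding noise_def using gradF_lipschitz[of x x0] norm_triangle_ineq4 by (smt (verit))
  then show ?thesis by (simp add: algebra_simps)
qed

text \<open>Three finite-difference errors of size \<open>d L \<beta> / 2\<close> add up: at \<open>x\<close> and at \<open>x0\<close> along the random
  frames, and at \<open>x0\<close> along the basis. The gradient at \<open>x0\<close> recovered from the last one cancels
  the corresponding term in the mean of the noise.\<close>

lemma direction_error_decomposition:
  assumes v: "valid (fresh \<tau> k) p"
  shows "norm (direction \<tau> k p x0 x - gradF x - noise \<tau> k p x0 x) \<le> 3 / 2 * real CARD('d) * L * \<beta> \<tau>"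
proof -
  define i where "i j = fst (p (\<tau>, k, j))" for j
  define Q where "Q j = snd (p (\<tau>, k, j))" for j
  define \<xi> where "\<xi> j y = fd_orth e l (f (i j)) y (Q j) (\<beta> \<tau>) - frame_sketch e l (grad (i j) y) (Q j)" for j y
  have \<xi>: "norm (\<xi> j y) \<le> real CARD('d) * L * \<beta> \<tau> / 2" if j: "j \<in> {1..b}" for j y
    unfolding \<xi>_def
    by (rule fd_orth_error[OF GDERIV_f f_smooth \<beta>]) (use validD[OF v j] in \<open>auto simp: i_def Q_def\<close>)
  have "norm (\<Sum>j=1..b. \<xi> j x - \<xi> j x0) \<le> of_nat (card {1..b}) * (real CARD('d) * L * \<beta> \<tau>)"
  proof (rule sum_norm_bound)
    fix j assume j: "j \<in> {1..b}"
    show "norm (\<xi> j x - \<xi> j x0) \<le> real CARD('d) * L * \<beta> \<tau>"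
      using \<xi>[OF j, of x] \<xi>[OF j, of x0] norm_triangle_ineq4[of "\<xi> j x" "\<xi> j x0"] by linarith
  qed
  then have 1: "norm ((1 / real b) *\<^sub>R (\<Sum>j=1..b. \<xi> j x - \<xi> j x0)) \<le> real CARD('d) * L * \<beta> \<tau>"
    using b by (simp add: field_simps)
  have 2: "norm (fd_full e F x0 (\<beta> \<tau>) - gradF x0) \<le> real CARD('d) * L * \<beta> \<tau> / 2"
    by (rule fd_full_error[OF GDERIV_F gradF_lipschitz \<beta>])
  have "direction \<tau> k p x0 x - gradF x - noise \<tau> k p x0 x
      = (1 / real b) *\<^sub>R (\<Sum>j=1..b. \<xi> j x - \<xi> j x0) + (fd_full e F x0 (\<beta> \<tau>) - gradF x0)"
    unfolding direction_def vr_direction_def noise_def i_def[symmetric] Q_def[symmetric] \<xi>_def frame_sketch_diff sum_subtractf scaleR_diff_right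
    by (simp add: algebra_simps)
  also have "norm \<dots> \<le> 3 / 2 * real CARD('d) * L * \<beta> \<tau>"
    using 1 2 norm_triangle_ineq[of "(1 / real b) *\<^sub>R (\<Sum>j=1..b. \<xi> j x - \<xi> j x0)" "fd_full e F x0 (\<beta> \<tau>) - gradF x0"]
    by linarith
  finally show ?thesis .
qed

lemma direction_error_square:
  assumes v: "valid (fresh \<tau> k) p"
  shows "(norm (direction \<tau> k p x0 x - gradF x))\<^sup>2 \<le> 2 * (norm (noise \<tau> k p x0 x))\<^sup>2 + 9 / 2 * (real CARD('d))\<^sup>2 * L\<^sup>2 * (\<beta> \<tau>)\<^sup>2"
proof -
  define r where "r = direction \<tau> k p x0 x - gradF x - noise \<tau> k p x0 x"
  have "(norm r)\<^sup>2 \<le> (3 / 2 * real CARD('d) * L * \<beta> \<tau>)\<^sup>2"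
    unfolding r_def by (intro power_mono direction_error_decomposition v) simp
  then have "(norm r)\<^sup>2 \<le> 9 / 4 * (real CARD('d))\<^sup>2 * L\<^sup>2 * (\<beta> \<tau>)\<^sup>2"
    by (simp add: power_mult_distrib power_divide)
  moreover have "(norm (noise \<tau> k p x0 x + r))\<^sup>2 \<le> 2 * (norm (noise \<tau> k p x0 x))\<^sup>2 + 2 * (norm r)\<^sup>2"
    by (rule norm_add_square_le)
  moreover have "noise \<tau> k p x0 x + r = direction \<tau> k p x0 x - gradF x" by (simp add: r_def)
  ultimately show ?thesis by simp
qed

text \<open>A step moves a bounded pair of centre and iterate by a bounded amount, because the gradients are
  Lipschitz and \<^const>\<open>prox\<close> is nonexpansive.\<close>

lemma X_Suc_bounded:
  assumes R0: "\<And>p. valid (past \<tau> k) p \<Longrightarrow> norm (X \<tau> 0 p) \<le> R0"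
    and R: "\<And>p. valid (past \<tau> k) p \<Longrightarrow> norm (X \<tau> k p) \<le> R" and k: "k < m"
  shows "\<exists>R'. \<forall>p. valid (past \<tau> (Suc k)) p \<longrightarrow> norm (X \<tau> (Suc k) p) \<le> R'"
proof (intro exI allI impI)
  fix p assume v: "valid (past \<tau> (Suc k)) p"
  have vf: "valid (fresh \<tau> k) p" and vp: "valid (past \<tau> k) p"
    using valid_subset[OF v] past_subset k by auto
  define x0 where "x0 = X \<tau> 0 p"
  define x where "x = X \<tau> k p"
  define v where "v = direction \<tau> k p x0 x"
  have b0: "norm x0 \<le> R0" and b1: "norm x \<le> R" using R0[OF vp] R[OF vp] by (auto simp: x0_def x_def)
  have "norm (noise \<tau> k p x0 x) \<le> (real CARD('d) + 1) * L * norm (x - x0)" by (rule noise_bound[OF vf])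
  also have "\<dots> \<le> (real CARD('d) + 1) * L * (R + R0)"
    using b0 b1 norm_triangle_ineq4[of x x0] L by (intro mult_left_mono) auto
  finally have noise: "norm (noise \<tau> k p x0 x) \<le> (real CARD('d) + 1) * L * (R + R0)" .
  have "L * norm (x - 0) \<le> L * R" using b1 L by (intro mult_left_mono) auto
  then have gr: "norm (gradF x) \<le> norm (gradF 0) + L * R"
    using gradF_lipschitz[of x 0] norm_triangle_ineq2[of "gradF x" "gradF 0"] by linarith
  have "norm v \<le> norm (v - gradF x - noise \<tau> k p x0 x) + norm (gradF x) + norm (noise \<tau> k p x0 x)"
    using norm_triangle_ineq[of "v - gradF x - noise \<tau> k p x0 x" "gradF x + noise \<tau> k p x0 x"]
      norm_triangle_ineq[of "gradF x" "noise \<tau> k p x0 x"] by (simp add: algebra_simps)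
  then have "norm v \<le> 3 / 2 * real CARD('d) * L * \<beta> \<tau> + (norm (gradF 0) + L * R) + (real CARD('d) + 1) * L * (R + R0)"
    using direction_error_decomposition[OF vf, of x0 x] noise gr unfolding v_def by linarith
  then have "\<gamma> * norm v \<le> \<gamma> * (3 / 2 * real CARD('d) * L * \<beta> \<tau> + (norm (gradF 0) + L * R) + (real CARD('d) + 1) * L * (R + R0))"
    using \<gamma> by (intro mult_left_mono) auto
  moreover have "norm (x - \<gamma> *\<^sub>R v) \<le> norm x + \<gamma> * norm v"
    using norm_triangle_ineq4[of x "\<gamma> *\<^sub>R v"] \<gamma> by simp
  moreover have "norm (prox \<gamma> h (x - \<gamma> *\<^sub>R v)) \<le> norm (prox \<gamma> h 0) + norm (x - \<gamma> *\<^sub>R v)"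
    using prox_nonexpansive[OF \<gamma>(1), of "x - \<gamma> *\<^sub>R v" 0]
      norm_triangle_ineq2[of "prox \<gamma> h (x - \<gamma> *\<^sub>R v)" "prox \<gamma> h 0"] by simp
  moreover have eq: "X \<tau> (Suc k) p = prox \<gamma> h (x - \<gamma> *\<^sub>R v)"
    by (simp add: X_Suc x_def x0_def v_def)
  ultimately show "norm (X \<tau> (Suc k) p) \<le> norm (prox \<gamma> h 0)
     + R + \<gamma> * (3 / 2 * real CARD('d) * L * \<beta> \<tau> + (norm (gradF 0) + L * R) + (real CARD('d) + 1) * L * (R + R0))"
    unfolding eq using b1 by linarith
qed

text \<open>The bound is uniform over all sample paths. All expectations below are thereby finite, which is
  what allows displacement terms to be cancelled.\<close>

lemma X_bounded:
  "k \<le> m \<Longrightarrow> \<exists>R. \<forall>p. valid (past \<tau> k) p \<longrightarrow> norm (X \<tau> k p) \<le> R"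
proof (induction \<tau> arbitrary: k)
  have inner: "\<exists>R. \<forall>p. valid (past \<tau> k) p \<longrightarrow> norm (X \<tau> k p) \<le> R"
    if start: "\<exists>R. \<forall>p. valid (past \<tau> 0) p \<longrightarrow> norm (X \<tau> 0 p) \<le> R" and "k \<le> m" for \<tau> k
    using \<open>k \<le> m\<close>
  proof (induction k)
    case 0 then show ?case using start by simp
  next
    case (Suc k)
    obtain R0 where R0: "\<And>p. valid (past \<tau> 0) p \<Longrightarrow> norm (X \<tau> 0 p) \<le> R0" using start by blast
    obtain R where "\<And>p. valid (past \<tau> k) p \<Longrightarrow> norm (X \<tau> k p) \<le> R" using Suc by auto
    moreover have "norm (X \<tau> 0 p) \<le> R0" if "valid (past \<tau> k) p" for p
      using R0 valid_subset[OF that] past_subset(1) by blast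
    ultimately show ?case using Suc.prems by (intro X_Suc_bounded) auto
  qed
  { case 0 then show ?case by (rule inner[rotated]) (auto simp: X_0_0) }
  { case (Suc \<tau>)
    obtain R where R: "\<And>p. valid (past \<tau> m) p \<Longrightarrow> norm (X \<tau> m p) \<le> R" using Suc.IH by blast
    have "norm (X (Suc \<tau>) 0 p) \<le> R" if "valid (past (Suc \<tau>) 0) p" for p
      unfolding X_Suc_0 using R valid_subset[OF that] past_subset(3) by blast
    then show ?case by (intro inner[OF _ Suc.prems]) blast }
qed

text \<open>The iterates depend on the past samples only; combined with the independence of disjoint blocks of
  samples, this replaces a filtration.\<close>

lemma X_cong:
  "k \<le> m \<Longrightarrow> (\<And>i. i \<in> past \<tau> k \<Longrightarrow> p i = q i) \<Longrightarrow> X \<tau> k p = X \<tau> k q"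
proof (induction \<tau> arbitrary: k)
  have dir: "direction \<tau> k p x0 x = direction \<tau> k q x0 x" if "\<And>i. i \<in> fresh \<tau> k \<Longrightarrow> p i = q i" for \<tau> k x0 x
    unfolding direction_def vr_direction_def
    using that by (auto simp: fresh_def intro!: sum.cong)
  have inner: "X \<tau> k p = X \<tau> k q" if "X \<tau> 0 p = X \<tau> 0 q" "k \<le> m" "\<And>i. i \<in> past \<tau> k \<Longrightarrow> p i = q i" for \<tau> k
    using that(2,3)
  proof (induction k)
    case 0 then show ?case using that(1) by simp
  next
    case (Suc k)
    have "X \<tau> k p = X \<tau> k q" 
      by (rule Suc.IH) (use Suc.prems past_subset(2)[of \<tau> k] in \<open>simp, blast\<close>)
    moreover have "direction \<tau> k p x0 x = direction \<tau> k q x0 x" for x0 x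
      using Suc.prems past_subset(4)[of k \<tau>] by (intro dir) auto
    ultimately show ?case using that(1) by (simp add: X_Suc)
  qed
  { case 0 show ?case by (rule inner) (use 0 in \<open>simp_all add: X_0_0\<close>) }
  { case (Suc \<tau>)
    have "X (Suc \<tau>) 0 p = X (Suc \<tau>) 0 q"
      unfolding X_Suc_0
    proof (rule Suc.IH)
      fix i assume "i \<in> past \<tau> m"
      then show "p i = q i" using Suc.prems(2) past_subset(1)[of "Suc \<tau>" k] past_subset(3)[of \<tau>] by blast
    qed simp
    then show ?case by (rule inner) (use Suc.prems in simp_all) }
qed

lemma h_X_finite: "h (X \<tau> k p) < \<infinity>"
proof -
  have prox_point: "h (X \<tau> (Suc k) p) < \<infinity>" for \<tau> k
    unfolding X_Suc by (rule h_prox_finite[OF \<gamma>(1)])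
  have "h (X \<tau> 0 p) < \<infinity>"
  proof (cases \<tau>)
    case 0 then show ?thesis using x00 by (simp add: X_0_0)
  next
    case (Suc \<tau>')
    then have "X \<tau> 0 p = X \<tau>' (Suc (m - 1)) p" using m by (simp add: X_Suc_0)
    then show ?thesis using prox_point by (simp only:)
  qed
  with prox_point show ?thesis by (cases k) auto
qed

abbreviation G :: "real^'d \<Rightarrow> real" where
  "G x \<equiv> (norm (gradient_mapping \<gamma> F h x))\<^sup>2"

abbreviation \<Delta> :: real where "\<Delta> \<equiv> 1 / 2 - L * \<gamma>"

text \<open>The coefficient that the descent inequality leaves in front of the squared step length.\<close>

abbreviation c :: real where "c \<equiv> 1 / (2 * \<gamma>) - L / 2"

lemma c_pos: "c > 0" "9 / (20 * \<gamma>) \<le> c"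
proof -
  have "\<gamma> * (9 / (20 * \<gamma>)) \<le> \<gamma> * c" using \<gamma> by (simp add: algebra_simps)
  then show "9 / (20 * \<gamma>) \<le> c" using \<gamma> by (simp only: mult_le_cancel_left_pos)
  moreover have "0 < 9 / (20 * \<gamma>)" using \<gamma> by simp
  ultimately show "c > 0" by linarith
qed

lemma one_step:
  assumes v: "valid (fresh \<tau> k) p"
  shows "F (X \<tau> (Suc k) p) + hr (X \<tau> (Suc k) p) + (\<gamma> * \<Delta> * G (X \<tau> k p) + c * (norm (X \<tau> (Suc k) p - X \<tau> k p))\<^sup>2)
    \<le> F (X \<tau> k p) + hr (X \<tau> k p) + (\<gamma> * (norm (noise \<tau> k p (X \<tau> 0 p) (X \<tau> k p)))\<^sup>2 + \<gamma> * (9 / 4 * (real CARD('d))\<^sup>2 * L\<^sup>2 * (\<beta> \<tau>)\<^sup>2))"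
proof -
  define v where "v = direction \<tau> k p (X \<tau> 0 p) (X \<tau> k p)"
  have "F (X \<tau> (Suc k) p) + hr (X \<tau> (Suc k) p) + \<gamma> * \<Delta> * G (X \<tau> k p) + c * (norm (X \<tau> (Suc k) p - X \<tau> k p))\<^sup>2
      \<le> F (X \<tau> k p) + hr (X \<tau> k p) + \<gamma> / 2 * (norm (v - gradF (X \<tau> k p)))\<^sup>2"
    unfolding X_Suc v_def
    by (rule inexact_prox_gradient_descent[OF GDERIV_F gradF_lipschitz \<gamma>(1) h_X_finite])
  also have "\<gamma> / 2 * (norm (v - gradF (X \<tau> k p)))\<^sup>2
      \<le> \<gamma> / 2 * (2 * (norm (noise \<tau> k p (X \<tau> 0 p) (X \<tau> k p)))\<^sup>2 + 9 / 2 * (real CARD('d))\<^sup>2 * L\<^sup>2 * (\<beta> \<tau>)\<^sup>2)"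
    unfolding v_def using \<gamma> by (intro mult_left_mono direction_error_square v) auto
  finally show ?thesis by (simp add: algebra_simps)
qed

text \<open>Telescoping over the inner loop, then trading the squared step lengths for squared displacements
  from the centre of the epoch.\<close>

lemma one_epoch:
  assumes v: "valid (past (Suc \<tau>) 0) p"
  shows "F (X (Suc \<tau>) 0 p) + hr (X (Suc \<tau>) 0 p)
      + (\<Sum>k<m. \<gamma> * \<Delta> * G (X \<tau> k p) + c / (real m)\<^sup>2 * (norm (X \<tau> k p - X \<tau> 0 p))\<^sup>2)
    \<le> F (X \<tau> 0 p) + hr (X \<tau> 0 p)
      + (\<Sum>k<m. \<gamma> * (norm (noise \<tau> k p (X \<tau> 0 p) (X \<tau> k p)))\<^sup>2 + \<gamma> * (9 / 4 * (real CARD('d))\<^sup>2 * L\<^sup>2 * (\<beta> \<tau>)\<^sup>2))"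
proof -
  have telescope: "F (X \<tau> r p) + hr (X \<tau> r p)
      + (\<Sum>k<r. \<gamma> * \<Delta> * G (X \<tau> k p) + c * (norm (X \<tau> (Suc k) p - X \<tau> k p))\<^sup>2)
    \<le> F (X \<tau> 0 p) + hr (X \<tau> 0 p)
      + (\<Sum>k<r. \<gamma> * (norm (noise \<tau> k p (X \<tau> 0 p) (X \<tau> k p)))\<^sup>2 + \<gamma> * (9 / 4 * (real CARD('d))\<^sup>2 * L\<^sup>2 * (\<beta> \<tau>)\<^sup>2))"
    if "r \<le> m" for r
    using that
  proof (induction r)
    case (Suc r)
    have "valid (fresh \<tau> r) p"
      by (rule valid_subset[OF v]) (use Suc.prems in \<open>auto simp: past_def fresh_def\<close>)
    from one_step[OF this] Suc show ?case by simp
  qed simp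
  have "c / (real m)\<^sup>2 * (\<Sum>k<m. (norm (X \<tau> k p - X \<tau> 0 p))\<^sup>2)
      \<le> c / (real m)\<^sup>2 * ((real m)\<^sup>2 * (\<Sum>k<m. (norm (X \<tau> (Suc k) p - X \<tau> k p))\<^sup>2))"
    using c_pos by (intro mult_left_mono sum_square_displacement_le) auto
  also have "\<dots> = c * (\<Sum>k<m. (norm (X \<tau> (Suc k) p - X \<tau> k p))\<^sup>2)" using m by simp
  finally have "(\<Sum>k<m. c / (real m)\<^sup>2 * (norm (X \<tau> k p - X \<tau> 0 p))\<^sup>2)
      \<le> (\<Sum>k<m. c * (norm (X \<tau> (Suc k) p - X \<tau> k p))\<^sup>2)" by (simp add: sum_distrib_left)
  with telescope[of m] show ?thesis unfolding X_Suc_0 sum.distrib by linarith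
qed

text \<open>The epochs are summed on each sample path, so the objective values cancel, except for the first
  and the last, before any expectation is taken.\<close>

lemma pathwise_descent:
  assumes v: "valid (past (Suc T) 0) p"
  shows "(\<Sum>\<tau>\<le>T. \<Sum>k<m. \<gamma> * \<Delta> * G (X \<tau> k p) + c / (real m)\<^sup>2 * (norm (X \<tau> k p - X \<tau> 0 p))\<^sup>2)
    \<le> F x00 + hr x00 - Fmin
      + (\<Sum>\<tau>\<le>T. \<Sum>k<m. \<gamma> * (norm (noise \<tau> k p (X \<tau> 0 p) (X \<tau> k p)))\<^sup>2 + \<gamma> * (9 / 4 * (real CARD('d))\<^sup>2 * L\<^sup>2 * (\<beta> \<tau>)\<^sup>2))"
    (is "(\<Sum>\<tau>\<le>T. ?A \<tau>) \<le> _ + (\<Sum>\<tau>\<le>T. ?B \<tau>)")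
proof -
  have "F (X r 0 p) + hr (X r 0 p) + (\<Sum>\<tau><r. ?A \<tau>) \<le> F x00 + hr x00 + (\<Sum>\<tau><r. ?B \<tau>)" if "r \<le> Suc T" for r
    using that
  proof (induction r)
    case 0 then show ?case by (simp add: X_0_0)
  next
    case (Suc r)
    have "valid (past (Suc r) 0) p"
      by (rule valid_subset[OF v]) (use Suc.prems in \<open>auto simp: past_def\<close>)
    from one_epoch[OF this] Suc show ?case by simp
  qed
  from this[of "Suc T"] Fmin[OF h_X_finite, of "Suc T" 0 p] show ?thesis
    by (simp add: lessThan_Suc_atMost)
qed

end

section \<open>Expected descent\<close>

text \<open>Conditioning on \<open>Z\<close> in the form of Fubini's theorem: since the joint law of \<open>Z\<close> and \<open>W\<close> is a
  product, an estimate for every frozen value of \<open>Z\<close> may be integrated.\<close>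

lemma (in prob_space) integral_le_by_freezing:
  fixes \<Phi> :: "'s \<times> 's \<Rightarrow> real"
  assumes ind: "indep_var S Z T W"
    and \<Phi> [measurable]: "\<Phi> \<in> borel_measurable (S \<Otimes>\<^sub>M T)"
    and \<Phi>_bnd: "\<And>z w. z \<in> space S \<Longrightarrow> w \<in> space T \<Longrightarrow> \<bar>\<Phi> (z, w)\<bar> \<le> B"
    and \<psi> [measurable]: "\<psi> \<in> borel_measurable S"
    and \<psi>_bnd: "\<And>z. z \<in> space S \<Longrightarrow> \<bar>\<psi> z\<bar> \<le> C"
    and le: "\<And>z. z \<in> space S \<Longrightarrow> expectation (\<lambda>\<omega>. \<Phi> (z, W \<omega>)) \<le> \<psi> z"
  shows "expectation (\<lambda>\<omega>. \<Phi> (Z \<omega>, W \<omega>)) \<le> expectation (\<lambda>\<omega>. \<psi> (Z \<omega>))"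
proof -
  have [measurable]: "Z \<in> measurable M S" "W \<in> measurable M T"
    using ind by (auto dest: indep_var_rv1 indep_var_rv2)
  have joint: "distr M S Z \<Otimes>\<^sub>M distr M T W = distr M (S \<Otimes>\<^sub>M T) (\<lambda>\<omega>. (Z \<omega>, W \<omega>))"
    using ind by (simp add: indep_var_distribution_eq)
  interpret Z: prob_space "distr M S Z" by (rule prob_space_distr) measurable
  interpret W: prob_space "distr M T W" by (rule prob_space_distr) measurable
  interpret ZW: pair_prob_space "distr M S Z" "distr M T W" ..
  have int: "integrable (distr M S Z \<Otimes>\<^sub>M distr M T W) \<Phi>"
    using \<Phi>_bnd by (intro ZW.integrable_const_bound[where B = B] AE_I2) (auto simp: space_pair_measure)
  have "expectation (\<lambda>\<omega>. \<Phi> (Z \<omega>, W \<omega>)) = integral\<^sup>L (distr M S Z \<Otimes>\<^sub>M distr M T W) \<Phi>"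
    unfolding joint by (subst integral_distr) auto
  also have "\<dots> = (\<integral>z. (\<integral>w. \<Phi> (z, w) \<partial>distr M T W) \<partial>distr M S Z)"
    by (rule ZW.integral_fst'[OF int, symmetric])
  also have "\<dots> \<le> (\<integral>z. \<psi> z \<partial>distr M S Z)"
  proof (rule integral_mono)
    show "integrable (distr M S Z) (\<lambda>z. \<integral>w. \<Phi> (z, w) \<partial>distr M T W)" by (rule ZW.integrable_fst'[OF int])
    show "integrable (distr M S Z) \<psi>"
      using \<psi>_bnd by (intro Z.integrable_const_bound[where B = C] AE_I2) auto
    fix z assume z: "z \<in> space (distr M S Z)"
    then have "(\<integral>w. \<Phi> (z, w) \<partial>distr M T W) = expectation (\<lambda>\<omega>. \<Phi> (z, W \<omega>))"
      by (intro integral_distr) auto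
    then show "(\<integral>w. \<Phi> (z, w) \<partial>distr M T W) \<le> \<psi> z" using le z by simp
  qed
  also have "\<dots> = expectation (\<lambda>\<omega>. \<psi> (Z \<omega>))" by (rule integral_distr) auto
  finally show ?thesis .
qed

lemma (in prob_space) expectation_double_sum:
  fixes A :: "'i \<Rightarrow> 'j \<Rightarrow> 'a \<Rightarrow> real"
  assumes A: "\<And>i j. j \<in> J \<Longrightarrow> integrable M (A i j)"
  shows "integrable M (\<lambda>\<omega>. \<Sum>i\<in>K. \<Sum>j\<in>J. A i j \<omega>)"
    and "expectation (\<lambda>\<omega>. \<Sum>i\<in>K. \<Sum>j\<in>J. A i j \<omega>) = (\<Sum>i\<in>K. \<Sum>j\<in>J. expectation (A i j))"
proof -
  have row: "integrable M (\<lambda>\<omega>. \<Sum>j\<in>J. A i j \<omega>)" for i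
    by (rule Bochner_Integration.integrable_sum) (rule A)
  show "integrable M (\<lambda>\<omega>. \<Sum>i\<in>K. \<Sum>j\<in>J. A i j \<omega>)"
    by (rule Bochner_Integration.integrable_sum) (rule row)
  have "expectation (\<lambda>\<omega>. \<Sum>i\<in>K. \<Sum>j\<in>J. A i j \<omega>) = (\<Sum>i\<in>K. expectation (\<lambda>\<omega>. \<Sum>j\<in>J. A i j \<omega>))"
    by (rule Bochner_Integration.integral_sum) (rule row)
  also have "\<dots> = (\<Sum>i\<in>K. \<Sum>j\<in>J. expectation (A i j))"
    by (rule sum.cong[OF refl], rule Bochner_Integration.integral_sum) (rule A)
  finally show "expectation (\<lambda>\<omega>. \<Sum>i\<in>K. \<Sum>j\<in>J. A i j \<omega>) = (\<Sum>i\<in>K. \<Sum>j\<in>J. expectation (A i j))" .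
qed

context vr_problem
begin

text \<open>The sampled component number takes countably many values, so measurability can be checked for each
  value separately.\<close>

lemma borel_measurable_indexed:
  fixes \<phi> :: "nat \<Rightarrow> real^'d \<Rightarrow> 'z::topological_space"
  assumes J: "J \<in> measurable N (count_space {1..n})"
    and \<phi>: "\<And>i. i \<in> {1..n} \<Longrightarrow> continuous_on UNIV (\<phi> i)"
    and x: "x \<in> borel_measurable N"
  shows "(\<lambda>\<omega>. \<phi> (J \<omega>) (x \<omega>)) \<in> borel_measurable N"
proof (rule measurable_compose_countable'[OF _ J])
  fix i assume "i \<in> {1..n}"
  then show "(\<lambda>\<omega>. \<phi> i (x \<omega>)) \<in> borel_measurable N"
    by (intro measurable_compose[OF x] borel_measurable_continuous_onI \<phi>)
qed simp

lemma continuous_on_of_lipschitz: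
  fixes g :: "real^'d \<Rightarrow> real^'d"
  assumes "\<And>x y. norm (g x - g y) \<le> L * norm (x - y)"
  shows "continuous_on UNIV g"
  unfolding continuous_on_iff
proof (intro ballI allI impI)
  fix x :: "real^'d" and \<epsilon> :: real assume \<epsilon>: "\<epsilon> > 0"
  have "dist (g y) (g x) < \<epsilon>" if "dist y x < \<epsilon> / L" for y
  proof -
    have "dist (g y) (g x) \<le> L * dist y x" using assms by (simp add: dist_norm)
    also have "\<dots> < \<epsilon>" using that L by (simp add: field_simps)
    finally show ?thesis .
  qed
  then show "\<exists>\<delta>>0. \<forall>y\<in>UNIV. dist y x < \<delta> \<longrightarrow> dist (g y) (g x) < \<epsilon>"
    using L \<epsilon> by (intro exI[of _ "\<epsilon> / L"]) auto
qed

lemma continuous_on_f: "i \<in> {1..n} \<Longrightarrow> continuous_on UNIV (f i)"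
  using f_diff by (auto intro!: continuous_at_imp_continuous_on differentiable_imp_continuous_within)

lemma continuous_on_F: "continuous_on UNIV F"
  unfolding avg_fun_def divide_inverse
  by (intro continuous_on_mult_right continuous_on_sum continuous_on_f)

lemma continuous_on_grad: "i \<in> {1..n} \<Longrightarrow> continuous_on UNIV (grad i)"
  by (intro continuous_on_of_lipschitz f_smooth)

lemma continuous_on_gradF: "continuous_on UNIV gradF"
  by (intro continuous_on_of_lipschitz gradF_lipschitz)

lemma gradient_F: "gradient F = gradF"
  by (rule ext) (rule gradient_eqI[OF GDERIV_F])

lemma continuous_on_gradient_mapping: "continuous_on UNIV (gradient_mapping \<gamma> F h)"
  unfolding gradient_mapping_def gradient_F
  by (intro continuous_intros continuous_on_compose2[OF continuous_on_prox[OF \<gamma>(1)]] continuous_on_gradF) auto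

lemma measurable_gradient_mapping [measurable]: "gradient_mapping \<gamma> F h \<in> borel_measurable borel"
  by (intro borel_measurable_continuous_onI continuous_on_gradient_mapping)

lemma measurable_sample:
  assumes "w \<in> measurable N P"
  shows "(\<lambda>\<omega>. fst (w \<omega>)) \<in> measurable N (count_space {1..n})"
    and "(\<lambda>\<omega>. snd (w \<omega>)) \<in> borel_measurable N"
proof -
  have "fst \<in> measurable P (count_space {1..n})"
    unfolding P_def using measurable_fst[of "uniform_count_measure {1..n}" H]
    by (simp add: uniform_count_measure_def measurable_cong_sets[OF refl sets_point_measure_count_space])
  then show "(\<lambda>\<omega>. fst (w \<omega>)) \<in> measurable N (count_space {1..n})"
    by (rule measurable_compose[OF assms])
  show "(\<lambda>\<omega>. snd (w \<omega>)) \<in> borel_measurable N"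
    by (rule measurable_compose[OF assms measurable_matrix])
qed

lemma measurable_direction:
  assumes p: "\<And>i. i \<in> fresh \<tau> k \<Longrightarrow> (\<lambda>\<omega>. p \<omega> i) \<in> measurable N P"
    and x0 [measurable]: "x0 \<in> borel_measurable N" and x [measurable]: "x \<in> borel_measurable N"
  shows "(\<lambda>\<omega>. direction \<tau> k (p \<omega>) (x0 \<omega>) (x \<omega>)) \<in> borel_measurable N"
proof -
  have fd: "(\<lambda>\<omega>. fd_orth e l (f (fst (p \<omega> (\<tau>, k, j)))) (y \<omega>) (snd (p \<omega> (\<tau>, k, j))) (\<beta> \<tau>)) \<in> borel_measurable N"
    if j: "j \<in> {1..b}" and y [measurable]: "y \<in> borel_measurable N" for j y
  proof -
    have w: "(\<lambda>\<omega>. p \<omega> (\<tau>, k, j)) \<in> measurable N P" using j by (intro p) (auto simp: fresh_def)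
    note J = measurable_sample(1)[OF w] and Q [measurable] = measurable_sample(2)[OF w]
    have f [measurable]: "(\<lambda>\<omega>. f (fst (p \<omega> (\<tau>, k, j))) (z \<omega>)) \<in> borel_measurable N"
      if "z \<in> borel_measurable N" for z
      by (rule borel_measurable_indexed[OF J continuous_on_f that])
    show ?thesis unfolding fd_orth_def by measurable
  qed
  have F [measurable]: "F \<in> borel_measurable borel"
    by (intro borel_measurable_continuous_onI continuous_on_F)
  have [measurable]: "(\<lambda>\<omega>. fd_full e F (x0 \<omega>) (\<beta> \<tau>)) \<in> borel_measurable N"
    unfolding fd_full_def by measurable
  show ?thesis
    unfolding direction_def vr_direction_def
    by (intro borel_measurable_add borel_measurable_scaleR borel_measurable_sum borel_measurable_diff fd x0 x) auto
qed

lemma measurable_noise: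
  assumes p: "\<And>i. i \<in> fresh \<tau> k \<Longrightarrow> (\<lambda>\<omega>. p \<omega> i) \<in> measurable N P"
    and x0 [measurable]: "x0 \<in> borel_measurable N" and x [measurable]: "x \<in> borel_measurable N"
  shows "(\<lambda>\<omega>. noise \<tau> k (p \<omega>) (x0 \<omega>) (x \<omega>)) \<in> borel_measurable N"
proof -
  have sk: "(\<lambda>\<omega>. frame_sketch e l (grad (fst (p \<omega> (\<tau>, k, j))) (x \<omega>) - grad (fst (p \<omega> (\<tau>, k, j))) (x0 \<omega>))
      (snd (p \<omega> (\<tau>, k, j)))) \<in> borel_measurable N" if j: "j \<in> {1..b}" for j
  proof -
    have w: "(\<lambda>\<omega>. p \<omega> (\<tau>, k, j)) \<in> measurable N P" using j by (intro p) (auto simp: fresh_def)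
    note J = measurable_sample(1)[OF w] and Q [measurable] = measurable_sample(2)[OF w]
    show ?thesis
      by (intro borel_measurable_frame_sketch Q borel_measurable_diff
          borel_measurable_indexed[OF J continuous_on_grad] x x0)
  qed
  have [measurable]: "gradF \<in> borel_measurable borel"
    by (intro borel_measurable_continuous_onI continuous_on_gradF)
  show ?thesis
    unfolding noise_def
    by (intro borel_measurable_scaleR borel_measurable_sum borel_measurable_diff sk) measurable
qed

lemma measurable_X:
  "k \<le> m \<Longrightarrow> (\<And>i. i \<in> past \<tau> k \<Longrightarrow> (\<lambda>\<omega>. p \<omega> i) \<in> measurable N P)
    \<Longrightarrow> (\<lambda>\<omega>. X \<tau> k (p \<omega>)) \<in> borel_measurable N"
proof (induction \<tau> arbitrary: k)
  have inner: "(\<lambda>\<omega>. X \<tau> k (p \<omega>)) \<in> borel_measurable N"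
    if "(\<lambda>\<omega>. X \<tau> 0 (p \<omega>)) \<in> borel_measurable N" "k \<le> m" "\<And>i. i \<in> past \<tau> k \<Longrightarrow> (\<lambda>\<omega>. p \<omega> i) \<in> measurable N P" for \<tau> k
    using that(2,3)
  proof (induction k)
    case 0 then show ?case using that(1) by simp
  next
    case (Suc k)
    have x: "(\<lambda>\<omega>. X \<tau> k (p \<omega>)) \<in> borel_measurable N"
      by (rule Suc.IH) (use Suc.prems past_subset(2)[of \<tau> k] in \<open>simp, blast\<close>)
    have v: "(\<lambda>\<omega>. direction \<tau> k (p \<omega>) (X \<tau> 0 (p \<omega>)) (X \<tau> k (p \<omega>))) \<in> borel_measurable N"
      using Suc.prems past_subset(4)[of k \<tau>] by (intro measurable_direction that(1) x) auto
    have "(\<lambda>\<omega>. X \<tau> k (p \<omega>) - \<gamma> *\<^sub>R direction \<tau> k (p \<omega>) (X \<tau> 0 (p \<omega>)) (X \<tau> k (p \<omega>))) \<in> borel_measurable N"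
      using x v by measurable
    then show ?case
      unfolding X_Suc
      by (rule measurable_compose) (intro borel_measurable_continuous_onI continuous_on_prox \<gamma>)
  qed
  { case 0 show ?case by (rule inner) (use 0 in \<open>simp_all add: X_0_0\<close>) }
  { case (Suc \<tau>)
    have "(\<lambda>\<omega>. X (Suc \<tau>) 0 (p \<omega>)) \<in> borel_measurable N"
      unfolding X_Suc_0
    proof (rule Suc.IH)
      fix i assume "i \<in> past \<tau> m"
      then show "(\<lambda>\<omega>. p \<omega> i) \<in> measurable N P"
        using Suc.prems(2) past_subset(1)[of "Suc \<tau>" k] past_subset(3)[of \<tau>] by blast
    qed simp
    then show ?case by (rule inner) (use Suc.prems in simp_all) }
qed

lemma noise_cong:
  assumes "\<And>i. i \<in> fresh \<tau> k \<Longrightarrow> p i = q i"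
  shows "noise \<tau> k p x0 x = noise \<tau> k q x0 x"
proof -
  have "p (\<tau>, k, j) = q (\<tau>, k, j)" if "j \<in> {1..b}" for j
    using that by (intro assms) (simp add: fresh_def)
  then show ?thesis unfolding noise_def by (auto intro!: sum.cong)
qed

end

locale vr_run = vr_problem h H e l n f L \<gamma> b m \<beta> x00 Fmin + M: prob_space M
  for h :: "real^'d \<Rightarrow> ereal" and H :: "(real^'d^'d) measure" and e l n f L \<gamma> b m \<beta> x00 Fmin
    and M :: "'w measure" +
  fixes W :: "nat \<times> nat \<times> nat \<Rightarrow> 'w \<Rightarrow> nat \<times> (real^'d^'d)"
  assumes W_indep: "M.indep_vars (\<lambda>_. P) W (UNIV \<times> {..<m} \<times> {1..b})"
    and W_distr: "\<And>i. i \<in> UNIV \<times> {..<m} \<times> {1..b} \<Longrightarrow> distr M P (W i) = P"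
begin

abbreviation path :: "'w \<Rightarrow> nat \<times> nat \<times> nat \<Rightarrow> nat \<times> (real^'d^'d)" where
  "path \<omega> \<equiv> \<lambda>i. W i \<omega>"

lemma fresh_subset: "k < m \<Longrightarrow> fresh \<tau> k \<subseteq> UNIV \<times> {..<m} \<times> {1..b}"
  by (auto simp: fresh_def)

lemma past_subset_index: "past \<tau> k \<subseteq> UNIV \<times> {..<m} \<times> {1..b}"
  by (auto simp: past_def)

lemma measurable_W: "i \<in> UNIV \<times> {..<m} \<times> {1..b} \<Longrightarrow> W i \<in> measurable M P"
  using W_indep by (auto simp: M.indep_vars_def)

lemma valid_path: "\<omega> \<in> space M \<Longrightarrow> A \<subseteq> UNIV \<times> {..<m} \<times> {1..b} \<Longrightarrow> valid A (path \<omega>)"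
  by (auto simp: valid_def dest: subsetD intro!: measurable_space[OF measurable_W])

text \<open>For fixed \<open>x0\<close> and \<open>x\<close> the noise is a centred average of \<open>b\<close> independent sketches.\<close>

lemma fresh_noise_second_moment:
  assumes k: "k < m"
  shows "M.expectation (\<lambda>\<omega>. (norm (noise \<tau> k (path \<omega>) x0 x))\<^sup>2)
    \<le> real CARD('d) / (real l * real b) * L\<^sup>2 * (norm (x - x0))\<^sup>2"
proof -
  define \<delta> where "\<delta> i = grad i x - grad i x0" for i
  define D where "D = L * norm (x - x0)"
  define Y where "Y = (\<lambda>i \<omega>. frame_sketch e l (\<delta> (fst (W i \<omega>))) (snd (W i \<omega>)))"
  have \<delta>: "norm (\<delta> i) \<le> D" if "i \<in> {1..n}" for i
    using f_smooth[OF that] by (simp add: \<delta>_def D_def)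
  have sk [measurable]: "(\<lambda>w. frame_sketch e l (\<delta> (fst w)) (snd w)) \<in> borel_measurable P" by measurable
  have fin: "finite (fresh \<tau> k)" "fresh \<tau> k \<noteq> {}" using b by (auto simp: fresh_def)
  have inj: "inj_on (\<lambda>j. (\<tau>, k, j)) {1..b}" by (auto simp: inj_on_def)
  have card: "card (fresh \<tau> k) = b" unfolding fresh_def card_image[OF inj] by simp
  have mean: "(1 / real n) *\<^sub>R (\<Sum>i=1..n. \<delta> i) = gradF x - gradF x0"
    by (simp add: \<delta>_def gradF_def sum_subtractf scaleR_diff_right)
  have law: "M.expectation (\<lambda>\<omega>. \<phi> (W i \<omega>)) = (\<integral>w. \<phi> w \<partial>P)"
    if "i \<in> fresh \<tau> k" "\<phi> \<in> borel_measurable P" for i and \<phi> :: "_ \<Rightarrow> 'z::{banach,second_countable_topology}"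
  proof -
    have i: "i \<in> UNIV \<times> {..<m} \<times> {1..b}" using fresh_subset[OF k] that by blast
    show ?thesis using integral_distr[OF measurable_W[OF i] that(2)] W_distr[OF i] by simp
  qed
  have eq: "noise \<tau> k (path \<omega>) x0 x = (1 / real (card (fresh \<tau> k))) *\<^sub>R (\<Sum>i\<in>fresh \<tau> k. Y i \<omega>) - (gradF x - gradF x0)" for \<omega>
    unfolding card unfolding noise_def fresh_def sum.reindex[OF inj] by (simp add: Y_def \<delta>_def)
  have "M.expectation (\<lambda>\<omega>. (norm (noise \<tau> k (path \<omega>) x0 x))\<^sup>2) \<le> (real CARD('d) / real l * D\<^sup>2) / real (card (fresh \<tau> k))"
    unfolding eq
  proof (rule M.average_variance_bound[OF fin])
    show "M.indep_vars (\<lambda>_. borel) Y (fresh \<tau> k)"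
      unfolding Y_def
      by (rule M.indep_vars_compose2[OF M.indep_vars_subset[OF W_indep fresh_subset[OF k]]]) measurable
    show "norm (Y i \<omega>) \<le> real CARD('d) * D" if "i \<in> fresh \<tau> k" "\<omega> \<in> space M" for i \<omega>
      unfolding Y_def
      using valid_path[OF that(2) fresh_subset[OF k]] that(1)
      by (intro index_sketch_bound \<delta>) (auto simp: valid_def)
    show "M.expectation (Y i) = gradF x - gradF x0" if "i \<in> fresh \<tau> k" for i
      unfolding Y_def law[OF that sk] mean[symmetric] by (rule index_sketch_unbiased) (rule \<delta>)
    show "M.expectation (\<lambda>\<omega>. (norm (Y i \<omega>))\<^sup>2) \<le> real CARD('d) / real l * D\<^sup>2" if "i \<in> fresh \<tau> k" for i
    proof -
      have "M.expectation (\<lambda>\<omega>. (norm (Y i \<omega>))\<^sup>2) = (\<integral>w. (norm (frame_sketch e l (\<delta> (fst w)) (snd w)))\<^sup>2 \<partial>P)"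
        unfolding Y_def by (rule law[OF that]) measurable
      also have "\<dots> \<le> real CARD('d) / real l * D\<^sup>2"
        by (rule index_sketch_second_moment) (rule \<delta>)
      finally show ?thesis .
    qed
  qed
  then show ?thesis by (simp add: card D_def power_mult_distrib mult.assoc)
qed

lemma iterate_bound_on_path:
  assumes "k \<le> m"
  obtains R where "\<And>\<omega>. \<omega> \<in> space M \<Longrightarrow> norm (X \<tau> k (path \<omega>)) \<le> R"
proof -
  from X_bounded[OF assms, of \<tau>] obtain R where R: "\<And>p. valid (past \<tau> k) p \<Longrightarrow> norm (X \<tau> k p) \<le> R"
    by blast
  show thesis by (rule that[of R]) (intro R valid_path past_subset_index)
qed

lemma measurable_X_path: "k \<le> m \<Longrightarrow> (\<lambda>\<omega>. X \<tau> k (path \<omega>)) \<in> borel_measurable M"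
  by (rule measurable_X) (auto intro!: measurable_W dest: subsetD[OF past_subset_index])

lemma integrable_displacement:
  assumes k: "k \<le> m"
  shows "integrable M (\<lambda>\<omega>. (norm (X \<tau> k (path \<omega>) - X \<tau> 0 (path \<omega>)))\<^sup>2)"
proof -
  obtain R where R: "\<And>\<omega>. \<omega> \<in> space M \<Longrightarrow> norm (X \<tau> k (path \<omega>)) \<le> R"
    using iterate_bound_on_path[OF k] by blast
  obtain R0 where R0: "\<And>\<omega>. \<omega> \<in> space M \<Longrightarrow> norm (X \<tau> 0 (path \<omega>)) \<le> R0"
    using iterate_bound_on_path[of 0] by blast
  note [measurable] = measurable_X_path[OF k] measurable_X_path[of 0]
  show ?thesis
  proof (rule M.integrable_const_bound[where B = "(R + R0)\<^sup>2"])
    show "AE \<omega> in M. norm ((norm (X \<tau> k (path \<omega>) - X \<tau> 0 (path \<omega>)))\<^sup>2) \<le> (R + R0)\<^sup>2"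
    proof (rule AE_I2)
      fix \<omega> assume \<omega>: "\<omega> \<in> space M"
      have "norm (X \<tau> k (path \<omega>) - X \<tau> 0 (path \<omega>)) \<le> R + R0"
        using R[OF \<omega>] R0[OF \<omega>] norm_triangle_ineq4[of "X \<tau> k (path \<omega>)" "X \<tau> 0 (path \<omega>)"] by linarith
      then show "norm ((norm (X \<tau> k (path \<omega>) - X \<tau> 0 (path \<omega>)))\<^sup>2) \<le> (R + R0)\<^sup>2"
        by (simp add: power_mono)
    qed
  qed measurable
qed

text \<open>The centre and the current iterate are functions of the past samples, hence independent of the
  fresh ones; the bound for fixed points may be applied with both of them frozen.\<close>

lemma noise_second_moment:
  assumes k: "k < m"
  shows "integrable M (\<lambda>\<omega>. (norm (noise \<tau> k (path \<omega>) (X \<tau> 0 (path \<omega>)) (X \<tau> k (path \<omega>))))\<^sup>2)"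
    and "M.expectation (\<lambda>\<omega>. (norm (noise \<tau> k (path \<omega>) (X \<tau> 0 (path \<omega>)) (X \<tau> k (path \<omega>))))\<^sup>2)
      \<le> real CARD('d) / (real l * real b) * L\<^sup>2
          * M.expectation (\<lambda>\<omega>. (norm (X \<tau> k (path \<omega>) - X \<tau> 0 (path \<omega>)))\<^sup>2)"
proof -
  let ?C = "real CARD('d) / (real l * real b) * L\<^sup>2"
  obtain R where R: "\<And>p. valid (past \<tau> k) p \<Longrightarrow> norm (X \<tau> k p) \<le> R"
    using X_bounded[of k \<tau>] k by auto
  obtain R1 where R1: "\<And>p. valid (past \<tau> 0) p \<Longrightarrow> norm (X \<tau> 0 p) \<le> R1"
    using X_bounded[of 0 \<tau>] by auto
  have R0: "norm (X \<tau> 0 p) \<le> R1" if "valid (past \<tau> k) p" for p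
    using R1 valid_subset[OF that past_subset(1)] .
  have displ: "norm (X \<tau> k p - X \<tau> 0 p) \<le> R + R1" if "valid (past \<tau> k) p" for p
    using R[OF that] R0[OF that] norm_triangle_ineq4[of "X \<tau> k p" "X \<tau> 0 p"] by linarith
  have nb: "norm (noise \<tau> k q (X \<tau> 0 p) (X \<tau> k p)) \<le> (real CARD('d) + 1) * L * (R + R1)"
    if "valid (past \<tau> k) p" "valid (fresh \<tau> k) q" for p q
    by (rule order_trans[OF noise_bound[OF that(2)]]) (use displ[OF that(1)] L in \<open>intro mult_left_mono, auto\<close>)
  show "integrable M (\<lambda>\<omega>. (norm (noise \<tau> k (path \<omega>) (X \<tau> 0 (path \<omega>)) (X \<tau> k (path \<omega>))))\<^sup>2)"
  proof (rule M.integrable_const_bound[where B = "((real CARD('d) + 1) * L * (R + R1))\<^sup>2"])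
    show "AE \<omega> in M. norm ((norm (noise \<tau> k (path \<omega>) (X \<tau> 0 (path \<omega>)) (X \<tau> k (path \<omega>))))\<^sup>2)
        \<le> ((real CARD('d) + 1) * L * (R + R1))\<^sup>2"
      using nb valid_path[OF _ past_subset_index] valid_path[OF _ fresh_subset[OF k]]
      by (intro AE_I2) (simp add: power_mono)
    have "(\<lambda>\<omega>. noise \<tau> k (path \<omega>) (X \<tau> 0 (path \<omega>)) (X \<tau> k (path \<omega>))) \<in> borel_measurable M"
      using k fresh_subset[OF k] by (intro measurable_noise measurable_W measurable_X_path) auto
    then show "(\<lambda>\<omega>. (norm (noise \<tau> k (path \<omega>) (X \<tau> 0 (path \<omega>)) (X \<tau> k (path \<omega>))))\<^sup>2) \<in> borel_measurable M"
      by measurable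
  qed
  \<comment> \<open>The past and the fresh block as random elements of product spaces.\<close>
  define S where "S = PiM (past \<tau> k) (\<lambda>_. P)"
  define T where "T = PiM (fresh \<tau> k) (\<lambda>_. P)"
  define Zp where "Zp \<omega> = restrict (path \<omega>) (past \<tau> k)" for \<omega>
  define Zf where "Zf \<omega> = restrict (path \<omega>) (fresh \<tau> k)" for \<omega>
  define \<Phi> where "\<Phi> = (\<lambda>(z, w). (norm (noise \<tau> k w (X \<tau> 0 z) (X \<tau> k z)))\<^sup>2)"
  define \<psi> where "\<psi> z = ?C * (norm (X \<tau> k z - X \<tau> 0 z))\<^sup>2" for z
  have vS: "z \<in> space S \<Longrightarrow> valid (past \<tau> k) z" and vT: "w \<in> space T \<Longrightarrow> valid (fresh \<tau> k) w" for z w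
    by (auto simp: S_def T_def space_PiM valid_def)
  have XS: "(\<lambda>z. X \<tau> k z) \<in> borel_measurable S" "(\<lambda>z. X \<tau> 0 z) \<in> borel_measurable S"
    using k past_subset(1)[of \<tau> k] unfolding S_def
    by (auto intro!: measurable_X measurable_component_singleton)
  have Xp: "X \<tau> k (Zp \<omega>) = X \<tau> k (path \<omega>)" "X \<tau> 0 (Zp \<omega>) = X \<tau> 0 (path \<omega>)" for \<omega>
    using k past_subset(1)[of \<tau> k] by (auto intro!: X_cong simp: Zp_def)
  have Nf: "noise \<tau> k (Zf \<omega>) x0 x = noise \<tau> k (path \<omega>) x0 x" for \<omega> x0 x
    by (rule noise_cong) (simp add: Zf_def)
  have "M.expectation (\<lambda>\<omega>. \<Phi> (Zp \<omega>, Zf \<omega>)) \<le> M.expectation (\<lambda>\<omega>. \<psi> (Zp \<omega>))"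
  proof (rule M.integral_le_by_freezing[where S = S and T = T and Z = Zp and W = Zf and \<Phi> = \<Phi> and \<psi> = \<psi>
        and B = "((real CARD('d) + 1) * L * (R + R1))\<^sup>2" and C = "?C * (R + R1)\<^sup>2"])
    show "M.indep_var S Zp T Zf"
      unfolding S_def T_def Zp_def[abs_def] Zf_def[abs_def]
      by (rule M.indep_var_restrict[OF W_indep _ past_subset_index fresh_subset[OF k]])
         (auto simp: past_def fresh_def)
    have "(\<lambda>a. noise \<tau> k (snd a) (X \<tau> 0 (fst a)) (X \<tau> k (fst a))) \<in> borel_measurable (S \<Otimes>\<^sub>M T)"
    proof (rule measurable_noise)
      show "(\<lambda>a. snd a i) \<in> measurable (S \<Otimes>\<^sub>M T) P" if "i \<in> fresh \<tau> k" for i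
        using that unfolding T_def
        by (intro measurable_compose[OF measurable_snd] measurable_component_singleton)
    qed (intro measurable_compose[OF measurable_fst] XS)+
    then have "(\<lambda>a. (norm (noise \<tau> k (snd a) (X \<tau> 0 (fst a)) (X \<tau> k (fst a))))\<^sup>2) \<in> borel_measurable (S \<Otimes>\<^sub>M T)"
      by measurable
    then show "\<Phi> \<in> borel_measurable (S \<Otimes>\<^sub>M T)" by (simp add: \<Phi>_def case_prod_beta')
    show "\<bar>\<Phi> (z, w)\<bar> \<le> ((real CARD('d) + 1) * L * (R + R1))\<^sup>2" if "z \<in> space S" "w \<in> space T" for z w
      using nb[OF vS[OF that(1)] vT[OF that(2)]] by (simp add: \<Phi>_def power_mono)
    show "\<psi> \<in> borel_measurable S" unfolding \<psi>_def[abs_def] using XS by measurable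
    show "\<bar>\<psi> z\<bar> \<le> ?C * (R + R1)\<^sup>2" if "z \<in> space S" for z
    proof -
      have "\<psi> z \<le> ?C * (R + R1)\<^sup>2"
        unfolding \<psi>_def using displ[OF vS[OF that]] by (intro mult_left_mono power_mono) auto
      moreover have "0 \<le> \<psi> z" by (simp add: \<psi>_def)
      ultimately show ?thesis by simp
    qed
    show "M.expectation (\<lambda>\<omega>. \<Phi> (z, Zf \<omega>)) \<le> \<psi> z" for z
      using fresh_noise_second_moment[OF k, of \<tau> "X \<tau> 0 z" "X \<tau> k z"] by (simp add: \<Phi>_def \<psi>_def Nf)
  qed
  then show "M.expectation (\<lambda>\<omega>. (norm (noise \<tau> k (path \<omega>) (X \<tau> 0 (path \<omega>)) (X \<tau> k (path \<omega>))))\<^sup>2)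
      \<le> ?C * M.expectation (\<lambda>\<omega>. (norm (X \<tau> k (path \<omega>) - X \<tau> 0 (path \<omega>)))\<^sup>2)"
    by (simp add: \<Phi>_def \<psi>_def Nf Xp)
qed

lemma integrable_gradient_mapping:
  assumes k: "k \<le> m"
  shows "integrable M (\<lambda>\<omega>. G (X \<tau> k (path \<omega>)))"
proof -
  obtain R where R: "\<And>\<omega>. \<omega> \<in> space M \<Longrightarrow> norm (X \<tau> k (path \<omega>)) \<le> R"
    using iterate_bound_on_path[OF k] by blast
  have "compact ((gradient_mapping \<gamma> F h) ` cball 0 R)"
    by (intro compact_continuous_image compact_cball continuous_on_subset[OF continuous_on_gradient_mapping]) simp
  then have "bounded (gradient_mapping \<gamma> F h ` cball 0 R)" by (rule compact_imp_bounded)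
  then obtain B where "\<And>y. y \<in> gradient_mapping \<gamma> F h ` cball 0 R \<Longrightarrow> norm y \<le> B"
    unfolding bounded_iff by blast
  then have B: "norm (gradient_mapping \<gamma> F h x) \<le> B" if "norm x \<le> R" for x
    using that by simp
  note [measurable] = measurable_X_path[OF k]
  show ?thesis
    using B R by (intro M.integrable_const_bound[where B = "B\<^sup>2"] AE_I2) (auto intro!: power_mono)
qed

text \<open>Taking expectations in the pathwise descent, the noise is dominated by the displacement terms. The
  hypothesis on the stepsize is equivalent to \<open>\<gamma> d L^2 / (l b) \<le> 1 / (100 \<gamma> m^2)\<close>, far below
  the available \<open>c / m^2 \<ge> 9 / (20 \<gamma> m^2)\<close>.\<close>

theorem expected_gradient_mapping_bound:
  assumes step: "100 * \<gamma>\<^sup>2 * L\<^sup>2 * (real m)\<^sup>2 * real CARD('d) \<le> real l * real b"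
  shows "(\<Sum>\<tau>\<le>T. \<Sum>k<m. M.expectation (\<lambda>\<omega>. G (X \<tau> k (path \<omega>))))
    \<le> (F x00 + hr x00 - Fmin) / (\<gamma> * \<Delta>) + 45 / 8 * (real CARD('d))\<^sup>2 * L\<^sup>2 * real m * (\<Sum>\<tau>\<le>T. (\<beta> \<tau>)\<^sup>2)"
proof -
  define g where "g \<tau> k = M.expectation (\<lambda>\<omega>. G (X \<tau> k (path \<omega>)))" for \<tau> k
  define V where "V \<tau> k = M.expectation (\<lambda>\<omega>. (norm (X \<tau> k (path \<omega>) - X \<tau> 0 (path \<omega>)))\<^sup>2)" for \<tau> k
  define N where "N \<tau> k = M.expectation (\<lambda>\<omega>. (norm (noise \<tau> k (path \<omega>) (X \<tau> 0 (path \<omega>)) (X \<tau> k (path \<omega>))))\<^sup>2)" for \<tau> k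
  define gap where "gap = F x00 + hr x00 - Fmin"
  define E where "E \<tau> = 9 / 4 * (real CARD('d))\<^sup>2 * L\<^sup>2 * (\<beta> \<tau>)\<^sup>2" for \<tau>
  have lb: "real l * real b > 0" using l b by simp
  have \<Delta>: "4 / 10 \<le> \<Delta>" using \<gamma> by simp
  have int: "integrable M (\<lambda>\<omega>. G (X \<tau> k (path \<omega>)))"
      "integrable M (\<lambda>\<omega>. (norm (X \<tau> k (path \<omega>) - X \<tau> 0 (path \<omega>)))\<^sup>2)"
      "integrable M (\<lambda>\<omega>. (norm (noise \<tau> k (path \<omega>) (X \<tau> 0 (path \<omega>)) (X \<tau> k (path \<omega>))))\<^sup>2)" if "k < m" for \<tau> k
    using that integrable_gradient_mapping integrable_displacement noise_second_moment(1) by auto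
  define A :: "nat \<Rightarrow> nat \<Rightarrow> 'w \<Rightarrow> real" where "A \<tau> k \<omega> = \<gamma> * \<Delta> * G (X \<tau> k (path \<omega>)) + c / (real m)\<^sup>2 * (norm (X \<tau> k (path \<omega>) - X \<tau> 0 (path \<omega>)))\<^sup>2" for \<tau> k \<omega>
  define B where "B \<tau> k \<omega> = \<gamma> * (norm (noise \<tau> k (path \<omega>) (X \<tau> 0 (path \<omega>)) (X \<tau> k (path \<omega>))))\<^sup>2 + \<gamma> * E \<tau>" for \<tau> k \<omega>
  have A: "integrable M (A \<tau> k)" "M.expectation (A \<tau> k) = \<gamma> * \<Delta> * g \<tau> k + c / (real m)\<^sup>2 * V \<tau> k" if "k \<in> {..<m}" for \<tau> k
    using int[of k \<tau>] that by (simp_all add: A_def[abs_def] g_def V_def)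
  have B: "integrable M (B \<tau> k)" "M.expectation (B \<tau> k) = \<gamma> * N \<tau> k + \<gamma> * E \<tau>" if "k \<in> {..<m}" for \<tau> k
    using int[of k \<tau>] that by (simp_all add: B_def[abs_def] N_def M.prob_space)
  note sumA = M.expectation_double_sum[where K = "{..T}" and J = "{..<m}" and A = A, OF A(1)]
    and sumB = M.expectation_double_sum[where K = "{..T}" and J = "{..<m}" and A = B, OF B(1)]
  have "M.expectation (\<lambda>\<omega>. \<Sum>\<tau>\<le>T. \<Sum>k<m. A \<tau> k \<omega>) \<le> M.expectation (\<lambda>\<omega>. gap + (\<Sum>\<tau>\<le>T. \<Sum>k<m. B \<tau> k \<omega>))"
  proof (rule integral_mono)
    show "integrable M (\<lambda>\<omega>. \<Sum>\<tau>\<le>T. \<Sum>k<m. A \<tau> k \<omega>)"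
      by (rule sumA(1))
    show "integrable M (\<lambda>\<omega>. gap + (\<Sum>\<tau>\<le>T. \<Sum>k<m. B \<tau> k \<omega>))"
      by (rule Bochner_Integration.integrable_add[OF M.integrable_const sumB(1)])
    fix \<omega> assume \<omega>: "\<omega> \<in> space M"
    show "(\<Sum>\<tau>\<le>T. \<Sum>k<m. A \<tau> k \<omega>) \<le> gap + (\<Sum>\<tau>\<le>T. \<Sum>k<m. B \<tau> k \<omega>)"
      unfolding A_def B_def gap_def E_def
      by (rule pathwise_descent[OF valid_path[OF \<omega> past_subset_index]])
  qed
  also have "\<dots> = gap + (\<Sum>\<tau>\<le>T. \<Sum>k<m. M.expectation (B \<tau> k))"
    using sumB by (simp add: M.prob_space)
  also have "\<dots> = gap + (\<Sum>\<tau>\<le>T. \<Sum>k<m. \<gamma> * N \<tau> k + \<gamma> * E \<tau>)"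
    by (simp add: B(2))
  also have "M.expectation (\<lambda>\<omega>. \<Sum>\<tau>\<le>T. \<Sum>k<m. A \<tau> k \<omega>) = (\<Sum>\<tau>\<le>T. \<Sum>k<m. M.expectation (A \<tau> k))"
    by (rule sumA(2))
  also have "\<dots> = (\<Sum>\<tau>\<le>T. \<Sum>k<m. \<gamma> * \<Delta> * g \<tau> k + c / (real m)\<^sup>2 * V \<tau> k)"
    by (intro sum.cong refl A(2))
  finally have main: "(\<Sum>\<tau>\<le>T. \<Sum>k<m. \<gamma> * \<Delta> * g \<tau> k + c / (real m)\<^sup>2 * V \<tau> k)
      \<le> gap + (\<Sum>\<tau>\<le>T. \<Sum>k<m. \<gamma> * N \<tau> k + \<gamma> * E \<tau>)" .
  \<comment> \<open>The noise costs less than what the displacement terms gain.\<close>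
  have absorb: "\<gamma> * N \<tau> k \<le> c / (real m)\<^sup>2 * V \<tau> k" if k: "k < m" for \<tau> k
  proof -
    have "\<gamma> * (real CARD('d) / (real l * real b) * L\<^sup>2) \<le> c / (real m)\<^sup>2"
    proof -
      have "100 * \<gamma> * (real m)\<^sup>2 > 0" using \<gamma> m by simp
      moreover have "(100 * \<gamma> * (real m)\<^sup>2) * (\<gamma> * (real CARD('d) / (real l * real b) * L\<^sup>2)) \<le> 1"
      proof -
        have "(100 * \<gamma> * (real m)\<^sup>2) * (\<gamma> * (real CARD('d) / (real l * real b) * L\<^sup>2))
            = (100 * \<gamma>\<^sup>2 * L\<^sup>2 * (real m)\<^sup>2 * real CARD('d)) / (real l * real b)"
          by (simp add: power2_eq_square)
        also have "\<dots> \<le> 1" using step lb by (simp only: divide_le_eq_1_pos)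
        finally show ?thesis .
      qed
      ultimately have "\<gamma> * (real CARD('d) / (real l * real b) * L\<^sup>2) \<le> 1 / (100 * \<gamma> * (real m)\<^sup>2)"
        by (simp add: pos_le_divide_eq mult.commute)
      also have "\<dots> \<le> 45 / (100 * \<gamma> * (real m)\<^sup>2)" using \<gamma> by (intro divide_right_mono) auto
      also have "\<dots> = (9 / (20 * \<gamma>)) / (real m)\<^sup>2" by simp
      also have "\<dots> \<le> c / (real m)\<^sup>2" using c_pos(2) by (intro divide_right_mono) auto
      finally show ?thesis .
    qed
    moreover have "0 \<le> V \<tau> k" unfolding V_def by (rule integral_nonneg_AE) simp
    ultimately have "\<gamma> * (real CARD('d) / (real l * real b) * L\<^sup>2) * V \<tau> k \<le> c / (real m)\<^sup>2 * V \<tau> k"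
      by (rule mult_right_mono)
    moreover have "\<gamma> * N \<tau> k \<le> \<gamma> * (real CARD('d) / (real l * real b) * L\<^sup>2 * V \<tau> k)"
      unfolding N_def V_def using \<gamma> by (intro mult_left_mono noise_second_moment(2) k) auto
    ultimately show ?thesis by (simp add: mult.assoc)
  qed
  have "(\<Sum>\<tau>\<le>T. \<Sum>k<m. \<gamma> * N \<tau> k) \<le> (\<Sum>\<tau>\<le>T. \<Sum>k<m. c / (real m)\<^sup>2 * V \<tau> k)"
    by (intro sum_mono absorb) simp
  with main have "(\<Sum>\<tau>\<le>T. \<Sum>k<m. \<gamma> * \<Delta> * g \<tau> k) \<le> gap + (\<Sum>\<tau>\<le>T. \<Sum>k<m. \<gamma> * E \<tau>)"
    unfolding sum.distrib by linarith
  moreover have "(\<Sum>\<tau>\<le>T. \<Sum>k<m. \<gamma> * \<Delta> * g \<tau> k) = \<gamma> * \<Delta> * (\<Sum>\<tau>\<le>T. \<Sum>k<m. g \<tau> k)"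
    by (simp only: sum_distrib_left)
  moreover have "(\<Sum>\<tau>\<le>T. \<Sum>k<m. \<gamma> * E \<tau>) = \<gamma> * (9 / 4 * (real CARD('d))\<^sup>2 * L\<^sup>2 * real m * (\<Sum>\<tau>\<le>T. (\<beta> \<tau>)\<^sup>2))"
    by (simp add: E_def sum_distrib_left mult_ac)
  ultimately have "\<gamma> * \<Delta> * (\<Sum>\<tau>\<le>T. \<Sum>k<m. g \<tau> k) \<le> gap + \<gamma> * (9 / 4 * (real CARD('d))\<^sup>2 * L\<^sup>2 * real m * (\<Sum>\<tau>\<le>T. (\<beta> \<tau>)\<^sup>2))"
    by simp
  moreover have "\<gamma> * \<Delta> > 0" using \<gamma>(1) \<Delta> by (intro mult_pos_pos) auto
  ultimately have "(\<Sum>\<tau>\<le>T. \<Sum>k<m. g \<tau> k)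
      \<le> (gap + \<gamma> * (9 / 4 * (real CARD('d))\<^sup>2 * L\<^sup>2 * real m * (\<Sum>\<tau>\<le>T. (\<beta> \<tau>)\<^sup>2))) / (\<gamma> * \<Delta>)"
    by (simp only: pos_le_divide_eq mult.commute)
  also have "\<dots> = gap / (\<gamma> * \<Delta>) + (9 / 4 * (real CARD('d))\<^sup>2 * L\<^sup>2 * real m * (\<Sum>\<tau>\<le>T. (\<beta> \<tau>)\<^sup>2)) / \<Delta>"
    using \<gamma> by (simp add: add_divide_distrib)
  also have "(9 / 4 * (real CARD('d))\<^sup>2 * L\<^sup>2 * real m * (\<Sum>\<tau>\<le>T. (\<beta> \<tau>)\<^sup>2)) / \<Delta>
      \<le> (9 / 4 * (real CARD('d))\<^sup>2 * L\<^sup>2 * real m * (\<Sum>\<tau>\<le>T. (\<beta> \<tau>)\<^sup>2)) / (4 / 10)"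
    using \<Delta> by (intro divide_left_mono) (auto intro!: mult_nonneg_nonneg sum_nonneg)
  finally show ?thesis by (simp add: g_def gap_def)
qed

end

section \<open>The convergence bound\<close>

text \<open>The bound \<open>1 / 10\<close> uses both \<open>l \<le> d\<close> and \<open>sqrt b \<le> m\<close>.\<close>

lemma stepsize_bounds:
  fixes L :: real
  assumes L: "L > 0" and l: "1 \<le> l" "l \<le> d" and b: "1 \<le> b" and m: "sqrt (real b) \<le> real m"
  shows "vr_stepsize L d l b m > 0" "L * vr_stepsize L d l b m \<le> 1 / 10"
    "2 / 5 \<le> vr_Delta L d l b m" "vr_Delta L d l b m \<le> 1 / 2"
    "100 * (vr_stepsize L d l b m)\<^sup>2 * L\<^sup>2 * (real m)\<^sup>2 * real d = real l * real b"
    "1 / (vr_stepsize L d l b m * real m) = 10 * L * sqrt (real d) / sqrt (real l * real b)"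
proof -
  have sb: "1 \<le> sqrt (real b)" using b by simp
  then have m0: "real m > 0" using m by linarith
  have d0: "real d > 0" using l by simp
  have lb: "real l * real b > 0" using l b by simp
  show pos: "vr_stepsize L d l b m > 0"
    using L m0 d0 lb by (simp add: vr_stepsize_def)
  have "sqrt (real l * real b) \<le> real m * sqrt (real d)"
    unfolding real_sqrt_mult mult.commute[of "real m"] using l m by (intro mult_mono) auto
  then have "sqrt (real l * real b) / (real m * sqrt (real d)) \<le> 1"
    using m0 d0 by (simp add: divide_le_eq_1_pos)
  moreover have Lg: "L * vr_stepsize L d l b m = (sqrt (real l * real b) / (real m * sqrt (real d))) / 10"
    using L by (simp add: vr_stepsize_def)
  ultimately show small: "L * vr_stepsize L d l b m \<le> 1 / 10" by simp
  then show "2 / 5 \<le> vr_Delta L d l b m" by (simp add: vr_Delta_def)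
  have "0 \<le> L * vr_stepsize L d l b m" using L pos by simp
  then show "vr_Delta L d l b m \<le> 1 / 2" by (simp add: vr_Delta_def)
  have "(vr_stepsize L d l b m)\<^sup>2 = (real l * real b) / (100 * L\<^sup>2 * (real m)\<^sup>2 * real d)"
    unfolding vr_stepsize_def power_divide power_mult_distrib using lb d0 by simp
  then show "100 * (vr_stepsize L d l b m)\<^sup>2 * L\<^sup>2 * (real m)\<^sup>2 * real d = real l * real b"
    using L m0 d0 by simp
  show "1 / (vr_stepsize L d l b m * real m) = 10 * L * sqrt (real d) / sqrt (real l * real b)"
    using m0 by (simp add: vr_stepsize_def)
qed

context vr_run
begin

lemma expected_nonneg: "0 \<le> M.expectation (\<lambda>\<omega>. G (X \<tau> k (path \<omega>)))"
  by (rule integral_nonneg_AE) simp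

text \<open>The extended nonnegative integrals are ordinary expectations, because the iterates are bounded.\<close>

lemma convergence_measure_eq:
  "convergence_measure M e n f h l b m \<gamma> \<beta> (\<lambda>\<tau> k j \<omega>. fst (W (\<tau>, k, j) \<omega>)) (\<lambda>\<tau> k j \<omega>. snd (W (\<tau>, k, j) \<omega>)) x00 T
    = ereal ((\<Sum>\<tau>\<le>T. \<Sum>k<m. M.expectation (\<lambda>\<omega>. G (X \<tau> k (path \<omega>)))) / (real (T + 1) * real m))"
proof -
  have nn: "(\<integral>\<^sup>+\<omega>. ennreal (G (X \<tau> k (path \<omega>))) \<partial>M) = ennreal (M.expectation (\<lambda>\<omega>. G (X \<tau> k (path \<omega>))))" if "k < m" for \<tau> k
    using that by (intro nn_integral_eq_integral integrable_gradient_mapping) auto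
  have "(\<Sum>\<tau>=0..T. \<Sum>k<m. \<integral>\<^sup>+\<omega>. ennreal (G (X \<tau> k (path \<omega>))) \<partial>M)
      = (\<Sum>\<tau>\<le>T. \<Sum>k<m. ennreal (M.expectation (\<lambda>\<omega>. G (X \<tau> k (path \<omega>)))))"
    unfolding atLeast0AtMost by (intro sum.cong refl nn) simp
  also have "\<dots> = ennreal (\<Sum>\<tau>\<le>T. \<Sum>k<m. M.expectation (\<lambda>\<omega>. G (X \<tau> k (path \<omega>))))"
    by (simp add: sum_ennreal expected_nonneg sum_nonneg)
  finally have sum: "(\<Sum>\<tau>=0..T. \<Sum>k<m. \<integral>\<^sup>+\<omega>. ennreal (G (X \<tau> k (path \<omega>))) \<partial>M)
      = ennreal (\<Sum>\<tau>\<le>T. \<Sum>k<m. M.expectation (\<lambda>\<omega>. G (X \<tau> k (path \<omega>))))" .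
  have "(of_nat ((T + 1) * m) :: ennreal) = ennreal (real (T + 1) * real m)"
    unfolding ennreal_of_nat_eq_real_of_nat of_nat_mult ..
  then have "ennreal (\<Sum>\<tau>\<le>T. \<Sum>k<m. M.expectation (\<lambda>\<omega>. G (X \<tau> k (path \<omega>)))) / of_nat ((T + 1) * m)
      = ennreal ((\<Sum>\<tau>\<le>T. \<Sum>k<m. M.expectation (\<lambda>\<omega>. G (X \<tau> k (path \<omega>)))) / (real (T + 1) * real m))"
    using m by (simp only:) (rule divide_ennreal, auto intro!: sum_nonneg expected_nonneg)
  moreover have "vr_szd e n f h l b m \<gamma> \<beta> (\<lambda>\<tau> k j. fst (W (\<tau>, k, j) \<omega>)) (\<lambda>\<tau> k j. snd (W (\<tau>, k, j) \<omega>)) x00 \<tau> k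
      = X \<tau> k (path \<omega>)" for \<tau> k \<omega>
    by (simp add: X_def)
  ultimately show ?thesis
    by (simp only: convergence_measure_def sum) (rule enn2ereal_ennreal, intro divide_nonneg_nonneg sum_nonneg expected_nonneg, auto)
qed

end

text \<open>The constant \<open>25\<close> is \<open>10 / (2 / 5)\<close>: the first factor comes from \<open>1 / (\<gamma> m)\<close>, the second from
  \<open>\<Delta> \<ge> 2 / 5\<close>.\<close>

lemma convergence_measure_bound:
  fixes f :: "nat \<Rightarrow> real^'d \<Rightarrow> real" and h :: "real^'d \<Rightarrow> ereal" and \<beta> :: "nat \<Rightarrow> real"
  assumes e: "bij_betw e {1..CARD('d)} Basis"
    and n: "1 \<le> n" and L: "L > 0"
    and f_diff: "\<And>i x. i \<in> {1..n} \<Longrightarrow> f i differentiable (at x)"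
    and f_smooth: "\<And>i x y. i \<in> {1..n} \<Longrightarrow> norm (gradient (f i) x - gradient (f i) y) \<le> L * norm (x - y)"
    and h: "\<And>x. h x \<noteq> -\<infinity>" "convex_ereal h" "proximable h"
    and Fmin: "\<And>x. h x < \<infinity> \<Longrightarrow> Fmin \<le> avg_fun n f x + real_of_ereal (h x)"
    and x00: "h x00 < \<infinity>"
    and l: "1 \<le> l" "l \<le> CARD('d)" and b: "1 \<le> b" and m: "sqrt (real b) \<le> real m"
    and samples: "vr_samples M n m b I Q"
    and \<beta>: "\<And>\<tau>. \<beta> \<tau> > 0"
  shows "convergence_measure M e n f h l b m (vr_stepsize L CARD('d) l b m) \<beta> I Q x00 T
    \<le> ereal (25 * (L * sqrt (real CARD('d)) / sqrt (real l * real b))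
          * ((avg_fun n f x00 + real_of_ereal (h x00) - Fmin) / (real T + 1))
        + 45 / 8 * (real CARD('d))\<^sup>2 * L\<^sup>2 * (\<Sum>\<tau>\<le>T. (\<beta> \<tau>)\<^sup>2) / (real T + 1))"
proof -
  define \<gamma> where "\<gamma> = vr_stepsize L CARD('d) l b m"
  note step = stepsize_bounds[OF L l b m, folded \<gamma>_def]
  have m1: "1 \<le> m" using m b by (cases m) auto
  from samples obtain H where M: "prob_space M" and H: "normalized_haar_orth H"
    and ind: "prob_space.indep_vars M (\<lambda>_. uniform_count_measure {1..n} \<Otimes>\<^sub>M H)
         (\<lambda>(\<tau>, k, j) \<omega>. (I \<tau> k j \<omega>, Q \<tau> k j \<omega>)) (UNIV \<times> {..<m} \<times> {1..b})"
    and law: "\<And>\<tau> k j. k < m \<Longrightarrow> j \<in> {1..b} \<Longrightarrow>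
         distr M (uniform_count_measure {1..n} \<Otimes>\<^sub>M H) (\<lambda>\<omega>. (I \<tau> k j \<omega>, Q \<tau> k j \<omega>))
           = uniform_count_measure {1..n} \<Otimes>\<^sub>M H"
    unfolding vr_samples_def by blast
  interpret H: prob_space H using H by (simp add: normalized_haar_orth_def)
  interpret S: index_frame_sampling H e l n
    by unfold_locales (use H e l n in auto)
  define W where "W = (\<lambda>(\<tau>, k, j) \<omega>. (I \<tau> k j \<omega>, Q \<tau> k j \<omega>))"
  interpret M: prob_space M by (rule M)
  interpret R: vr_run h H e l n f L \<gamma> b m \<beta> x00 Fmin M W
  proof unfold_locales
    show "M.indep_vars (\<lambda>_. S.P) W (UNIV \<times> {..<m} \<times> {1..b})"
      using ind by (simp add: W_def S.P_def)
    show "distr M S.P (W i) = S.P" if "i \<in> UNIV \<times> {..<m} \<times> {1..b}" for i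
    proof -
      obtain \<tau> k j where i: "i = (\<tau>, k, j)" by (cases i)
      show ?thesis unfolding S.P_def using law[of k j \<tau>] that by (simp add: W_def i)
    qed
  qed (use h L f_diff f_smooth step(1,2) b m1 \<beta> x00 Fmin in auto)
  define g where "g = avg_fun n f x00 + real_of_ereal (h x00) - Fmin"
  have g: "g \<ge> 0" using Fmin[OF x00] by (simp add: g_def)
  have \<Delta>: "2 / 5 \<le> 1 / 2 - L * \<gamma>" using step(2) by simp
  have Tm: "real (T + 1) * real m > 0" using m1 by simp
  let ?S = "\<Sum>\<tau>\<le>T. \<Sum>k<m. M.expectation (\<lambda>\<omega>. R.G (R.X \<tau> k (\<lambda>i. W i \<omega>)))"
  let ?B = "45 / 8 * (real CARD('d))\<^sup>2 * L\<^sup>2 * (\<Sum>\<tau>\<le>T. (\<beta> \<tau>)\<^sup>2)"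
  have "?S \<le> g / (\<gamma> * (1 / 2 - L * \<gamma>)) + ?B * real m"
    using R.expected_gradient_mapping_bound[of T] step(5) by (simp add: g_def mult_ac)
  also have "g / (\<gamma> * (1 / 2 - L * \<gamma>)) \<le> g / (\<gamma> * (2 / 5))"
    using g step(1) \<Delta> by (intro divide_left_mono mult_left_mono mult_pos_pos) auto
  also have "g / (\<gamma> * (2 / 5)) = 25 * (L * sqrt (real CARD('d)) / sqrt (real l * real b)) * g * real m"
  proof -
    have "g / (\<gamma> * (2 / 5)) = 5 / 2 * (1 / (\<gamma> * real m)) * g * real m" using m1 step(1) by simp
    also have "\<dots> = 25 * (L * sqrt (real CARD('d)) / sqrt (real l * real b)) * g * real m"
      unfolding step(6) by simp
    finally show ?thesis .
  qed
  finally have "?S \<le> (25 * (L * sqrt (real CARD('d)) / sqrt (real l * real b)) * g + ?B) * real m"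
    by (simp add: algebra_simps)
  then have "?S / (real (T + 1) * real m)
      \<le> ((25 * (L * sqrt (real CARD('d)) / sqrt (real l * real b)) * g + ?B) * real m) / (real (T + 1) * real m)"
    using Tm by (intro divide_right_mono) auto
  also have "\<dots> = 25 * (L * sqrt (real CARD('d)) / sqrt (real l * real b)) * (g / (real T + 1)) + ?B / (real T + 1)"
    using m1 by (simp add: add_divide_distrib add.commute)
  finally have "?S / (real (T + 1) * real m) \<le> \<dots>" .
  moreover have "convergence_measure M e n f h l b m \<gamma> \<beta> I Q x00 T = ereal (?S / (real (T + 1) * real m))"
    using R.convergence_measure_eq[of T] by (simp add: W_def)
  ultimately show ?thesis by (simp add: \<gamma>_def g_def)
qed

section \<open>Complexity\<close>

text \<open>Rounding up the lower bound for \<open>T + 1\<close> yields an admissible \<open>T\<close>. The rounding, and passing from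
  \<open>T\<close> to the number \<open>T + 1\<close> of outer iterations, account for the summand \<open>2\<close>.\<close>

lemma least_admissible_le:
  assumes L: "L > 0" and l: "1 \<le> l" "l \<le> d" and b: "1 \<le> b" and m: "sqrt (real b) \<le> real m"
    and g: "g \<ge> 0" and \<epsilon>: "\<epsilon> > 0"
  shows "real (LEAST T. admissible_T L (ereal g) d l b m \<epsilon> T) + 1
    \<le> 200 * L * g * (sqrt (real d) / sqrt (real l * real b)) / \<epsilon> + 2"
proof -
  define s where "s = sqrt (real d) / sqrt (real l * real b)"
  define K where "K = 80 * L * sqrt (real d) / (sqrt (real l * real b) * vr_Delta L d l b m) * g * (1 / \<epsilon>)"
  note step = stepsize_bounds[OF L l b m]
  have s: "s \<ge> 0" by (simp add: s_def)
  have K_eq: "K = (80 * L * s * g / \<epsilon>) / vr_Delta L d l b m" by (simp add: K_def s_def)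
  have K0: "K \<ge> 0" unfolding K_eq using L s g \<epsilon> step(3) by (intro divide_nonneg_nonneg mult_nonneg_nonneg) auto
  have adm: "admissible_T L (ereal g) d l b m \<epsilon> T \<longleftrightarrow> 1 \<le> T \<and> K \<le> real T + 1" for T
    by (simp add: admissible_T_def K_def)
  define T0 where "T0 = max 1 (nat \<lceil>K\<rceil>)"
  have "K \<le> real (nat \<lceil>K\<rceil>)" using K0 by linarith
  then have "admissible_T L (ereal g) d l b m \<epsilon> T0" by (auto simp: adm T0_def)
  then have "(LEAST T. admissible_T L (ereal g) d l b m \<epsilon> T) \<le> T0" by (rule Least_le)
  moreover have "real T0 \<le> K + 1" using K0 unfolding T0_def by linarith
  ultimately have "real (LEAST T. admissible_T L (ereal g) d l b m \<epsilon> T) + 1 \<le> K + 2" by linarith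
  also have "K \<le> (80 * L * s * g / \<epsilon>) / (2 / 5)"
    unfolding K_eq using L s g \<epsilon> step(3) by (intro divide_left_mono) (auto intro!: mult_nonneg_nonneg)
  finally show ?thesis by (simp add: s_def mult_ac)
qed

text \<open>The threshold for \<open>\<epsilon>\<close> is where the cost of the at most two surplus outer iterations falls below the
  claimed order; they account for the summand \<open>1\<close> in the constant.\<close>

lemma complexity_le:
  assumes L: "L > 0" and n: "1 \<le> n" and l: "1 \<le> l" "l \<le> d" and b: "1 \<le> b" and m: "sqrt (real b) \<le> real m"
    and g: "g \<ge> 0" and \<epsilon>: "\<epsilon> > 0" "\<epsilon> \<le> sqrt (real d) / sqrt (real l * real b) / 4"
  shows "real (vr_complexity L (ereal g) d n l b m \<epsilon>) \<le> (400 * L * g + 1) *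
      ((real n * (real d * sqrt (real d) / sqrt (real l * real b))
        + real m * real b * (real l + 1) * sqrt (real d) / sqrt (real l * real b)) * (1 / \<epsilon>))"
proof -
  define s where "s = sqrt (real d) / sqrt (real l * real b)"
  define N where "N = real n * real d + real m * real b * (real l + 1)"
  define T where "T = (LEAST T. admissible_T L (ereal g) d l b m \<epsilon> T)"
  have N: "N \<ge> 0" by (simp add: N_def)
  have T: "real T + 1 \<le> 200 * L * g * s / \<epsilon> + 2"
    unfolding T_def s_def by (rule least_admissible_le[OF L l b m g \<epsilon>(1)])
  have "real n * 1 \<le> real n * real d" using l by (intro mult_left_mono) auto
  then have cost: "real (n * (d + 1) + 2 * m * b * (l + 1)) \<le> 2 * N"
    by (simp add: N_def algebra_simps)
  have "real (vr_complexity L (ereal g) d n l b m \<epsilon>) = (real T + 1) * real (n * (d + 1) + 2 * m * b * (l + 1))"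
  proof -
    have "vr_complexity L (ereal g) d n l b m \<epsilon> = (T + 1) * (n * (d + 1) + 2 * m * b * (l + 1))"
      unfolding vr_complexity_def vr_evaluations_def T_def[symmetric] by simp
    then show ?thesis by (simp only: of_nat_mult of_nat_add of_nat_1)
  qed
  also have "\<dots> \<le> (200 * L * g * s / \<epsilon> + 2) * (2 * N)"
    by (rule mult_mono[OF T cost]) (use T in linarith)+
  also have "\<dots> = 400 * L * g * (s * N * (1 / \<epsilon>)) + 4 * N" by (simp add: algebra_simps)
  also have "4 * N \<le> s * N * (1 / \<epsilon>)"
  proof -
    have "4 \<le> s / \<epsilon>" using \<epsilon> by (simp add: s_def[symmetric] pos_le_divide_eq)
    then have "4 * N \<le> s / \<epsilon> * N" using N by (rule mult_right_mono)
    then show ?thesis by simp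
  qed
  also have "400 * L * g * (s * N * (1 / \<epsilon>)) + s * N * (1 / \<epsilon>) = (400 * L * g + 1) * (s * N * (1 / \<epsilon>))"
    by (simp add: algebra_simps)
  also have "s * N = real n * (real d * sqrt (real d) / sqrt (real l * real b))
        + real m * real b * (real l + 1) * sqrt (real d) / sqrt (real l * real b)"
    by (simp add: s_def N_def add_divide_distrib algebra_simps)
  finally show ?thesis by simp
qed

lemma eventually_complexity_le:
  assumes L: "L > 0" and n: "1 \<le> n" and l: "1 \<le> l" "l \<le> d" and b: "1 \<le> b" and m: "sqrt (real b) \<le> real m"
    and g: "g \<ge> 0"
  shows "\<forall>\<^sub>F \<epsilon> in at_right 0. real (vr_complexity L (ereal g) d n l b m \<epsilon>) \<le> (400 * L * g + 1) *
      ((real n * (real d * sqrt (real d) / sqrt (real l * real b))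
        + real m * real b * (real l + 1) * sqrt (real d) / sqrt (real l * real b)) * (1 / \<epsilon>))"
proof -
  have "0 < sqrt (real d) / sqrt (real l * real b) / 4" using l b by simp
  then show ?thesis
    unfolding eventually_at_right_field
    using complexity_le[OF assms] by (intro exI[of _ "sqrt (real d) / sqrt (real l * real b) / 4"]) auto
qed

text \<open>Write \<open>s = n powr (2 / 3)\<close>, so that \<open>n = s * sqrt s\<close>, while \<open>b\<close> and \<open>m\<close> lie within a factor \<open>2\<close> of
  \<open>s\<close> and \<open>sqrt b\<close>. The first summand is controlled by \<open>d \<le> c l\<close>, the second by \<open>l \<le> d\<close>: the two
  are balanced at this batch size.\<close>

lemma balanced_cost_le:
  fixes d n l b m :: nat
  assumes n: "1 \<le> n" and l: "1 \<le> l" "l \<le> d" "l = nat \<lceil>real d / c\<rceil>" and c: "c > 0"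
    and b: "b = nat \<lceil>real n powr (2 / 3)\<rceil>" and m: "m = nat \<lceil>sqrt (real b)\<rceil>"
  shows "real n * (real d * sqrt (real d) / sqrt (real l * real b))
        + real m * real b * (real l + 1) * sqrt (real d) / sqrt (real l * real b)
      \<le> (sqrt c + 8) * (real d * real n powr (2 / 3))"
proof -
  define s where "s = real n powr (2 / 3)"
  have s1: "1 \<le> s" using n by (simp add: s_def ge_one_powr_ge_zero)
  have bs: "s \<le> real b" "real b \<le> 2 * s" unfolding b s_def[symmetric] using s1 by linarith+
  have sb: "1 \<le> sqrt (real b)" using bs s1 by simp
  have ms: "real m \<le> 2 * sqrt (real b)" unfolding m using sb by linarith
  have d0: "real d > 0" "real l > 0" using l(1,2) by auto
  have "real d / c \<le> real l" unfolding l(3) by linarith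
  then have dl: "real d \<le> c * real l" using c by (simp add: pos_divide_le_eq mult.commute)
  have ns: "real n = s * sqrt s"
  proof -
    have "s * sqrt s = real n powr (2 / 3) * (real n powr (2 / 3)) powr (1 / 2)"
      using n by (simp add: s_def powr_half_sqrt)
    also have "\<dots> = real n" using n by (simp add: powr_powr flip: powr_add)
    finally show ?thesis ..
  qed
  define q where "q = sqrt (real l * real b)"
  have q: "q > 0" "q = sqrt (real l) * sqrt (real b)" using d0 bs s1 by (simp_all add: q_def real_sqrt_mult)
  \<comment> \<open>The denominator \<open>q\<close> is bounded from below in terms of \<open>d\<close> and \<open>s\<close>.\<close>
  have "sqrt (real d * s) \<le> sqrt (c * real l * real b)"
    using dl bs s1 c by (intro real_sqrt_le_mono mult_mono) auto
  then have key: "sqrt (real d) * sqrt s \<le> sqrt c * q" by (simp add: q real_sqrt_mult)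
  have "real n * (real d * sqrt (real d)) = real d * s * (sqrt (real d) * sqrt s)" by (simp add: ns)
  also have "\<dots> \<le> real d * s * (sqrt c * q)" using key d0 s1 by (intro mult_left_mono) auto
  finally have "real n * (real d * sqrt (real d)) \<le> (sqrt c * (real d * s)) * q" by (simp add: mult_ac)
  then have 1: "real n * (real d * sqrt (real d) / q) \<le> sqrt c * (real d * s)"
    using q by (simp add: pos_divide_le_eq)
  have "real m * real b * (real l + 1) * sqrt (real d)
      \<le> (2 * sqrt (real b)) * (2 * s) * (2 * real l) * sqrt (real d)"
    using ms bs d0 l by (intro mult_mono mult_right_mono) auto
  also have "\<dots> = 8 * s * sqrt (real l) * sqrt (real d) * q"
    unfolding q(2) using d0 real_sqrt_mult_self[of "real l"] by (simp add: mult_ac)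
  also have "\<dots> \<le> 8 * s * sqrt (real d) * sqrt (real d) * q"
    using l s1 q by (intro mult_right_mono mult_left_mono) auto
  also have "\<dots> = 8 * (real d * s) * q" using d0 by simp
  finally have 2: "real m * real b * (real l + 1) * sqrt (real d) / q \<le> 8 * (real d * s)"
    using q by (simp add: pos_divide_le_eq)
  from 1 2 show ?thesis by (simp add: q_def s_def distrib_right)
qed

section \<open>Convergence rates and complexity of the method\<close>

theorem corollary1:
  fixes f :: "nat \<Rightarrow> real^'d \<Rightarrow> real"
    and h :: "real^'d \<Rightarrow> ereal"
    and e :: "nat \<Rightarrow> real^'d"
    and x00 :: "real^'d"
    and L \<gamma> :: real
    and d n l b m :: nat
    and M :: "'w measure"
    and I :: "nat \<Rightarrow> nat \<Rightarrow> nat \<Rightarrow> 'w \<Rightarrow> nat"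
    and Q :: "nat \<Rightarrow> nat \<Rightarrow> nat \<Rightarrow> 'w \<Rightarrow> real^'d^'d"
    and gap :: ereal
    and \<eta> :: "(nat \<Rightarrow> real) \<Rightarrow> nat \<Rightarrow> ereal"
  assumes d: "d = CARD('d)"
    and e: "bij_betw e {1..d} Basis"
    and n: "1 \<le> n"
    and "L > 0"
    and f_diff: "\<forall>i\<in>{1..n}. \<forall>x. f i differentiable (at x)"
    and f_smooth: "\<forall>i\<in>{1..n}. \<forall>x y. norm (gradient (f i) x - gradient (f i) y) \<le> L * norm (x - y)"
    and h_proper: "\<forall>x. h x \<noteq> -\<infinity>"
    and h_convex: "convex_ereal h"
    and h_prox: "proximable h"
    and min_exists: "\<exists>z. objective n f h z = (INF x. objective n f h x)"
    and gap: "gap = objective n f h x00 - (INF x. objective n f h x)"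
    and l: "1 \<le> l" "l \<le> d"
    and b: "1 \<le> b"
    and m: "1 \<le> m" "sqrt (real b) \<le> real m"
    and \<gamma>: "\<gamma> = vr_stepsize L d l b m"
    and samples: "vr_samples M n m b I Q"
    and \<eta>: "\<And>\<beta> T. \<eta> \<beta> T = convergence_measure M e n f h l b m \<gamma> \<beta> I Q x00 T"
  shows
    "(\<forall>\<alpha> \<beta>. \<alpha> > 1 / 2 \<and> \<beta> > 0 \<longrightarrow>
       (\<exists>K::real. \<forall>T\<ge>1. \<eta> (\<lambda>\<tau>. \<beta> / real d * real (\<tau> + 1) powr (- \<alpha>)) T \<le>
          ereal (40 * (L * sqrt (real d) / sqrt (real l * real b))) * (gap / ereal (real T + 1))
          + ereal (K * (1 / (real T + 1)))))
     \<and>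
     (\<forall>\<beta>>0. \<forall>T\<ge>1. \<eta> (\<lambda>\<tau>. \<beta> / real d) T \<le>
        ereal (40 * (L * sqrt (real d) / sqrt (real l * real b))) * (gap / ereal (real T + 1))
        + ereal (4 * (3 * real d / (real l * real b) + 2 + 3 * real d) * (L\<^sup>2 / real d) * \<beta>\<^sup>2))
     \<and>
     (\<forall>\<epsilon>\<in>{0<..<1}. \<forall>T.
        admissible_T L gap d l b m \<epsilon> T \<longrightarrow>
        \<eta> (\<lambda>\<tau>. sqrt (\<epsilon> / (2 * (4 * (3 * real d / (real l * real b) + 2 + 3 * real d) * L\<^sup>2 * real d)))) T
          \<le> ereal \<epsilon>)
     \<and>
     (gap < \<infinity> \<longrightarrow>
       (\<exists>C. \<forall>d' n' l' b' m'. 1 \<le> n' \<and> 1 \<le> l' \<and> l' \<le> d' \<and> 1 \<le> b' \<and> sqrt (real b') \<le> real m' \<longrightarrow>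
          (\<forall>\<^sub>F \<epsilon> in at_right 0. real (vr_complexity L gap d' n' l' b' m' \<epsilon>) \<le>
             C * ((real n' * (real d' * sqrt (real d') / sqrt (real l' * real b'))
                  + real m' * real b' * (real l' + 1) * sqrt (real d') / sqrt (real l' * real b'))
                 * (1 / \<epsilon>)))))
     \<and>
     (gap < \<infinity> \<longrightarrow>
       (\<forall>c>0. \<exists>C. \<forall>d' n' l' b' m'. 1 \<le> n' \<and> 1 \<le> l' \<and> l' \<le> d' \<and>
          b' = nat \<lceil>real n' powr (2 / 3)\<rceil> \<and> m' = nat \<lceil>sqrt (real b')\<rceil> \<and> l' = nat \<lceil>real d' / c\<rceil> \<longrightarrow>
          (\<forall>\<^sub>F \<epsilon> in at_right 0. real (vr_complexity L gap d' n' l' b' m' \<epsilon>) \<le>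
             C * (real d' * real n' powr (2 / 3) * (1 / \<epsilon>)))))"
proof (intro conjI)
  define s where "s = sqrt (real d) / sqrt (real l * real b)"
  define A where "A = 3 * real d / (real l * real b) + 2 + 3 * real d"
  note step = stepsize_bounds[OF \<open>L > 0\<close> l b m(2)]
  have d1: "1 \<le> real d" using l by simp
  have s: "s > 0" using l b by (simp add: s_def)
  \<comment> \<open>Through this summand alone the prescribed constants, which carry a factor \<open>4\<close>, exceed \<open>45/8\<close>.\<close>
  have A: "3 * real d \<le> A" by (simp add: A_def)
  obtain x1 where x1: "h x1 < \<infinity>"
    using proximable_imp_finite_somewhere[OF h_prox] by blast
  have obj: "objective n f h x = ereal (avg_fun n f x + real_of_ereal (h x))" if "h x < \<infinity>" for x
    using that h_proper[rule_format, of x] unfolding objective_def by (cases "h x") auto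
  obtain z where z: "objective n f h z = (INF x. objective n f h x)" using min_exists by blast
  have z_le: "objective n f h z \<le> objective n f h x" for x unfolding z by (rule INF_lower) simp
  have "objective n f h z < \<infinity>" using z_le[of x1] obj[OF x1] by auto
  then have hz: "h z < \<infinity>" by (auto simp: objective_def)
  define Fmin where "Fmin = avg_fun n f z + real_of_ereal (h z)"
  have INF: "(INF x. objective n f h x) = ereal Fmin" unfolding z[symmetric] obj[OF hz] Fmin_def ..
  have Fmin: "Fmin \<le> avg_fun n f x + real_of_ereal (h x)" if "h x < \<infinity>" for x
    using z_le[of x] unfolding obj[OF hz] obj[OF that] Fmin_def by simp
  define g where "g = avg_fun n f x00 + real_of_ereal (h x00) - Fmin"
  \<comment> \<open>If \<open>x00\<close> lies outside the domain of \<open>h\<close>, the gap is infinite and the rates hold trivially.\<close>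
  have gap_finite: "gap = ereal g" "g \<ge> 0" "h x00 < \<infinity>" if "gap < \<infinity>"
  proof -
    show hx: "h x00 < \<infinity>"
    proof (rule ccontr)
      assume "\<not> h x00 < \<infinity>"
      then have "h x00 = \<infinity>" by simp
      then show False using that by (simp add: gap INF objective_def)
    qed
    show "gap = ereal g" unfolding gap INF obj[OF hx] g_def by simp
    show "g \<ge> 0" using Fmin[OF hx] by (simp add: g_def)
  qed
  have gap_infinite: "gap = \<infinity>" if "\<not> gap < \<infinity>" using that by simp
  have bound: "\<eta> \<beta> T \<le> ereal (25 * (L * s) * (g / (real T + 1))
      + 45 / 8 * (real d)\<^sup>2 * L\<^sup>2 * (\<Sum>\<tau>\<le>T. (\<beta> \<tau>)\<^sup>2) / (real T + 1))"
    if fin: "gap < \<infinity>" and \<beta>: "\<And>\<tau>. \<beta> \<tau> > 0" for \<beta> T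
    using convergence_measure_bound[OF e[unfolded d] n \<open>L > 0\<close> f_diff[rule_format] f_smooth[rule_format]
        h_proper[rule_format] h_convex h_prox Fmin gap_finite(3)[OF fin] l(1) l(2)[unfolded d] b m(2) samples \<beta>, where T = T]
    unfolding \<eta> \<gamma> d g_def s_def by simp
  have bound40: "\<eta> \<beta> T \<le> ereal (40 * (L * sqrt (real d) / sqrt (real l * real b))) * (gap / ereal (real T + 1))
      + ereal (45 / 8 * (real d)\<^sup>2 * L\<^sup>2 * (\<Sum>\<tau>\<le>T. (\<beta> \<tau>)\<^sup>2) / (real T + 1))"
    if \<beta>: "\<And>\<tau>. \<beta> \<tau> > 0" for \<beta> T
  proof (cases "gap < \<infinity>")
    case True
    have "25 * (L * s) * (g / (real T + 1)) \<le> 40 * (L * s) * (g / (real T + 1))"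
      using gap_finite(2)[OF True] \<open>L > 0\<close> s by (intro mult_right_mono divide_nonneg_nonneg) auto
    then have "\<eta> \<beta> T \<le> ereal (40 * (L * s) * (g / (real T + 1))
      + 45 / 8 * (real d)\<^sup>2 * L\<^sup>2 * (\<Sum>\<tau>\<le>T. (\<beta> \<tau>)\<^sup>2) / (real T + 1))"
      by (intro order_trans[OF bound[OF True \<beta>]]) simp
    then show ?thesis by (simp add: gap_finite(1)[OF True] s_def)
  next
    case False
    have "40 * (L * s) > 0" using s \<open>L > 0\<close> by simp
    then have pos: "40 * (L * sqrt (real d) / sqrt (real l * real b)) > 0" by (simp add: s_def)
    have inf: "ereal a * (\<infinity> / ereal (real T + 1)) = \<infinity>" if "a > 0" for a :: real
      using that by simp
    show ?thesis unfolding gap_infinite[OF False] inf[OF pos] by simp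
  qed
  have const_sum: "x * (\<Sum>\<tau>\<le>T. y) / (real T + 1) = x * y" for x y :: real and T :: nat
  proof -
    have "(\<Sum>\<tau>\<le>T. y) = (real T + 1) * y" by (simp add: add.commute)
    then show ?thesis by (simp add: divide_eq_eq)
  qed
  show "\<forall>\<alpha> \<beta>. \<alpha> > 1 / 2 \<and> \<beta> > 0 \<longrightarrow>
       (\<exists>K::real. \<forall>T\<ge>1. \<eta> (\<lambda>\<tau>. \<beta> / real d * real (\<tau> + 1) powr (- \<alpha>)) T \<le>
          ereal (40 * (L * sqrt (real d) / sqrt (real l * real b))) * (gap / ereal (real T + 1))
          + ereal (K * (1 / (real T + 1))))"
  proof (intro allI impI, elim conjE)
    fix \<alpha> \<beta> :: real assume \<alpha>: "\<alpha> > 1 / 2" and \<beta>: "\<beta> > 0"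
    define B where "B \<tau> = \<beta> / real d * real (\<tau> + 1) powr (- \<alpha>)" for \<tau> :: nat
    have B_pos: "B \<tau> > 0" for \<tau> using \<beta> d1 by (simp add: B_def)
    have "summable (\<lambda>\<tau>. real \<tau> powr (- 2 * \<alpha>))" using \<alpha> by (simp add: summable_real_powr_iff)
    then have "summable (\<lambda>\<tau>. (\<beta> / real d)\<^sup>2 * real (\<tau> + 1) powr (- 2 * \<alpha>))"
      by (intro summable_mult) (rule summable_ignore_initial_segment)
    moreover have "(B \<tau>)\<^sup>2 = (\<beta> / real d)\<^sup>2 * real (\<tau> + 1) powr (- 2 * \<alpha>)" for \<tau>
      by (simp add: B_def power_mult_distrib power_divide power2_eq_square flip: powr_add)
    ultimately have summ: "summable (\<lambda>\<tau>. (B \<tau>)\<^sup>2)" by simp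
    define K where "K = 45 / 8 * (real d)\<^sup>2 * L\<^sup>2 * (\<Sum>\<tau>. (B \<tau>)\<^sup>2)"
    have "\<eta> B T \<le> ereal (40 * (L * sqrt (real d) / sqrt (real l * real b))) * (gap / ereal (real T + 1))
          + ereal (K * (1 / (real T + 1)))" for T
    proof -
      have "(\<Sum>\<tau>\<le>T. (B \<tau>)\<^sup>2) \<le> (\<Sum>\<tau>. (B \<tau>)\<^sup>2)" by (intro sum_le_suminf summ) auto
      then have "45 / 8 * (real d)\<^sup>2 * L\<^sup>2 * (\<Sum>\<tau>\<le>T. (B \<tau>)\<^sup>2) / (real T + 1) \<le> K / (real T + 1)"
        unfolding K_def by (intro divide_right_mono mult_left_mono) auto
      then show ?thesis by (intro order_trans[OF bound40[OF B_pos]] add_left_mono) simp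
    qed
    then show "\<exists>K. \<forall>T\<ge>1. \<eta> (\<lambda>\<tau>. \<beta> / real d * real (\<tau> + 1) powr (- \<alpha>)) T \<le>
          ereal (40 * (L * sqrt (real d) / sqrt (real l * real b))) * (gap / ereal (real T + 1))
          + ereal (K * (1 / (real T + 1)))"
      unfolding B_def by blast
  qed
  show "\<forall>\<beta>>0. \<forall>T\<ge>1. \<eta> (\<lambda>\<tau>. \<beta> / real d) T \<le>
        ereal (40 * (L * sqrt (real d) / sqrt (real l * real b))) * (gap / ereal (real T + 1))
        + ereal (4 * (3 * real d / (real l * real b) + 2 + 3 * real d) * (L\<^sup>2 / real d) * \<beta>\<^sup>2)"
  proof (intro allI impI)
    fix \<beta> :: real and T :: nat assume \<beta>: "\<beta> > 0"
    have "45 / 8 * (real d)\<^sup>2 * L\<^sup>2 * (\<Sum>\<tau>\<le>T. (\<beta> / real d)\<^sup>2) / (real T + 1) = 45 / 8 * L\<^sup>2 * \<beta>\<^sup>2"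
      unfolding const_sum using d1 by (simp add: power_divide)
    also have "\<dots> \<le> 4 * (3 * real d) * (L\<^sup>2 / real d) * \<beta>\<^sup>2" using d1 by (simp add: mult_right_mono)
    also have "\<dots> \<le> 4 * A * (L\<^sup>2 / real d) * \<beta>\<^sup>2" using A by (intro mult_right_mono) auto
    finally show "\<eta> (\<lambda>\<tau>. \<beta> / real d) T \<le>
        ereal (40 * (L * sqrt (real d) / sqrt (real l * real b))) * (gap / ereal (real T + 1))
        + ereal (4 * (3 * real d / (real l * real b) + 2 + 3 * real d) * (L\<^sup>2 / real d) * \<beta>\<^sup>2)"
      unfolding A_def[symmetric] using \<beta> d1
      by (intro order_trans[OF bound40[of "\<lambda>_. \<beta> / real d"]] add_left_mono) auto
  qed
  show "\<forall>\<epsilon>\<in>{0<..<1}. \<forall>T.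
        admissible_T L gap d l b m \<epsilon> T \<longrightarrow>
        \<eta> (\<lambda>\<tau>. sqrt (\<epsilon> / (2 * (4 * (3 * real d / (real l * real b) + 2 + 3 * real d) * L\<^sup>2 * real d)))) T
          \<le> ereal \<epsilon>"
  proof (intro ballI allI impI)
    fix \<epsilon> :: real and T :: nat assume \<epsilon>: "\<epsilon> \<in> {0<..<1}" and adm: "admissible_T L gap d l b m \<epsilon> T"
    define C where "C = 4 * A * L\<^sup>2 * real d"
    define \<Delta> where "\<Delta> = vr_Delta L d l b m"
    have \<Delta>: "0 < \<Delta>" "\<Delta> \<le> 1 / 2" using step(3,4) by (auto simp: \<Delta>_def)
    have "12 * (real d)\<^sup>2 * L\<^sup>2 = 4 * (3 * real d) * L\<^sup>2 * real d" by (simp add: power2_eq_square)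
    also have "\<dots> \<le> C" unfolding C_def using A by (intro mult_right_mono) auto
    finally have C: "12 * (real d)\<^sup>2 * L\<^sup>2 \<le> C" .
    moreover have "12 * (real d)\<^sup>2 * L\<^sup>2 > 0" using d1 \<open>L > 0\<close> by simp
    ultimately have C0: "C > 0" by linarith
    have coef: "ereal (80 * L * sqrt (real d) / (sqrt (real l * real b) * vr_Delta L d l b m)) = ereal (80 * L * s / \<Delta>)"
      by (simp add: s_def \<Delta>_def)
    have coef0: "80 * L * s / \<Delta> > 0" using \<open>L > 0\<close> s \<Delta> by simp
    have fin: "gap < \<infinity>"
    proof (rule ccontr)
      assume "\<not> gap < \<infinity>"
      then have inf: "gap = \<infinity>" by (rule gap_infinite)
      have "\<not> ereal x * \<infinity> * ereal (1 / \<epsilon>) \<le> ereal (real T + 1)" if "x > 0" for x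
        using that \<epsilon> by simp
      from this[OF coef0] show False using adm unfolding admissible_T_def coef inf by (elim conjE notE)
    qed
    have "80 * L * s / \<Delta> * g * (1 / \<epsilon>) \<le> real T + 1"
      using adm unfolding admissible_T_def coef gap_finite(1)[OF fin] by simp
    moreover have "160 * (L * s * g) / \<epsilon> \<le> 80 * L * s / \<Delta> * g * (1 / \<epsilon>)"
    proof -
      have "80 * (L * s * g / \<epsilon>) / (1 / 2) \<le> 80 * (L * s * g / \<epsilon>) / \<Delta>"
        using \<Delta> \<epsilon> \<open>L > 0\<close> s gap_finite(2)[OF fin] by (intro divide_left_mono) (auto intro!: mult_nonneg_nonneg)
      then show ?thesis by (simp add: mult_ac)
    qed
    ultimately have "160 * (L * s * g) / \<epsilon> \<le> real T + 1" by linarith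
    then have "160 * (L * s * g) \<le> \<epsilon> * (real T + 1)" using \<epsilon> by (simp add: pos_divide_le_eq mult.commute)
    moreover have "0 \<le> \<epsilon> * (real T + 1)" using \<epsilon> by simp
    ultimately have "25 * (L * s) * g \<le> \<epsilon> / 2 * (real T + 1)" by simp
    then have 1: "25 * (L * s) * (g / (real T + 1)) \<le> \<epsilon> / 2" by (simp add: pos_divide_le_eq)
    define r where "r = sqrt (\<epsilon> / (2 * C))"
    have r: "r > 0" "r\<^sup>2 = \<epsilon> / (2 * C)" using \<epsilon> C0 by (auto simp: r_def)
    have "45 / 8 * (real d)\<^sup>2 * L\<^sup>2 * (\<Sum>\<tau>\<le>T. r\<^sup>2) / (real T + 1) = 45 / 8 * (real d)\<^sup>2 * L\<^sup>2 * r\<^sup>2"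
      by (rule const_sum)
    also have "\<dots> \<le> 12 * (real d)\<^sup>2 * L\<^sup>2 * r\<^sup>2" by (intro mult_right_mono) auto
    also have "\<dots> \<le> C * r\<^sup>2" using C by (intro mult_right_mono) auto
    also have "\<dots> = \<epsilon> / 2" using C0 by (simp add: r)
    finally have 2: "45 / 8 * (real d)\<^sup>2 * L\<^sup>2 * (\<Sum>\<tau>\<le>T. r\<^sup>2) / (real T + 1) \<le> \<epsilon> / 2" .
    have "\<eta> (\<lambda>_. r) T \<le> ereal (25 * (L * s) * (g / (real T + 1))
        + 45 / 8 * (real d)\<^sup>2 * L\<^sup>2 * (\<Sum>\<tau>\<le>T. r\<^sup>2) / (real T + 1))"
      by (rule bound[OF fin r(1)])
    also have "\<dots> \<le> ereal \<epsilon>" using 1 2 by simp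
    finally show "\<eta> (\<lambda>\<tau>. sqrt (\<epsilon> / (2 * (4 * (3 * real d / (real l * real b) + 2 + 3 * real d) * L\<^sup>2 * real d)))) T
          \<le> ereal \<epsilon>"
      unfolding r_def C_def A_def .
  qed
  show "gap < \<infinity> \<longrightarrow>
       (\<exists>C. \<forall>d' n' l' b' m'. 1 \<le> n' \<and> 1 \<le> l' \<and> l' \<le> d' \<and> 1 \<le> b' \<and> sqrt (real b') \<le> real m' \<longrightarrow>
          (\<forall>\<^sub>F \<epsilon> in at_right 0. real (vr_complexity L gap d' n' l' b' m' \<epsilon>) \<le>
             C * ((real n' * (real d' * sqrt (real d') / sqrt (real l' * real b'))
                  + real m' * real b' * (real l' + 1) * sqrt (real d') / sqrt (real l' * real b'))
                 * (1 / \<epsilon>))))"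
  proof
    assume fin: "gap < \<infinity>"
    show "\<exists>C. \<forall>d' n' l' b' m'. 1 \<le> n' \<and> 1 \<le> l' \<and> l' \<le> d' \<and> 1 \<le> b' \<and> sqrt (real b') \<le> real m' \<longrightarrow>
          (\<forall>\<^sub>F \<epsilon> in at_right 0. real (vr_complexity L gap d' n' l' b' m' \<epsilon>) \<le>
             C * ((real n' * (real d' * sqrt (real d') / sqrt (real l' * real b'))
                  + real m' * real b' * (real l' + 1) * sqrt (real d') / sqrt (real l' * real b'))
                 * (1 / \<epsilon>)))"
      unfolding gap_finite(1)[OF fin]
      by (intro exI[of _ "400 * L * g + 1"] allI impI, elim conjE)
         (rule eventually_complexity_le[OF \<open>L > 0\<close> _ _ _ _ _ gap_finite(2)[OF fin]])
  qed
  show "gap < \<infinity> \<longrightarrow>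
       (\<forall>c>0. \<exists>C. \<forall>d' n' l' b' m'. 1 \<le> n' \<and> 1 \<le> l' \<and> l' \<le> d' \<and>
          b' = nat \<lceil>real n' powr (2 / 3)\<rceil> \<and> m' = nat \<lceil>sqrt (real b')\<rceil> \<and> l' = nat \<lceil>real d' / c\<rceil> \<longrightarrow>
          (\<forall>\<^sub>F \<epsilon> in at_right 0. real (vr_complexity L gap d' n' l' b' m' \<epsilon>) \<le>
             C * (real d' * real n' powr (2 / 3) * (1 / \<epsilon>))))"
  proof (intro impI allI)
    fix c :: real assume fin: "gap < \<infinity>" and c: "c > 0"
    show "\<exists>C. \<forall>d' n' l' b' m'. 1 \<le> n' \<and> 1 \<le> l' \<and> l' \<le> d' \<and>
          b' = nat \<lceil>real n' powr (2 / 3)\<rceil> \<and> m' = nat \<lceil>sqrt (real b')\<rceil> \<and> l' = nat \<lceil>real d' / c\<rceil> \<longrightarrow>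
          (\<forall>\<^sub>F \<epsilon> in at_right 0. real (vr_complexity L gap d' n' l' b' m' \<epsilon>) \<le>
             C * (real d' * real n' powr (2 / 3) * (1 / \<epsilon>)))"
      unfolding gap_finite(1)[OF fin]
    proof (intro exI[of _ "(400 * L * g + 1) * (sqrt c + 8)"] allI impI, elim conjE)
      fix d' n' l' b' m' :: nat
      assume n': "1 \<le> n'" and l': "1 \<le> l'" "l' \<le> d'" and b': "b' = nat \<lceil>real n' powr (2 / 3)\<rceil>"
        and m': "m' = nat \<lceil>sqrt (real b')\<rceil>" and l'': "l' = nat \<lceil>real d' / c\<rceil>"
      have "1 \<le> real n' powr (2 / 3)" using n' by (simp add: ge_one_powr_ge_zero)
      then have b1: "1 \<le> b'" unfolding b' by linarith
      have m1: "sqrt (real b') \<le> real m'" unfolding m' by linarith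
      have "\<forall>\<^sub>F \<epsilon> in at_right (0::real). 0 < \<epsilon>" by (simp add: eventually_at_right_less)
      with eventually_complexity_le[OF \<open>L > 0\<close> n' l' b1 m1 gap_finite(2)[OF fin]]
      show "\<forall>\<^sub>F \<epsilon> in at_right 0. real (vr_complexity L (ereal g) d' n' l' b' m' \<epsilon>) \<le>
             (400 * L * g + 1) * (sqrt c + 8) * (real d' * real n' powr (2 / 3) * (1 / \<epsilon>))"
      proof eventually_elim
        case (elim \<epsilon>)
        note elim(1)
        also have "(400 * L * g + 1) * ((real n' * (real d' * sqrt (real d') / sqrt (real l' * real b'))
            + real m' * real b' * (real l' + 1) * sqrt (real d') / sqrt (real l' * real b')) * (1 / \<epsilon>))
          \<le> (400 * L * g + 1) * ((sqrt c + 8) * (real d' * real n' powr (2 / 3)) * (1 / \<epsilon>))"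
          using balanced_cost_le[OF n' l' l'' c b' m'] elim(2) \<open>L > 0\<close> gap_finite(2)[OF fin]
          by (intro mult_left_mono mult_right_mono) auto
        finally show ?case by (simp add: mult_ac)
      qed
    qed
  qed
qed

end
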